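(* Let $A\in\mathbb{R}^{n\times n}$ be arbitrary. (i) Let $\mathcal P_{\mathrm{VCS}}^\infty$ denote the set of optimal solutions to the infinite-horizon VCS problem: minimize $-\log\det W_\infty(p)$ subject to $p\in\Delta$, $W_\infty(p)\succ O$. For every $T>0$ select any optimal solution $p_{\mathrm{VCS}}^T$ to the finite-horizon VCS problem: minimize $-\log\det\widetilde W(p;T)$ subject to $p\in\Delta$, $\widetilde W(p;T)\succ O$. Then every cluster point of $p_{\mathrm{VCS}}^T$ as $T\to\infty$ belongs to $\mathcal P_{\mathrm{VCS}}^\infty$, and $$\inf_{q\in\mathcal P_{\mathrm{VCS}}^\infty}\|p_{\mathrm{VCS}}^T-q\|\to0\quad\text{as }T\to\infty.$$ (ii) Suppose that $A$ has at least one eigenvalue with negative real part. Let $\mathcal P_{\mathrm{AECS}}^\infty$ denote the set of optimal solutions to the infinite-horizon AECS problem: minimize $\mathrm{tr}\bigl(Q^{-*}\,\mathrm{diag}(W_-(p)^{-1},O,O)\,Q^{-1}\bigr)$ subject to $p\in\Delta$, $W_-(p)\succ O$. For every $T>0$ select any optimal solution $p_{\mathrm{AECS}}^T$ to the finite-horizon AECS problem: minimize $\mathrm{tr}\bigl(\widetilde W(p;T)^{-1}\bigr)$ subject to $p\in\Delta$, $\widetilde W(p;T)\succ O$. Then every cluster point of $p_{\mathrm{AECS}}^T$ as $T\to\infty$ belongs to $\mathcal P_{\mathrm{AECS}}^\infty$, and $$\inf_{q\in\mathcal P_{\mathrm{AECS}}^\infty}\|p_{\mathrm{AECS}}^T-q\|\to0\quad\text{as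 }T\to\infty.$$
   Context: Notation: $\Delta=\{p\in\mathbb{R}^n\mid p_i\ge0,\ \sum_ip_i=1\}$; $\|\cdot\|$ is the Euclidean norm; $X\succ O$ means $X$ is Hermitian positive definite; $X^*$ is the conjugate transpose, $X^{-*}=(X^{-1})^*$; $\mathrm{diag}$ of square matrices is the block-diagonal matrix; $I_k$ is the identity and $N_k$ is the $k\times k$ nilpotent Jordan block with ones on the superdiagonal. Blocks of size zero are omitted. A cluster point of $p^T$ as $T\to\infty$ is a limit of $p^{T_k}$ along some sequence $T_k\to\infty$. $\widetilde W(p;T)=\int_0^T \mathrm{e}^{At}\mathrm{diag}(p)\,\mathrm{e}^{A^\top t}\,\mathrm{d}t$. Jordan form: fix a Jordan decomposition $Q^{-1}AQ=J=\mathrm{diag}(J_1,\dots,J_m)$, $Q\in\mathbb{C}^{n\times n}$ invertible, $J_i=\lambda_iI_{n_i}+N_{n_i}\in\mathbb{C}^{n_i\times n_i}$. Let $m_-,m_0,m_+$ be the numbers of Jordan blocks with $\mathrm{Re}(\lambda_i)<0$, $=0$, $>0$. The blocks are ordered so that $\mathrm{Re}(\lambda_i)<0$ for $i\le m_-$, $\mathrm{Re}(\lambda_i)=0$ for $m_-<i\le m_-+m_0$, $\mathrm{Re}(\lambda_i)>0$ for $i>m_-+m_0$, and $\mathrm{Im}(\lambda_{m_-+1})\le\cdots\le\mathrm{Im}(\lambda_{m_-+m_0})$. Let $n_-,n_0,n_+$ be the total sizes of the blocks in the three groups and $J_-,J_0,J_+$ the corresponding diagonal blocks of $J$. Infinite-horizon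 scaled Gramian: for $p\in\mathbb{R}^n$ put $\widetilde B=Q^{-1}\mathrm{diag}(p)Q^{-*}$, partitioned as $(\widetilde B_{i,j})_{i,j=1}^m$ with $\widetilde B_{i,j}\in\mathbb{C}^{n_i\times n_j}$, and also as $(\widetilde B_{\alpha,\beta})_{\alpha,\beta\in\{-,0,+\}}$ with $\widetilde B_{\alpha,\beta}\in\mathbb{C}^{n_\alpha\times n_\beta}$. Then $W_\infty(p)=\mathrm{diag}(W_-(p),W_0(p),W_+(p))$, where: - $W_-(p)$ and $W_+(p)$ are the unique solutions of $J_-W_-(p)+W_-(p)J_-^*+\widetilde B_{-,-}=O$ and $(-J_+)W_+(p)+W_+(p)(-J_+^* )+\widetilde B_{+,+}=O$. - For $m_-<i,j\le m_-+m_0$, $\widetilde b_{i,j}$ is the $(n_i,n_j)$ (lower-right) entry of $\widetilde B_{i,j}$, and $C_{i,j}\in\mathbb{R}^{n_i\times n_j}$ has $(a,b)$ entry $\frac{1}{(n_i-a)!\,(n_j-b)!\,(n_i-a+n_j-b+1)}$. - $\lambda_1',\dots,\lambda_{m_0'}'$ are the distinct values among $\lambda_{m_-+1},\dots,\lambda_{m_-+m_0}$, ordered by strictly increasing imaginary part, and $m_0^{(\ell)}$ is the number of Jordan blocks with eigenvalue $\lambda_\ell'$. With $\alpha=m_-+m_0^{(1)}+\cdots+m_0^{(\ell-1)}$ and $\beta=\alpha+m_0^{(\ell)}$, $W_0^{(\ell)}(p)$ is the block matrix $(\widetilde b_{i,j}C_{i,j})_{i,j=\alpha+1}^{\beta}$,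 and $W_0(p)=\mathrm{diag}(W_0^{(1)}(p),\dots,W_0^{(m_0')}(p))$. In $\mathrm{diag}(W_-(p)^{-1},O,O)$ the zero blocks have sizes $n_0\times n_0$ and $n_+\times n_+$. *)

theory Defs
  imports
    "HOL-Analysis.Henstock_Kurzweil_Integration"
    "HOL-Library.Extended_Real"
    "Jordan_Normal_Form.Jordan_Normal_Form"
    "Jordan_Normal_Form.Gauss_Jordan_Elimination"
    "Jordan_Normal_Form.Schur_Decomposition"
begin

hide_type (open) Finite_Cartesian_Product.vec
hide_const (open) Finite_Cartesian_Product.vec
no_notation Finite_Cartesian_Product.vec_nth (infixl \<open>$\<close> 90)

section \<open>Matrices and vectors\<close>

text \<open>Meaningful for invertible square matrices only, see \<open>mat_inv\<close> below.\<close>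

definition mat_inv :: "'a::field mat \<Rightarrow> 'a mat" where
  "mat_inv X = the (mat_inverse X)"

lemma mat_inv:
  assumes "X \<in> carrier_mat n n" "invertible_mat X"
  shows "mat_inv X \<in> carrier_mat n n"
    and "mat_inv X * X = 1\<^sub>m n" and "X * mat_inv X = 1\<^sub>m n"
proof -
  obtain Y where Y: "X * Y = 1\<^sub>m n" "Y * X = 1\<^sub>m (dim_row Y)"
    using assms unfolding invertible_mat_def inverts_mat_def by auto
  have "dim_col (X * Y) = n" "dim_col (Y * X) = dim_row Y"
    using Y by simp_all
  then have "Y \<in> carrier_mat n n"
    using assms(1) by auto
  then have "X \<in> Units (ring_mat TYPE('a) n ())"
    using assms(1) Y unfolding Units_def ring_mat_def by auto
  then obtain Z where "mat_inverse X = Some Z"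
    using mat_inverse(1)[OF assms(1), of "()"] by (cases "mat_inverse X") auto
  then show "mat_inv X \<in> carrier_mat n n" "mat_inv X * X = 1\<^sub>m n" "X * mat_inv X = 1\<^sub>m n"
    using mat_inverse(2)[OF assms(1)] unfolding mat_inv_def by auto
qed

definition mat_trace :: "'a::comm_monoid_add mat \<Rightarrow> 'a" where
  "mat_trace X = (\<Sum>i<dim_row X. X $$ (i, i))"

text \<open>Hermitian positive definite. For complex numbers \<open>0 < z\<close> means that \<open>z\<close> is real and
  positive; for real matrices \<open>mat_adjoint\<close> is the transpose and conjugation is the identity.\<close>

definition pos_def :: "'a::conjugatable_ordered_field mat \<Rightarrow> bool" where
  "pos_def X \<longleftrightarrow> square_mat X \<and> mat_adjoint X = X \<and>
     (\<forall>v \<in> carrier_vec (dim_row X). v \<noteq> 0\<^sub>v (dim_row X) \<longrightarrow> 0 < (X *\<^sub>v v) \<bullet>c v)"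

definition diag_of_vec :: "'a::zero Matrix.vec \<Rightarrow> 'a mat" where
  "diag_of_vec p = mat_diag (dim_vec p) (\<lambda>i. p $ i)"

definition mat_exp :: "real mat \<Rightarrow> real mat" where
  "mat_exp X = mat (dim_row X) (dim_row X) (\<lambda>(i, j). \<Sum>k. (X ^\<^sub>m k) $$ (i, j) / fact k)"

definition euclid_norm :: "real Matrix.vec \<Rightarrow> real" where
  "euclid_norm v = sqrt (\<Sum>i<dim_vec v. (v $ i)\<^sup>2)"

definition prob_simplex :: "nat \<Rightarrow> real Matrix.vec set" where
  "prob_simplex n = {p \<in> carrier_vec n. (\<forall>i<n. 0 \<le> p $ i) \<and> (\<Sum>i<n. p $ i) = 1}"

text \<open>\<open>q\<close> is a cluster point of \<open>p T\<close> as \<open>T \<rightarrow> \<infinity>\<close>, in \<open>n\<close>-dimensional Euclidean space.\<close>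

definition cluster_point :: "nat \<Rightarrow> (real \<Rightarrow> real Matrix.vec) \<Rightarrow> real Matrix.vec \<Rightarrow> bool" where
  "cluster_point n p q \<longleftrightarrow> q \<in> carrier_vec n \<and>
     (\<exists>\<tau>::nat \<Rightarrow> real. (\<forall>k. \<tau> k > 0) \<and> filterlim \<tau> at_top sequentially \<and>
        (\<lambda>k. euclid_norm (p (\<tau> k) - q)) \<longlonglongrightarrow> 0)"

text \<open>The distance of a point to a set; the infimum is taken in the extended reals, so that it is
  \<open>\<infinity>\<close> (and not an arbitrary real) for the empty set.\<close>

definition dist_to_set :: "real Matrix.vec \<Rightarrow> real Matrix.vec set \<Rightarrow> ereal" where
  "dist_to_set p S = (INF q\<in>S. ereal (euclid_norm (p - q)))"

text \<open>Block matrices: \<open>block_index ns\<close> lists, in order, the pairs (block number, position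
  inside the block) of the rows of a matrix partitioned into blocks of sizes \<open>ns\<close>. In
  \<open>block_mat ns F\<close> the block \<open>F i j\<close> is the one of size \<open>ns ! i \<times> ns ! j\<close>.\<close>

definition block_index :: "nat list \<Rightarrow> (nat \<times> nat) list" where
  "block_index ns = [(i, a). i \<leftarrow> [0..<length ns], a \<leftarrow> [0..<ns ! i]]"

definition block_mat :: "nat list \<Rightarrow> (nat \<Rightarrow> nat \<Rightarrow> 'a mat) \<Rightarrow> 'a mat" where
  "block_mat ns F = mat (sum_list ns) (sum_list ns) (\<lambda>(r, c).
     let (i, a) = block_index ns ! r; (j, b) = block_index ns ! c in F i j $$ (a, b))"

text \<open>The \<open>h \<times> w\<close> submatrix whose upper-left corner is at \<open>(r, c)\<close>.\<close>

definition sub_block :: "'a mat \<Rightarrow> nat \<Rightarrow> nat \<Rightarrow> nat \<Rightarrow> nat \<Rightarrow> 'a mat" where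
  "sub_block B r c h w = mat h w (\<lambda>(a, b). B $$ (r + a, c + b))"

section \<open>Jordan decomposition\<close>

text \<open>A list of (block size, eigenvalue) pairs describes a Jordan matrix, as in
  \<^const>\<open>jordan_matrix\<close>. All indices start at 0.\<close>

type_synonym jordan_blocks = "(nat \<times> complex) list"

definition neg_blocks :: "jordan_blocks \<Rightarrow> jordan_blocks" where
  "neg_blocks bs = filter (\<lambda>(k, \<mu>). Re \<mu> < 0) bs"

definition zero_blocks :: "jordan_blocks \<Rightarrow> jordan_blocks" where
  "zero_blocks bs = filter (\<lambda>(k, \<mu>). Re \<mu> = 0) bs"

definition pos_blocks :: "jordan_blocks \<Rightarrow> jordan_blocks" where
  "pos_blocks bs = filter (\<lambda>(k, \<mu>). Re \<mu> > 0) bs"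

definition total_size :: "jordan_blocks \<Rightarrow> nat" where
  "total_size bs = sum_list (map fst bs)"

text \<open>\<open>Q\<^sup>-\<^sup>1 A Q\<close> is the Jordan matrix given by \<open>bs\<close>, and the blocks are ordered: first those with
  negative real part, then the imaginary ones by increasing imaginary part, then those with
  positive real part.\<close>

definition ordered_jordan_decomposition ::
    "real mat \<Rightarrow> complex mat \<Rightarrow> jordan_blocks \<Rightarrow> bool" where
  "ordered_jordan_decomposition A Q bs \<longleftrightarrow>
     Q \<in> carrier_mat (dim_row A) (dim_row A) \<and> invertible_mat Q \<and>
     (\<forall>(k, \<mu>) \<in> set bs. k \<ge> 1) \<and>
     mat_inv Q * map_mat complex_of_real A * Q = jordan_matrix bs \<and>
     bs = neg_blocks bs @ zero_blocks bs @ pos_blocks bs \<and>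
     sorted (map (\<lambda>(k, \<mu>). Im \<mu>) (zero_blocks bs))"

section \<open>Finite-horizon Gramian\<close>

definition W_fin :: "real mat \<Rightarrow> real \<Rightarrow> real Matrix.vec \<Rightarrow> real mat" where
  "W_fin A T p = mat (dim_row A) (dim_row A) (\<lambda>ij.
     integral {0..T} (\<lambda>t.
       (mat_exp (t \<cdot>\<^sub>m A) * diag_of_vec p * mat_exp (t \<cdot>\<^sub>m transpose_mat A)) $$ ij))"

section \<open>Infinite-horizon scaled Gramian\<close>

definition B_tilde :: "complex mat \<Rightarrow> real Matrix.vec \<Rightarrow> complex mat" where
  "B_tilde Q p =
     mat_inv Q * map_mat complex_of_real (diag_of_vec p) * mat_adjoint (mat_inv Q)"

text \<open>The solution \<open>X\<close> of \<open>J X + X J\<^sup>* + R = O\<close>; it is unique if all eigenvalues of \<open>J\<close> have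
  negative real part.\<close>

definition lyapunov_sol :: "complex mat \<Rightarrow> complex mat \<Rightarrow> complex mat" where
  "lyapunov_sol J R = (THE X. X \<in> carrier_mat (dim_row J) (dim_row J) \<and>
     J * X + X * mat_adjoint J + R = 0\<^sub>m (dim_row J) (dim_row J))"

definition W_neg :: "complex mat \<Rightarrow> jordan_blocks \<Rightarrow> real Matrix.vec \<Rightarrow> complex mat" where
  "W_neg Q bs p =
     (let n\<^sub>m = total_size (neg_blocks bs)
      in lyapunov_sol (jordan_matrix (neg_blocks bs)) (sub_block (B_tilde Q p) 0 0 n\<^sub>m n\<^sub>m))"

definition W_pos :: "complex mat \<Rightarrow> jordan_blocks \<Rightarrow> real Matrix.vec \<Rightarrow> complex mat" where
  "W_pos Q bs p =
     (let s = total_size (neg_blocks bs) + total_size (zero_blocks bs);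
          n\<^sub>p = total_size (pos_blocks bs)
      in lyapunov_sol (- jordan_matrix (pos_blocks bs)) (sub_block (B_tilde Q p) s s n\<^sub>p n\<^sub>p))"

definition B_block ::
    "complex mat \<Rightarrow> jordan_blocks \<Rightarrow> real Matrix.vec \<Rightarrow> nat \<Rightarrow> nat \<Rightarrow> complex mat" where
  "B_block Q bs p i j = sub_block (B_tilde Q p) (total_size (take i bs)) (total_size (take j bs))
     (fst (bs ! i)) (fst (bs ! j))"

definition b_corner ::
    "complex mat \<Rightarrow> jordan_blocks \<Rightarrow> real Matrix.vec \<Rightarrow> nat \<Rightarrow> nat \<Rightarrow> complex" where
  "b_corner Q bs p i j = B_block Q bs p i j $$ (fst (bs ! i) - 1, fst (bs ! j) - 1)"

text \<open>With indices starting at 0, \<open>k - 1 - a\<close> is the distance of row \<open>a\<close> from the last row.\<close>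

definition C_mat :: "nat \<Rightarrow> nat \<Rightarrow> real mat" where
  "C_mat k l = mat k l (\<lambda>(a, b).
     1 / (fact (k - 1 - a) * fact (l - 1 - b) * real ((k - 1 - a) + (l - 1 - b) + 1)))"

text \<open>The eigenvalues are \<open>\<i>y\<close>; \<^const>\<open>sorted_list_of_set\<close> makes \<open>y\<close> strictly increasing.\<close>

definition imag_eigenvalues :: "jordan_blocks \<Rightarrow> complex list" where
  "imag_eigenvalues bs =
     map (Complex 0) (sorted_list_of_set (Im ` snd ` set (zero_blocks bs)))"

definition block_count :: "jordan_blocks \<Rightarrow> complex \<Rightarrow> nat" where
  "block_count bs \<mu> = length (filter (\<lambda>(k, \<nu>). \<nu> = \<mu>) bs)"

definition group_start :: "jordan_blocks \<Rightarrow> nat \<Rightarrow> nat" where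
  "group_start bs l =
     length (neg_blocks bs) + (\<Sum>r<l. block_count bs (imag_eigenvalues bs ! r))"

definition W_zero_group ::
    "complex mat \<Rightarrow> jordan_blocks \<Rightarrow> real Matrix.vec \<Rightarrow> nat \<Rightarrow> complex mat" where
  "W_zero_group Q bs p l =
     (let \<alpha> = group_start bs l; c = block_count bs (imag_eigenvalues bs ! l)
      in block_mat (map fst (take c (drop \<alpha> bs)))
           (\<lambda>i j. b_corner Q bs p (\<alpha> + i) (\<alpha> + j) \<cdot>\<^sub>m
              map_mat complex_of_real (C_mat (fst (bs ! (\<alpha> + i))) (fst (bs ! (\<alpha> + j))))))"

definition W_zero :: "complex mat \<Rightarrow> jordan_blocks \<Rightarrow> real Matrix.vec \<Rightarrow> complex mat" where
  "W_zero Q bs p = diag_block_mat (map (W_zero_group Q bs p) [0..<length (imag_eigenvalues bs)])"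

definition W_inf :: "complex mat \<Rightarrow> jordan_blocks \<Rightarrow> real Matrix.vec \<Rightarrow> complex mat" where
  "W_inf Q bs p = diag_block_mat [W_neg Q bs p, W_zero Q bs p, W_pos Q bs p]"

section \<open>The optimization problems\<close>

definition minimizers :: "('a \<Rightarrow> real) \<Rightarrow> 'a set \<Rightarrow> 'a set" where
  "minimizers f S = {x. is_arg_min f (\<lambda>y. y \<in> S) x}"

text \<open>Determinants of positive definite Hermitian matrices, and the traces below, are real; \<^const>\<open>Re\<close>
  only converts the type.\<close>

definition VCS_fin :: "real mat \<Rightarrow> real \<Rightarrow> real Matrix.vec set" where
  "VCS_fin A T = minimizers (\<lambda>p. - ln (det (W_fin A T p)))
     {p \<in> prob_simplex (dim_row A). pos_def (W_fin A T p)}"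

definition VCS_inf :: "complex mat \<Rightarrow> jordan_blocks \<Rightarrow> real Matrix.vec set" where
  "VCS_inf Q bs = minimizers (\<lambda>p. - ln (Re (det (W_inf Q bs p))))
     {p \<in> prob_simplex (dim_row Q). pos_def (W_inf Q bs p)}"

definition AECS_fin :: "real mat \<Rightarrow> real \<Rightarrow> real Matrix.vec set" where
  "AECS_fin A T = minimizers (\<lambda>p. mat_trace (mat_inv (W_fin A T p)))
     {p \<in> prob_simplex (dim_row A). pos_def (W_fin A T p)}"

definition AECS_inf :: "complex mat \<Rightarrow> jordan_blocks \<Rightarrow> real Matrix.vec set" where
  "AECS_inf Q bs = minimizers
     (\<lambda>p. let n\<^sub>0 = total_size (zero_blocks bs); n\<^sub>p = total_size (pos_blocks bs) in
       Re (mat_trace (mat_adjoint (mat_inv Q) *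
         diag_block_mat [mat_inv (W_neg Q bs p), 0\<^sub>m n\<^sub>0 n\<^sub>0, 0\<^sub>m n\<^sub>p n\<^sub>p] * mat_inv Q)))
     {p \<in> prob_simplex (dim_row Q). pos_def (W_neg Q bs p)}"

end

theory Submission
  imports Defs "HOL-Real_Asymp.Real_Asymp"
begin

text \<open>
  Write \<open>A = Q J Q\<^sup>-\<^sup>1\<close> and rescale the rows of \<open>Q\<^sup>-\<^sup>1\<close> by an invertible \<open>S(T)\<close>: trivially on the stable
  part of \<open>J\<close>, by negative powers of \<open>T\<close> on the imaginary part and by \<open>exp (-J T)\<close> on the antistable
  part. With \<open>G(T) = S(T) Q\<^sup>-\<^sup>1\<close>, the congruent matrices \<open>M(T, p) = G(T) W(p; T) G(T)\<^sup>*\<close> converge to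
  \<open>W\<^sub>\<infinity>(p)\<close>, uniformly on the simplex because they are linear in \<open>p\<close>; the off-diagonal parts vanish
  because exponentials decay and distinct imaginary eigenvalues oscillate against each other.

  As \<open>det M(T, p)\<close> is \<open>det W(p; T)\<close> times a factor that does not depend on \<open>p\<close>, optimality for VCS
  passes to the limit. For AECS, the trace of \<open>W(p; T)\<^sup>-\<^sup>1\<close> is the supremum over \<open>X\<close> of
  \<open>2 Re tr (X\<^sup>* G) - Re tr (X\<^sup>* M X)\<close>, which is continuous in \<open>(G, M)\<close> for fixed \<open>X\<close>, and \<open>G(T)\<close> tends to
  the stable rows of \<open>Q\<^sup>-\<^sup>1\<close>. This bounds the optimal values from below along a convergent sequence of
  solutions, also where \<open>W\<^sub>-\<close> degenerates in the limit. The upper bound comes from competitors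
  perturbed towards the uniform distribution, for which the whole of \<open>W\<^sub>\<infinity>\<close> is positive definite.
\<close>

section \<open>Matrix algebra\<close>

text \<open>The powers of \<open>T\<close> in the scaling come from the integral of
  \<open>t^a t^b\<close> over \<open>[0, T]\<close>, which grows like \<open>T^(a + b + 1)\<close>:
  an imaginary row with \<open>h\<close> rows below it in its block gets the weight
  \<open>T^(- h - 1/2)\<close>. In the limit only the entries of \<open>B_tilde\<close> at the last
  row and last column of the imaginary blocks survive, which explains the corner entries and the
  matrices \<open>C_mat\<close>. Feasibility is an open condition, so a cluster point could a priori
  be infeasible for the limit problem. In VCS the determinant itself is compared, because it stays
  continuous at singular matrices while its logarithm does not; one competitor with positive
  limiting determinant then forces definiteness. The existence of such a competitor is not visible
  in the formulas for \<open>W_inf\<close>; it comes from a lower bound, independent of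
  \<open>T\<close>, for each quadratic form of the scaled Gramian at the uniform distribution. The
  statements on distances follow from those on cluster points by compactness of the simplex.\<close>

lemma index_mult_sum:
  assumes "A \<in> carrier_mat m n" "B \<in> carrier_mat n l" "i < m" "j < l"
  shows "(A * B) $$ (i, j) = (\<Sum>k<n. A $$ (i, k) * B $$ (k, j))"
  using assms by (auto simp: scalar_prod_def lessThan_atLeast0 intro!: sum.cong)

lemma index_mult_vec_sum:
  assumes "A \<in> carrier_mat m n" "v \<in> carrier_vec n" "i < m"
  shows "(A *\<^sub>v v) $ i = (\<Sum>k<n. A $$ (i, k) * v $ k)"
  using assms by (auto simp: scalar_prod_def lessThan_atLeast0 intro!: sum.cong)

lemma mat_adjoint_dim [simp]:
  "dim_row (mat_adjoint A) = dim_col A" "dim_col (mat_adjoint A) = dim_row A"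
  by (simp_all add: mat_adjoint_def mat_of_rows_def)

lemma mat_adjoint_carrier [simp]:
  "mat_adjoint A \<in> carrier_mat n m \<longleftrightarrow> A \<in> carrier_mat m n"
  unfolding carrier_mat_def mem_Collect_eq mat_adjoint_dim by (rule conj_commute)

lemma mat_adjoint_index [simp]:
  "i < dim_col A \<Longrightarrow> j < dim_row A \<Longrightarrow> mat_adjoint A $$ (i, j) = conjugate (A $$ (j, i))"
  by (auto simp: mat_adjoint_def mat_of_rows_index)

lemma mat_adjoint_adjoint [simp]: "mat_adjoint (mat_adjoint A) = A"
  by (rule eq_matI) auto

lemma mat_adjoint_one [simp]: "mat_adjoint (1\<^sub>m n) = (1\<^sub>m n :: complex mat)"
  by (rule eq_matI) auto

lemma mat_adjoint_minus:
  fixes A :: "complex mat"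
  assumes "A \<in> carrier_mat m n" "B \<in> carrier_mat m n"
  shows "mat_adjoint (A - B) = mat_adjoint A - mat_adjoint B"
  using assms by (intro eq_matI) auto

lemma mat_adjoint_mult:
  assumes "A \<in> carrier_mat m n" "B \<in> carrier_mat n l"
  shows "mat_adjoint (A * B) = mat_adjoint B * mat_adjoint A"
proof (rule eq_matI)
  fix i j assume ij: "i < dim_row (mat_adjoint B * mat_adjoint A)"
    "j < dim_col (mat_adjoint B * mat_adjoint A)"
  have "mat_adjoint (A * B) $$ (i, j) = conjugate (\<Sum>k<n. A $$ (j, k) * B $$ (k, i))"
    using ij assms by (auto simp: index_mult_sum[OF assms] simp del: index_mult_mat(1))
  also have "\<dots> = (\<Sum>k<n. mat_adjoint B $$ (i, k) * mat_adjoint A $$ (k, j))"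
    using ij assms by (auto simp: sum_conjugate conjugate_dist_mul mult.commute intro!: sum.cong)
  also have "\<dots> = (mat_adjoint B * mat_adjoint A) $$ (i, j)"
    using ij assms by (subst index_mult_sum[of _ l n _ m]) auto
  finally show "mat_adjoint (A * B) $$ (i, j) = (mat_adjoint B * mat_adjoint A) $$ (i, j)" .
qed (use assms in auto)

lemma scalar_prod_mat_adjoint:
  fixes A :: "complex mat"
  assumes "A \<in> carrier_mat m n" "v \<in> carrier_vec n" "w \<in> carrier_vec m"
  shows "(A *\<^sub>v v) \<bullet>c w = v \<bullet>c (mat_adjoint A *\<^sub>v w)"
proof -
  have "(A *\<^sub>v v) \<bullet>c w = (\<Sum>i<m. \<Sum>k<n. A $$ (i, k) * v $ k * cnj (w $ i))"
    using assms by (auto simp: scalar_prod_def lessThan_atLeast0 index_mult_vec_sum[OF assms(1,2)]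
        sum_distrib_right simp del: index_mult_mat_vec intro!: sum.cong)
  also have "\<dots> = (\<Sum>k<n. \<Sum>i<m. A $$ (i, k) * v $ k * cnj (w $ i))"
    by (rule sum.swap)
  also have "\<dots> = v \<bullet>c (mat_adjoint A *\<^sub>v w)"
    using assms by (auto simp: scalar_prod_def lessThan_atLeast0
        index_mult_vec_sum[of "mat_adjoint A" n m]
        sum_distrib_left simp del: index_mult_mat_vec intro!: sum.cong)
  finally show ?thesis .
qed

section \<open>Quadratic forms, semidefiniteness and determinants\<close>

definition quad_form :: "complex mat \<Rightarrow> complex Matrix.vec \<Rightarrow> complex" where
  "quad_form M v = (M *\<^sub>v v) \<bullet>c v"

lemma quad_form_sum:
  assumes "M \<in> carrier_mat n n" "v \<in> carrier_vec n"
  shows "quad_form M v = (\<Sum>i<n. \<Sum>j<n. M $$ (i, j) * v $ j * cnj (v $ i))"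
  using assms by (auto simp: quad_form_def scalar_prod_def lessThan_atLeast0
      sum_distrib_right intro!: sum.cong)

lemma quad_form_congruence:
  assumes "G \<in> carrier_mat m n" "M \<in> carrier_mat n n" "v \<in> carrier_vec m"
  shows "quad_form (G * M * mat_adjoint G) v = quad_form M (mat_adjoint G *\<^sub>v v)"
proof -
  have "G * M * mat_adjoint G *\<^sub>v v = G *\<^sub>v (M *\<^sub>v (mat_adjoint G *\<^sub>v v))"
    using assms mult_mat_vec_carrier[of "mat_adjoint G" n m v]
    by (simp add: assoc_mult_mat_vec[of _ m n _ m] assoc_mult_mat_vec[of _ m n _ n])
  then show ?thesis
    using assms scalar_prod_mat_adjoint[of G m n "M *\<^sub>v (mat_adjoint G *\<^sub>v v)" v]
    by (auto simp: quad_form_def)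
qed

text \<open>In the order on \<open>complex\<close>, \<open>0 \<le> quad_form M v\<close> also
  asserts that the value is real.\<close>

definition pos_semidef :: "nat \<Rightarrow> complex mat \<Rightarrow> bool" where
  "pos_semidef n M \<longleftrightarrow> M \<in> carrier_mat n n \<and> mat_adjoint M = M \<and>
     (\<forall>v \<in> carrier_vec n. 0 \<le> quad_form M v)"

lemma pos_semidef_congruence:
  assumes "pos_semidef n M" "G \<in> carrier_mat m n"
  shows "pos_semidef m (G * M * mat_adjoint G)"
proof -
  have M: "M \<in> carrier_mat n n" "mat_adjoint M = M" and G: "G \<in> carrier_mat m n"
    using assms by (auto simp: pos_semidef_def)
  have "mat_adjoint (G * M * mat_adjoint G) = G * (mat_adjoint M * mat_adjoint G)"
    using M(1) G by (subst mat_adjoint_mult[of _ m n _ m])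
      (auto simp: mat_adjoint_mult[of _ m n _ n])
  also have "\<dots> = G * M * mat_adjoint G"
    using M G by (simp add: assoc_mult_mat[of _ m n _ n _ m])
  finally show ?thesis
    using assms unfolding pos_semidef_def by (auto simp: quad_form_congruence)
qed

lemma pos_def_quad_form:
  assumes "M \<in> carrier_mat n n"
  shows "pos_def M \<longleftrightarrow> mat_adjoint M = M \<and>
    (\<forall>v \<in> carrier_vec n. v \<noteq> 0\<^sub>v n \<longrightarrow> 0 < quad_form M v)"
  using assms by (auto simp: pos_def_def quad_form_def)

lemma pos_def_imp_pos_semidef:
  assumes "M \<in> carrier_mat n n" "pos_def M"
  shows "pos_semidef n M"
  unfolding pos_semidef_def
proof (intro conjI ballI)
  fix v :: "complex Matrix.vec" assume v: "v \<in> carrier_vec n"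
  show "0 \<le> quad_form M v"
  proof (cases "v = 0\<^sub>v n")
    case True
    then show ?thesis using assms by (simp add: quad_form_sum[OF assms(1)])
  next
    case False
    then show ?thesis using assms v by (auto simp: pos_def_quad_form less_imp_le)
  qed
qed (use assms in \<open>auto simp: pos_def_quad_form\<close>)

lemma cscalar_prod_self_real:
  fixes w :: "complex Matrix.vec"
  shows "w \<bullet>c w = of_real (\<Sum>i<dim_vec w. (cmod (w $ i))\<^sup>2)"
  by (auto simp: scalar_prod_def lessThan_atLeast0 complex_mult_cnj cmod_power2)

text \<open>The minimum at \<open>v\<close> of the quadratic form forces its gradient \<open>M v\<close> to vanish.\<close>

lemma pos_semidef_kernel:
  assumes M: "pos_semidef n M" and v: "v \<in> carrier_vec n" and 0: "quad_form M v = 0"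
  shows "M *\<^sub>v v = 0\<^sub>v n"
proof -
  have Mc: "M \<in> carrier_mat n n" and Ma: "mat_adjoint M = M"
    using M by (auto simp: pos_semidef_def)
  define w where "w = M *\<^sub>v v"
  have w: "w \<in> carrier_vec n" using Mc v by (auto simp: w_def)
  define N where "N = (\<Sum>i<n. (cmod (w $ i))\<^sup>2)"
  have N: "w \<bullet>c w = of_real N" using w by (auto simp: cscalar_prod_self_real N_def)
  have "0 \<le> N" unfolding N_def by (auto intro: sum_nonneg)
  define q where "q = Re (quad_form M w)"
  have q: "quad_form M w = of_real q" "0 \<le> q"
    using M w by (auto simp: pos_semidef_def q_def less_eq_complex_def complex_eq_iff)
  have ineq: "0 \<le> s * s * q - 2 * s * N" for s :: real
  proof -
    let ?x = "v + (- of_real s) \<cdot>\<^sub>v w"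
    have x: "?x \<in> carrier_vec n" using v w by auto
    have "M *\<^sub>v ?x = w + (- of_real s) \<cdot>\<^sub>v (M *\<^sub>v w)"
      using Mc v w by (simp add: mult_add_distrib_mat_vec[of _ n n] mult_mat_vec[of _ n n] w_def)
    moreover have Mw: "M *\<^sub>v w \<in> carrier_vec n" using Mc w by auto
    moreover have "(M *\<^sub>v w) \<bullet>c v = w \<bullet>c w"
      using scalar_prod_mat_adjoint[OF Mc w v] Ma by (simp add: w_def)
    moreover have "w \<bullet>c v = 0" using 0 by (simp add: quad_form_def w_def)
    moreover have "conjugate ?x = conjugate v + (- of_real s) \<cdot>\<^sub>v conjugate w"
      using v w by (intro eq_vecI) auto
    ultimately have "quad_form M ?x = (of_real s * of_real s) * quad_form M w - 2 * of_real s * (w \<bullet>c w)"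
      using v w
      by (simp add: quad_form_def scalar_prod_add_distrib[of _ n] add_scalar_prod_distrib[of _ n]
          algebra_simps)
    also have "\<dots> = of_real (s * s * q - 2 * s * N)"
      using q N by simp
    finally show ?thesis using M x unfolding pos_semidef_def by (auto simp: less_eq_complex_def)
  qed
  have "N = 0"
  proof (rule ccontr)
    assume "N \<noteq> 0" with \<open>0 \<le> N\<close> have "N > 0" by simp
    \<comment> \<open>By \<open>ineq\<close>, the form at \<open>v - s w\<close> is
      \<open>s^2 q - 2 s N\<close>. This choice gives \<open>s q \<le> N\<close>, so that the value
      is at most \<open>- s N < 0\<close>; the summand 1 covers the case
      \<open>q = 0\<close>.\<close>
    define s where "s = N / (q + 1)"
    have s: "s > 0" "s * (q + 1) = N" using \<open>N > 0\<close> q by (auto simp: s_def)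
    have "s * q \<le> N" using s by (simp add: algebra_simps)
    then have "s * (s * q - 2 * N) < 0" using s \<open>N > 0\<close> by (intro mult_pos_neg) auto
    then show False using ineq[of s] by (simp add: algebra_simps)
  qed
  then have "\<forall>i<n. w $ i = 0" unfolding N_def by (subst (asm) sum_nonneg_eq_0_iff) auto
  then show ?thesis using w unfolding w_def[symmetric] by (intro eq_vecI) auto
qed

text \<open>A vector on which the form vanishes lies in the kernel by
  \<open>pos_semidef_kernel\<close>. Semidefiniteness survives limits and congruences, so this
  criterion reduces definiteness to one scalar that is continuous in the matrix.\<close>

lemma pos_semidef_det_ne_0:
  assumes M: "pos_semidef n M" and d: "det M \<noteq> 0"
  shows "pos_def M"
proof -
  have Mc: "M \<in> carrier_mat n n" using M by (auto simp: pos_semidef_def)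
  have "0 < quad_form M v" if v: "v \<in> carrier_vec n" "v \<noteq> 0\<^sub>v n" for v
  proof -
    have "quad_form M v \<noteq> 0"
      using pos_semidef_kernel[OF M v(1)] det_0_iff_vec_prod_zero[OF Mc] d v by auto
    moreover have "0 \<le> quad_form M v" using M v by (auto simp: pos_semidef_def)
    ultimately show ?thesis by (simp add: less_le)
  qed
  then show ?thesis using M by (auto simp: pos_def_quad_form[OF Mc] pos_semidef_def)
qed

text \<open>Polymorphic, as it serves the real Gramian as well as its complex congruences.\<close>

lemma pos_def_det_ne_0:
  fixes M :: "'a::conjugatable_ordered_field mat"
  assumes Mc: "M \<in> carrier_mat n n" and M: "pos_def M"
  shows "det M \<noteq> 0"
proof
  assume "det M = 0"
  then obtain v where v: "v \<in> carrier_vec n" "v \<noteq> 0\<^sub>v n" "M *\<^sub>v v = 0\<^sub>v n"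
    using det_0_iff_vec_prod_zero[OF Mc] by auto
  then have "(0::'a) < 0\<^sub>v n \<bullet>c v" using M Mc by (auto simp: pos_def_def)
  then show False using v by auto
qed

text \<open>The determinant is the product of the eigenvalues, which form the diagonal of a Schur
  decomposition. At an eigenvector \<open>v\<close> for \<open>a\<close> the form equals
  \<open>a\<close> times the squared norm of \<open>v\<close>, so each eigenvalue is real and
  nonnegative.\<close>

lemma pos_semidef_det_nonneg:
  assumes M: "pos_semidef n M"
  shows "0 \<le> det M"
proof -
  have Mc: "M \<in> carrier_mat n n" using M by (auto simp: pos_semidef_def)
  obtain es where es: "char_poly M = (\<Prod>a\<leftarrow>es. [:- a, 1:])"
    using char_poly_factorized[OF Mc] by auto
  obtain B P Q where s: "schur_decomposition M es = (B, P, Q)" by (metis prod_cases3)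
  from schur_decomposition[OF Mc es s]
  have B: "similar_mat_wit M B P Q" "upper_triangular B" "diag_mat B = es" by auto
  then have Bc: "B \<in> carrier_mat n n"
    using Mc by (auto simp: similar_mat_wit_def Let_def)
  have "det M = det B" using B(1) by (intro det_similar) (auto simp: similar_mat_def)
  also have "\<dots> = prod_list es" using B(2,3) Bc by (simp add: det_upper_triangular)
  finally have "det M = prod_list es" .
  moreover have "0 \<le> a" if a: "a \<in> set es" for a
  proof -
    have "poly (char_poly M) a = 0"
      unfolding es using a by (auto simp: poly_prod_list prod_list_zero_iff o_def)
    then have "eigenvalue M a" using eigenvalue_root_char_poly[OF Mc] by simp
    then obtain v where v: "v \<in> carrier_vec n" "v \<noteq> 0\<^sub>v n" "M *\<^sub>v v = a \<cdot>\<^sub>v v"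
      using Mc by (auto simp: eigenvalue_def eigenvector_def)
    define r where "r = (\<Sum>i<n. (cmod (v $ i))\<^sup>2)"
    have "quad_form M v = a * of_real r"
      using v by (simp add: quad_form_def cscalar_prod_self_real r_def)
    moreover have "r > 0"
    proof -
      obtain i where "i < n" "v $ i \<noteq> 0" using v by (metis eq_vecI carrier_vecD index_zero_vec)
      then show ?thesis unfolding r_def by (intro sum_pos2[of _ i]) auto
    qed
    moreover have "0 \<le> quad_form M v" using M v by (auto simp: pos_semidef_def)
    ultimately show "0 \<le> a"
      by (auto simp: less_eq_complex_def zero_le_mult_iff)
  qed
  ultimately show ?thesis
  proof -
    have "(\<And>a. a \<in> set es \<Longrightarrow> 0 \<le> a) \<Longrightarrow> 0 \<le> prod_list es"
      by (induction es) (auto simp: less_eq_complex_def)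
    then show ?thesis using \<open>det M = prod_list es\<close> \<open>\<And>a. a \<in> set es \<Longrightarrow> 0 \<le> a\<close> by simp
  qed
qed

lemma pos_def_det_pos:
  assumes "M \<in> carrier_mat n n" "pos_def M"
  shows "0 < Re (det M)"
  using pos_semidef_det_nonneg[OF pos_def_imp_pos_semidef[OF assms]] pos_def_det_ne_0[OF assms]
  by (auto simp: less_eq_complex_def complex_eq_iff)

section \<open>Entrywise analysis of matrix-valued functions\<close>

text \<open>The type \<open>mat\<close> mixes all sizes, so convergence is taken entry by entry at a
  fixed size. The size is prescribed at every \<open>t\<close>, not just eventually, so that entries
  of products can be expanded without side conditions.\<close>

definition mat_tendsto :: "nat \<Rightarrow> nat \<Rightarrow> ('b \<Rightarrow> complex mat) \<Rightarrow> complex mat \<Rightarrow> 'b filter \<Rightarrow> bool" where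
  "mat_tendsto m n f L F \<longleftrightarrow> (\<forall>t. f t \<in> carrier_mat m n) \<and> L \<in> carrier_mat m n \<and>
     (\<forall>i<m. \<forall>j<n. ((\<lambda>t. f t $$ (i, j)) \<longlongrightarrow> L $$ (i, j)) F)"

lemma mat_tendstoI:
  assumes "\<And>t. f t \<in> carrier_mat m n" "L \<in> carrier_mat m n"
    and "\<And>i j. i < m \<Longrightarrow> j < n \<Longrightarrow> ((\<lambda>t. f t $$ (i, j)) \<longlongrightarrow> L $$ (i, j)) F"
  shows "mat_tendsto m n f L F"
  using assms by (auto simp: mat_tendsto_def)

lemma mat_tendstoD:
  assumes "mat_tendsto m n f L F"
  shows "f t \<in> carrier_mat m n" "L \<in> carrier_mat m n"
    and "i < m \<Longrightarrow> j < n \<Longrightarrow> ((\<lambda>t. f t $$ (i, j)) \<longlongrightarrow> L $$ (i, j)) F"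
  using assms by (auto simp: mat_tendsto_def)

lemma mat_tendsto_const: "L \<in> carrier_mat m n \<Longrightarrow> mat_tendsto m n (\<lambda>t. L) L F"
  by (auto simp: mat_tendsto_def)

lemma mat_tendsto_mult:
  assumes f: "mat_tendsto m n f L F" and g: "mat_tendsto n l g K F"
  shows "mat_tendsto m l (\<lambda>t. f t * g t) (L * K) F"
proof (rule mat_tendstoI)
  fix i j assume "i < m" "j < l"
  moreover have "((\<lambda>t. \<Sum>k<n. f t $$ (i, k) * g t $$ (k, j)) \<longlongrightarrow> (\<Sum>k<n. L $$ (i, k) * K $$ (k, j))) F"
    using mat_tendstoD[OF f] mat_tendstoD[OF g] \<open>i < m\<close> \<open>j < l\<close> by (intro tendsto_sum tendsto_mult) auto
  ultimately show "((\<lambda>t. (f t * g t) $$ (i, j)) \<longlongrightarrow> (L * K) $$ (i, j)) F"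
    by (simp add: index_mult_sum[OF mat_tendstoD(1)[OF f] mat_tendstoD(1)[OF g]]
        index_mult_sum[OF mat_tendstoD(2)[OF f] mat_tendstoD(2)[OF g]] del: index_mult_mat(1))
qed (use mat_tendstoD(1,2)[OF f] mat_tendstoD(1,2)[OF g] in \<open>auto intro!: mult_carrier_mat\<close>)

lemma mat_tendsto_adjoint:
  assumes f: "mat_tendsto m n f L F"
  shows "mat_tendsto n m (\<lambda>t. mat_adjoint (f t)) (mat_adjoint L) F"
proof (rule mat_tendstoI)
  fix i j assume ij: "i < n" "j < m"
  have "((\<lambda>t. cnj (f t $$ (j, i))) \<longlongrightarrow> cnj (L $$ (j, i))) F"
    using mat_tendstoD(3)[OF f ij(2,1)] by (intro tendsto_intros)
  then show "((\<lambda>t. mat_adjoint (f t) $$ (i, j)) \<longlongrightarrow> mat_adjoint L $$ (i, j)) F"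
    using ij mat_tendstoD(1,2)[OF f] by (simp add: carrier_matD[OF mat_tendstoD(1)[OF f]]
        carrier_matD[OF mat_tendstoD(2)[OF f]])
qed (use mat_tendstoD[OF f] in auto)

lemma mat_tendsto_add:
  assumes f: "mat_tendsto m n f L F" and g: "mat_tendsto m n g K F"
  shows "mat_tendsto m n (\<lambda>t. f t + g t) (L + K) F"
proof (rule mat_tendstoI)
  fix i j assume ij: "i < m" "j < n"
  have "((\<lambda>t. f t $$ (i, j) + g t $$ (i, j)) \<longlongrightarrow> L $$ (i, j) + K $$ (i, j)) F"
    using mat_tendstoD(3)[OF f ij] mat_tendstoD(3)[OF g ij] by (rule tendsto_add)
  then show "((\<lambda>t. (f t + g t) $$ (i, j)) \<longlongrightarrow> (L + K) $$ (i, j)) F"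
    using ij carrier_matD[OF mat_tendstoD(1)[OF g]] carrier_matD[OF mat_tendstoD(2)[OF g]] by simp
qed (use mat_tendstoD[OF f] mat_tendstoD[OF g] in auto)

lemma mat_tendsto_unique:
  assumes "mat_tendsto m n f L F" "mat_tendsto m n f K F" "F \<noteq> bot"
  shows "L = K"
proof (rule eq_matI)
  fix i j assume "i < dim_row K" "j < dim_col K"
  then have "i < m" "j < n" using mat_tendstoD(2)[OF assms(2)] by auto
  then show "L $$ (i, j) = K $$ (i, j)"
    using mat_tendstoD(3)[OF assms(1)] mat_tendstoD(3)[OF assms(2)] assms(3)
    by (metis tendsto_unique)
qed (use mat_tendstoD(2)[OF assms(1)] mat_tendstoD(2)[OF assms(2)] in auto)

lemma mat_tendsto_compose:
  assumes "mat_tendsto m n f L F" "filterlim g F H"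
  shows "mat_tendsto m n (\<lambda>x. f (g x)) L H"
  using assms(1) by (auto simp: mat_tendsto_def intro!: filterlim_compose[OF _ assms(2)])

text \<open>The Leibniz formula exhibits the determinant as a polynomial in the entries.\<close>

lemma mat_tendsto_det:
  assumes f: "mat_tendsto n n f L F"
  shows "((\<lambda>t. det (f t)) \<longlongrightarrow> det L) F"
proof -
  have *: "det M = (\<Sum>p | p permutes {0..<n}. signof p * (\<Prod>i = 0..<n. M $$ (i, p i)))"
    if "M \<in> carrier_mat n n" for M :: "complex mat"
    using that by (simp add: det_def)
  show ?thesis
    unfolding *[OF mat_tendstoD(1)[OF f]] *[OF mat_tendstoD(2)[OF f]]
    by (intro tendsto_sum tendsto_mult tendsto_prod tendsto_const mat_tendstoD(3)[OF f])
      (auto dest: permutes_in_image)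
qed

lemma mat_tendsto_trace:
  assumes f: "mat_tendsto n n f L F"
  shows "((\<lambda>t. mat_trace (f t)) \<longlongrightarrow> mat_trace L) F"
  using mat_tendstoD(3)[OF f] carrier_matD(1)[OF mat_tendstoD(1)[OF f]]
    carrier_matD(1)[OF mat_tendstoD(2)[OF f]]
  by (auto simp: mat_trace_def intro!: tendsto_sum)

text \<open>Cofactors are determinants of submatrices. Continuity of the inverse is derived from
  this, since the adjugate makes sense at singular matrices too, where \<open>mat_inv\<close> is not
  meaningful.\<close>

lemma mat_tendsto_adj_mat:
  assumes f: "mat_tendsto n n f L F"
  shows "mat_tendsto n n (\<lambda>t. adj_mat (f t)) (adj_mat L) F"
proof (rule mat_tendstoI)
  fix i j assume ij: "i < n" "j < n"
  note dims = carrier_matD[OF mat_tendstoD(1)[OF f]] carrier_matD[OF mat_tendstoD(2)[OF f]]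
  have "mat_tendsto (n - 1) (n - 1) (\<lambda>t. mat_delete (f t) j i) (mat_delete L j i) F"
    using ij by (intro mat_tendstoI)
      (auto simp: mat_delete_def dims intro!: mat_tendstoD(3)[OF f])
  then have "((\<lambda>t. det (mat_delete (f t) j i)) \<longlongrightarrow> det (mat_delete L j i)) F"
    by (rule mat_tendsto_det)
  then show "((\<lambda>t. adj_mat (f t) $$ (i, j)) \<longlongrightarrow> adj_mat L $$ (i, j)) F"
    using ij by (auto simp: adj_mat_def cofactor_def dims intro!: tendsto_intros)
qed (use adj_mat(1)[OF mat_tendstoD(1)[OF f]] adj_mat(1)[OF mat_tendstoD(2)[OF f]] in auto)

section \<open>Inverses through determinants and adjugates\<close>

lemma smult_inverse_one_mat:
  "(a::'a::field) \<noteq> 0 \<Longrightarrow> inverse a \<cdot>\<^sub>m (a \<cdot>\<^sub>m 1\<^sub>m n) = 1\<^sub>m n"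
  by (intro eq_matI) auto

lemma invertible_mat_det:
  fixes X :: "'a::field mat"
  assumes "X \<in> carrier_mat n n"
  shows "invertible_mat X \<longleftrightarrow> det X \<noteq> 0"
proof
  assume "invertible_mat X"
  from mat_inv(1,3)[OF assms this] have "det X * det (mat_inv X) = 1"
    using det_mult[OF assms, of "mat_inv X"] by simp
  then show "det X \<noteq> 0" by auto
next
  assume d: "det X \<noteq> 0"
  have "X * (inverse (det X) \<cdot>\<^sub>m adj_mat X) = 1\<^sub>m n" "(inverse (det X) \<cdot>\<^sub>m adj_mat X) * X = 1\<^sub>m n"
    using adj_mat[OF assms] assms d
    by (simp_all add: mult_smult_distrib[of _ n n _ n] mult_smult_assoc_mat[of _ n n _ n] smult_inverse_one_mat)
  then show "invertible_mat X"
    using assms adj_mat(1)[OF assms]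
    by (auto simp: invertible_mat_def inverts_mat_def intro!: exI[of _ "inverse (det X) \<cdot>\<^sub>m adj_mat X"])
qed

text \<open>Multiplicativity of the determinant makes a right inverse two-sided. This is how values
  of \<open>mat_inv\<close>, which is defined by Gauss-Jordan elimination, are identified.\<close>

lemma mat_inv_unique:
  fixes X :: "'a::field mat"
  assumes "X \<in> carrier_mat n n" "Y \<in> carrier_mat n n" "X * Y = 1\<^sub>m n"
  shows "mat_inv X = Y"
proof -
  have "det X * det Y = 1" using det_mult[OF assms(1,2)] assms(3) by simp
  then have "invertible_mat X" using invertible_mat_det[OF assms(1)] by auto
  note i = mat_inv[OF assms(1) this]
  have "mat_inv X = mat_inv X * (X * Y)" using i assms by simp
  also have "\<dots> = mat_inv X * X * Y" using i(1) assms(1,2) by simp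
  also have "\<dots> = Y" using i(2) assms(2) by simp
  finally show ?thesis .
qed

lemma mat_inv_adj_mat:
  fixes X :: "'a::field mat"
  assumes "X \<in> carrier_mat n n" "det X \<noteq> 0"
  shows "mat_inv X = inverse (det X) \<cdot>\<^sub>m adj_mat X"
  using adj_mat[OF assms(1)] assms
  by (intro mat_inv_unique[of _ n]) (auto simp: mult_smult_distrib[of _ n n _ n] smult_inverse_one_mat)

section \<open>Entrywise derivatives, continuity and integrals\<close>

definition has_mat_derivative ::
    "nat \<Rightarrow> nat \<Rightarrow> (real \<Rightarrow> complex mat) \<Rightarrow> (real \<Rightarrow> complex mat) \<Rightarrow> bool" where
  "has_mat_derivative m n f f' \<longleftrightarrow> (\<forall>t. f t \<in> carrier_mat m n \<and> f' t \<in> carrier_mat m n) \<and>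
     (\<forall>t. \<forall>i<m. \<forall>j<n. ((\<lambda>t. f t $$ (i, j)) has_vector_derivative f' t $$ (i, j)) (at t))"

lemma has_mat_derivativeD:
  assumes "has_mat_derivative m n f f'"
  shows "f t \<in> carrier_mat m n" "f' t \<in> carrier_mat m n"
    and "i < m \<Longrightarrow> j < n \<Longrightarrow> ((\<lambda>t. f t $$ (i, j)) has_vector_derivative f' t $$ (i, j)) (at t)"
  using assms by (auto simp: has_mat_derivative_def)

lemma has_mat_derivativeI:
  assumes "\<And>t. f t \<in> carrier_mat m n" "\<And>t. f' t \<in> carrier_mat m n"
    and "\<And>t i j. i < m \<Longrightarrow> j < n \<Longrightarrow>
      ((\<lambda>t. f t $$ (i, j)) has_vector_derivative f' t $$ (i, j)) (at t)"
  shows "has_mat_derivative m n f f'"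
  using assms by (auto simp: has_mat_derivative_def)

lemma has_mat_derivative_const:
  "L \<in> carrier_mat m n \<Longrightarrow> has_mat_derivative m n (\<lambda>t. L) (\<lambda>t. 0\<^sub>m m n)"
  by (auto simp: has_mat_derivative_def)

lemma has_mat_derivative_mult:
  assumes f: "has_mat_derivative m n f f'" and g: "has_mat_derivative n l g g'"
  shows "has_mat_derivative m l (\<lambda>t. f t * g t) (\<lambda>t. f' t * g t + f t * g' t)"
proof (rule has_mat_derivativeI)
  note cf = has_mat_derivativeD(1,2)[OF f] and cg = has_mat_derivativeD(1,2)[OF g]
  fix t i j assume ij: "i < m" "j < l"
  have "((\<lambda>t. \<Sum>k<n. f t $$ (i, k) * g t $$ (k, j)) has_vector_derivative
      (\<Sum>k<n. f t $$ (i, k) * g' t $$ (k, j) + f' t $$ (i, k) * g t $$ (k, j))) (at t)"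
    using has_mat_derivativeD(3)[OF f] has_mat_derivativeD(3)[OF g] ij
    by (intro has_vector_derivative_sum has_vector_derivative_mult) auto
  moreover have "(f' t * g t + f t * g' t) $$ (i, j) =
      (\<Sum>k<n. f t $$ (i, k) * g' t $$ (k, j) + f' t $$ (i, k) * g t $$ (k, j))"
    using ij cf[of t] cg[of t]
    by (simp add: index_mult_sum[of _ m n _ l] sum.distrib del: index_mult_mat(1))
  ultimately show "((\<lambda>t. (f t * g t) $$ (i, j)) has_vector_derivative
      (f' t * g t + f t * g' t) $$ (i, j)) (at t)"
    using ij by (simp add: index_mult_sum[OF cf(1) cg(1)] del: index_mult_mat(1))
qed (use has_mat_derivativeD(1,2)[OF f] has_mat_derivativeD(1,2)[OF g] in \<open>auto intro!: add_carrier_mat mult_carrier_mat\<close>)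

lemma has_mat_derivative_adjoint:
  assumes f: "has_mat_derivative m n f f'"
  shows "has_mat_derivative n m (\<lambda>t. mat_adjoint (f t)) (\<lambda>t. mat_adjoint (f' t))"
proof (rule has_mat_derivativeI)
  note cf = has_mat_derivativeD(1,2)[OF f]
  fix t i j assume ij: "i < n" "j < m"
  have "((\<lambda>t. cnj (f t $$ (j, i))) has_vector_derivative cnj (f' t $$ (j, i))) (at t)"
    using has_mat_derivativeD(3)[OF f ij(2,1)]
    by (rule bounded_linear.has_vector_derivative[OF bounded_linear_cnj])
  then show "((\<lambda>t. mat_adjoint (f t) $$ (i, j)) has_vector_derivative mat_adjoint (f' t) $$ (i, j)) (at t)"
    using ij by (simp add: carrier_matD[OF cf(1)] carrier_matD[OF cf(2)])
qed (use has_mat_derivativeD(1,2)[OF f] in auto)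

definition mat_continuous :: "nat \<Rightarrow> nat \<Rightarrow> (real \<Rightarrow> complex mat) \<Rightarrow> bool" where
  "mat_continuous m n f \<longleftrightarrow> (\<forall>t. f t \<in> carrier_mat m n) \<and>
     (\<forall>i<m. \<forall>j<n. continuous_on UNIV (\<lambda>t. f t $$ (i, j)))"

lemma mat_continuousD:
  assumes "mat_continuous m n f"
  shows "f t \<in> carrier_mat m n"
    and "i < m \<Longrightarrow> j < n \<Longrightarrow> continuous_on S (\<lambda>t. f t $$ (i, j))"
  using assms by (auto simp: mat_continuous_def intro: continuous_on_subset)

lemma mat_continuousI:
  assumes "\<And>t. f t \<in> carrier_mat m n"
    and "\<And>i j. i < m \<Longrightarrow> j < n \<Longrightarrow> continuous_on UNIV (\<lambda>t. f t $$ (i, j))"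
  shows "mat_continuous m n f"
  using assms by (auto simp: mat_continuous_def)

lemma mat_continuous_const: "L \<in> carrier_mat m n \<Longrightarrow> mat_continuous m n (\<lambda>t. L)"
  by (auto simp: mat_continuous_def)

lemma mat_continuous_mult:
  assumes f: "mat_continuous m n f" and g: "mat_continuous n l g"
  shows "mat_continuous m l (\<lambda>t. f t * g t)"
proof (rule mat_continuousI)
  fix i j assume "i < m" "j < l"
  then show "continuous_on UNIV (\<lambda>t. (f t * g t) $$ (i, j))"
    using mat_continuousD(2)[OF f] mat_continuousD(2)[OF g]
    by (auto simp: index_mult_sum[OF mat_continuousD(1)[OF f] mat_continuousD(1)[OF g]]
        simp del: index_mult_mat(1) intro!: continuous_on_sum continuous_on_mult)
qed (use mat_continuousD(1)[OF f] mat_continuousD(1)[OF g] in \<open>auto intro!: mult_carrier_mat\<close>)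

lemma mat_continuous_adjoint:
  assumes f: "mat_continuous m n f"
  shows "mat_continuous n m (\<lambda>t. mat_adjoint (f t))"
  using mat_continuousD[OF f] carrier_matD[OF mat_continuousD(1)[OF f]]
  by (intro mat_continuousI) (auto intro!: continuous_intros)

lemma has_mat_derivative_continuous:
  assumes f: "has_mat_derivative m n f f'"
  shows "mat_continuous m n f"
proof (rule mat_continuousI)
  fix i j assume "i < m" "j < n"
  then show "continuous_on UNIV (\<lambda>t. f t $$ (i, j))"
    using has_mat_derivativeD(3)[OF f] by (intro continuous_on_vector_derivative) auto
qed (rule has_mat_derivativeD(1)[OF f])

definition mat_integral :: "nat \<Rightarrow> nat \<Rightarrow> real \<Rightarrow> (real \<Rightarrow> complex mat) \<Rightarrow> complex mat" where
  "mat_integral m n T f = mat m n (\<lambda>ij. integral {0..T} (\<lambda>t. f t $$ ij))"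

lemma mat_integral_carrier [simp]: "mat_integral m n T f \<in> carrier_mat m n"
  by (simp add: mat_integral_def)

lemma mat_integral_index [simp]:
  "i < m \<Longrightarrow> j < n \<Longrightarrow> mat_integral m n T f $$ (i, j) = integral {0..T} (\<lambda>t. f t $$ (i, j))"
  by (simp add: mat_integral_def)

lemma mat_integral_mult_left:
  assumes f: "mat_continuous m n f" and C: "C \<in> carrier_mat l m"
  shows "C * mat_integral m n T f = mat_integral l n T (\<lambda>t. C * f t)"
proof (rule eq_matI)
  fix i j assume "i < dim_row (mat_integral l n T (\<lambda>t. C * f t))" "j < dim_col (mat_integral l n T (\<lambda>t. C * f t))"
  then have ij: "i < l" "j < n" by (auto simp: mat_integral_def)
  have "integral {0..T} (\<lambda>t. \<Sum>k<m. C $$ (i, k) * f t $$ (k, j)) =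
      (\<Sum>k<m. integral {0..T} (\<lambda>t. C $$ (i, k) * f t $$ (k, j)))"
    using ij mat_continuousD(2)[OF f]
    by (intro integral_sum integrable_continuous_interval continuous_intros) auto
  then show "(C * mat_integral m n T f) $$ (i, j) = mat_integral l n T (\<lambda>t. C * f t) $$ (i, j)"
    using ij by (simp add: index_mult_sum[OF C mat_integral_carrier]
        index_mult_sum[OF C mat_continuousD(1)[OF f]] del: index_mult_mat(1))
qed (use C in \<open>auto simp: mat_integral_def\<close>)

lemma mat_integral_mult_right:
  assumes f: "mat_continuous m n f" and C: "C \<in> carrier_mat n l"
  shows "mat_integral m n T f * C = mat_integral m l T (\<lambda>t. f t * C)"
proof (rule eq_matI)
  fix i j assume "i < dim_row (mat_integral m l T (\<lambda>t. f t * C))" "j < dim_col (mat_integral m l T (\<lambda>t. f t * C))"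
  then have ij: "i < m" "j < l" by (auto simp: mat_integral_def)
  have "integral {0..T} (\<lambda>t. \<Sum>k<n. f t $$ (i, k) * C $$ (k, j)) =
      (\<Sum>k<n. integral {0..T} (\<lambda>t. f t $$ (i, k) * C $$ (k, j)))"
    using ij mat_continuousD(2)[OF f]
    by (intro integral_sum integrable_continuous_interval continuous_intros) auto
  then show "(mat_integral m n T f * C) $$ (i, j) = mat_integral m l T (\<lambda>t. f t * C) $$ (i, j)"
    using ij by (simp add: index_mult_sum[OF mat_integral_carrier C]
        index_mult_sum[OF mat_continuousD(1)[OF f] C] del: index_mult_mat(1))
qed (use C in \<open>auto simp: mat_integral_def\<close>)

lemma mat_integral_add:
  assumes f: "mat_continuous m n f" and g: "mat_continuous m n g"
  shows "mat_integral m n T (\<lambda>t. f t + g t) = mat_integral m n T f + mat_integral m n T g"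
  using mat_continuousD(2)[OF f] mat_continuousD(2)[OF g]
    carrier_matD[OF mat_continuousD(1)[OF f]] carrier_matD[OF mat_continuousD(1)[OF g]]
  by (intro eq_matI) (auto simp: mat_integral_def integral_add integrable_continuous_interval)

lemma mat_integral_derivative:
  assumes f: "has_mat_derivative m n f f'" and "0 \<le> T"
  shows "mat_integral m n T f' = f T - f 0"
proof (rule eq_matI)
  fix i j assume "i < dim_row (f T - f 0)" "j < dim_col (f T - f 0)"
  then have ij: "i < m" "j < n" using has_mat_derivativeD(1)[OF f, of 0] by auto
  have "((\<lambda>t. f' t $$ (i, j)) has_integral (f T $$ (i, j) - f 0 $$ (i, j))) {0..T}"
    using has_mat_derivativeD(3)[OF f ij] \<open>0 \<le> T\<close>
    by (intro fundamental_theorem_of_calculus) (auto intro: has_vector_derivative_at_within)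
  then show "mat_integral m n T f' $$ (i, j) = (f T - f 0) $$ (i, j)"
    using ij has_mat_derivativeD(1)[OF f, of 0] by (auto intro: integral_unique)
qed (use has_mat_derivativeD(1)[OF f, of 0] in \<open>auto simp: mat_integral_def\<close>)

lemma quad_form_mat_integral:
  assumes f: "mat_continuous n n f" and v: "v \<in> carrier_vec n"
  shows "((\<lambda>t. quad_form (f t) v) has_integral quad_form (mat_integral n n T f) v) {0..T}"
proof -
  have "((\<lambda>t. \<Sum>i<n. \<Sum>j<n. f t $$ (i, j) * v $ j * cnj (v $ i)) has_integral
      (\<Sum>i<n. \<Sum>j<n. integral {0..T} (\<lambda>t. f t $$ (i, j)) * v $ j * cnj (v $ i))) {0..T}"
    using mat_continuousD(2)[OF f]
    by (intro has_integral_sum has_integral_mult_left integrable_integral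
        integrable_continuous_interval) auto
  then show ?thesis
    by (simp add: quad_form_sum[OF mat_continuousD(1)[OF f] v] quad_form_sum[OF mat_integral_carrier v])
qed

lemma minus_mat_eq_0:
  fixes A :: "'a::ab_group_add mat"
  assumes "A \<in> carrier_mat m n" "B \<in> carrier_mat m n" "A - B = 0\<^sub>m m n"
  shows "A = B"
proof (rule eq_matI)
  fix i j assume ij: "i < dim_row B" "j < dim_col B"
  have "(A - B) $$ (i, j) = 0\<^sub>m m n $$ (i, j)" using assms(3) by simp
  then show "A $$ (i, j) = B $$ (i, j)" using ij assms(2) by auto
qed (use assms(1,2) in auto)

section \<open>The Lyapunov equation\<close>

lemma mat_tendsto_congruence_zero:
  assumes Z: "Z \<in> carrier_mat n n" and E: "mat_tendsto n n E (0\<^sub>m n n) F"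
  shows "mat_tendsto n n (\<lambda>t. E t * Z * mat_adjoint (E t)) (0\<^sub>m n n) F"
proof -
  have "mat_adjoint (0\<^sub>m n n) \<in> carrier_mat n n" by simp
  then have "0\<^sub>m n n * Z * mat_adjoint (0\<^sub>m n n) = 0\<^sub>m n n" using Z by simp
  then show ?thesis
    using mat_tendsto_mult[OF mat_tendsto_mult[OF E mat_tendsto_const[OF Z]] mat_tendsto_adjoint[OF E]]
    by simp
qed

text \<open>Product rule. It displays the Lyapunov operator as a generator: the curve
  \<open>Y = E Z E^*\<close> satisfies \<open>Y' = K Y + Y K^*\<close> as soon as
  \<open>E' = K E\<close>.\<close>

lemma has_mat_derivative_congruence:
  assumes K: "K \<in> carrier_mat n n" and Z: "Z \<in> carrier_mat n n"
    and E: "has_mat_derivative n n E (\<lambda>t. K * E t)"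
  shows "has_mat_derivative n n (\<lambda>t. E t * Z * mat_adjoint (E t))
    (\<lambda>t. K * (E t * Z * mat_adjoint (E t)) + (E t * Z * mat_adjoint (E t)) * mat_adjoint K)"
proof -
  note Ec = has_mat_derivativeD(1)[OF E]
  have eq: "(K * E t * Z + E t * 0\<^sub>m n n) * mat_adjoint (E t) + E t * Z * mat_adjoint (K * E t) =
    K * (E t * Z * mat_adjoint (E t)) + (E t * Z * mat_adjoint (E t)) * mat_adjoint K" for t
  proof -
    have a: "mat_adjoint (K * E t) = mat_adjoint (E t) * mat_adjoint K"
      using K Ec by (rule mat_adjoint_mult)
    have c: "mat_adjoint (E t) \<in> carrier_mat n n" "mat_adjoint K \<in> carrier_mat n n"
      using Ec K by auto
    have "K * E t * Z + E t * 0\<^sub>m n n = K * (E t * Z)"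
      using Ec[of t] K Z by (simp add: assoc_mult_mat[of _ n n _ n _ n])
    then show ?thesis
      using Ec[of t] K Z c unfolding a
      by (simp add: assoc_mult_mat[of _ n n _ n _ n])
  qed
  show ?thesis
    using has_mat_derivative_mult[OF has_mat_derivative_mult[OF E has_mat_derivative_const[OF Z]]
        has_mat_derivative_adjoint[OF E]] unfolding eq .
qed

text \<open>Integrating \<open>f' = K f + f K^*\<close> for \<open>f = E R E^*\<close> over
  \<open>[0, T]\<close> gives \<open>K V T + V T K^* = f T - R\<close>, where \<open>V T\<close> is
  the integral of \<open>f\<close>. The term \<open>f T\<close> decays, and
  \<open>T \<rightarrow> \<infinity>\<close> leaves the equation for the improper integral.\<close>

lemma lyapunov_limit:
  assumes K: "K \<in> carrier_mat n n" and R: "R \<in> carrier_mat n n"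
    and E: "has_mat_derivative n n E (\<lambda>t. K * E t)" and E0: "E 0 = 1\<^sub>m n"
    and decay: "mat_tendsto n n E (0\<^sub>m n n) at_top"
    and X: "mat_tendsto n n (\<lambda>T. mat_integral n n T (\<lambda>t. E t * R * mat_adjoint (E t))) X at_top"
  shows "K * X + X * mat_adjoint K + R = 0\<^sub>m n n"
proof -
  note der = has_mat_derivative_congruence[OF K R E]
  define f where "f = (\<lambda>t. E t * R * mat_adjoint (E t))"
  define V where "V = (\<lambda>T. mat_integral n n T f)"
  have Kad: "mat_adjoint K \<in> carrier_mat n n" using K by simp
  have cont: "mat_continuous n n f"
    using has_mat_derivative_continuous[OF der] unfolding f_def .
  have XV: "mat_tendsto n n V X at_top" using X unfolding V_def f_def .
  have lim: "mat_tendsto n n (\<lambda>T. K * V T + V T * mat_adjoint K + R) (K * X + X * mat_adjoint K + R) at_top"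
    using mat_tendsto_add[OF mat_tendsto_add[OF mat_tendsto_mult[OF mat_tendsto_const[OF K] XV]
          mat_tendsto_mult[OF XV mat_tendsto_const[OF Kad]]] mat_tendsto_const[OF R]] .
  have *: "K * V T + V T * mat_adjoint K + R = f T" if "0 \<le> T" for T
  proof -
    have c1: "mat_continuous n n (\<lambda>t. K * f t)" "mat_continuous n n (\<lambda>t. f t * mat_adjoint K)"
      using K Kad cont by (auto intro!: mat_continuous_mult mat_continuous_const)
    have "K * V T + V T * mat_adjoint K = mat_integral n n T (\<lambda>t. K * f t + f t * mat_adjoint K)"
      unfolding V_def mat_integral_mult_left[OF cont K] mat_integral_mult_right[OF cont Kad]
        mat_integral_add[OF c1] ..
    also have "\<dots> = f T - f 0"
      using mat_integral_derivative[OF der that] unfolding f_def .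
    also have "f 0 = R" using R by (simp add: E0 f_def)
    finally show ?thesis using R mat_continuousD(1)[OF cont, of T] by (intro eq_matI) auto
  qed
  have "mat_tendsto n n (\<lambda>T. K * V T + V T * mat_adjoint K + R) (0\<^sub>m n n) at_top"
  proof (rule mat_tendstoI)
    fix i j assume ij: "i < n" "j < n"
    have "\<forall>\<^sub>F T in at_top. f T $$ (i, j) = (K * V T + V T * mat_adjoint K + R) $$ (i, j)"
      using eventually_ge_at_top[of 0] by eventually_elim (simp only: *)
    then show "((\<lambda>T. (K * V T + V T * mat_adjoint K + R) $$ (i, j)) \<longlongrightarrow> 0\<^sub>m n n $$ (i, j)) at_top"
      using mat_tendstoD(3)[OF mat_tendsto_congruence_zero[OF R decay] ij] unfolding f_def
      by (rule Lim_transform_eventually[rotated])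
  qed (use mat_tendstoD(1)[OF lim] in auto)
  then show ?thesis using lim by (intro mat_tendsto_unique) auto
qed

text \<open>Since \<open>K\<close> commutes with \<open>E t\<close>, the derivative of
  \<open>E Z E^*\<close> is \<open>E (K Z + Z K^* ) E^*\<close>, which is zero. The curve is
  therefore constant; it starts at \<open>Z\<close> and decays to zero.\<close>

lemma lyapunov_homogeneous:
  assumes K: "K \<in> carrier_mat n n" and Z: "Z \<in> carrier_mat n n"
    and E: "has_mat_derivative n n E (\<lambda>t. K * E t)"
    and comm: "\<And>t. K * E t = E t * K" and E0: "E 0 = 1\<^sub>m n"
    and decay: "mat_tendsto n n E (0\<^sub>m n n) at_top"
    and KZ: "K * Z + Z * mat_adjoint K = 0\<^sub>m n n"
  shows "Z = 0\<^sub>m n n"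
proof -
  note Ec = has_mat_derivativeD(1)[OF E]
  note der = has_mat_derivative_congruence[OF K Z E]
  define f where "f = (\<lambda>t. E t * Z * mat_adjoint (E t))"
  have Kad: "mat_adjoint K \<in> carrier_mat n n" using K by simp
  have Ead: "mat_adjoint (E t) \<in> carrier_mat n n" for t using Ec by simp
  have fc: "f t \<in> carrier_mat n n" for t using Ec Ead Z unfolding f_def by (intro mult_carrier_mat)
  have zero: "K * f t + f t * mat_adjoint K = 0\<^sub>m n n" for t
  proof -
    have c: "mat_adjoint (E t) * mat_adjoint K = mat_adjoint K * mat_adjoint (E t)"
      using mat_adjoint_mult[OF K Ec[of t]] mat_adjoint_mult[OF Ec[of t] K] comm[of t] by simp
    have "K * f t = (K * E t) * (Z * mat_adjoint (E t))"
      using K Ec[of t] Z Ead[of t] by (simp add: f_def assoc_mult_mat[of _ n n _ n _ n])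
    also have "\<dots> = E t * (K * Z) * mat_adjoint (E t)"
      using K Ec[of t] Z Ead[of t] unfolding comm by (simp add: assoc_mult_mat[of _ n n _ n _ n])
    finally have 1: "K * f t = E t * (K * Z) * mat_adjoint (E t)" .
    have "f t * mat_adjoint K = E t * Z * (mat_adjoint K * mat_adjoint (E t))"
      using K Ec[of t] Z Ead[of t] Kad by (simp add: f_def c assoc_mult_mat[of _ n n _ n _ n])
    also have "\<dots> = E t * (Z * mat_adjoint K) * mat_adjoint (E t)"
      using K Ec[of t] Z Ead[of t] Kad by (simp add: assoc_mult_mat[of _ n n _ n _ n])
    finally have 2: "f t * mat_adjoint K = E t * (Z * mat_adjoint K) * mat_adjoint (E t)" .
    have KZc: "K * Z \<in> carrier_mat n n" "Z * mat_adjoint K \<in> carrier_mat n n" using K Z Kad by auto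
    have "K * f t + f t * mat_adjoint K = (E t * (K * Z) + E t * (Z * mat_adjoint K)) * mat_adjoint (E t)"
      unfolding 1 2
      using add_mult_distrib_mat[OF mult_carrier_mat[OF Ec KZc(1)] mult_carrier_mat[OF Ec KZc(2)] Ead]
      by simp
    also have "\<dots> = E t * (K * Z + Z * mat_adjoint K) * mat_adjoint (E t)"
      using mult_add_distrib_mat[OF Ec[of t] KZc] by simp
    also have "\<dots> = 0\<^sub>m n n" unfolding KZ using Ec[of t] Ead[of t] by simp
    finally show ?thesis .
  qed
  have const: "f t = Z" if "0 \<le> t" for t
  proof -
    have "f t - f 0 = mat_integral n n t (\<lambda>t. 0\<^sub>m n n)"
      using mat_integral_derivative[OF der that] zero unfolding f_def by simp
    moreover have "mat_integral n n t (\<lambda>t. 0\<^sub>m n n) = 0\<^sub>m n n"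
      by (intro eq_matI) (auto simp: mat_integral_def)
    moreover have "f 0 = Z" using Z by (simp add: f_def E0)
    ultimately have "f t - Z = 0\<^sub>m n n" by simp
    then show ?thesis by (rule minus_mat_eq_0[OF fc Z])
  qed
  have "mat_tendsto n n f Z at_top"
  proof (rule mat_tendstoI)
    fix i j assume ij: "i < n" "j < n"
    have "\<forall>\<^sub>F t in at_top. Z $$ (i, j) = f t $$ (i, j)"
      using eventually_ge_at_top[of 0] by eventually_elim (simp only: const)
    then show "((\<lambda>t. f t $$ (i, j)) \<longlongrightarrow> Z $$ (i, j)) at_top"
      by (rule Lim_transform_eventually[OF tendsto_const])
  qed (rule fc Z)+
  then show ?thesis
    using mat_tendsto_congruence_zero[OF Z decay] unfolding f_def
    by (intro mat_tendsto_unique) auto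
qed

text \<open>The improper integral is a solution, and two solutions differ by a solution of the
  homogeneous equation. The flow \<open>E\<close> is left abstract because it will be the
  exponential of the stable part and, in reversed time, that of the antistable part.\<close>

lemma lyapunov_sol_eqI:
  assumes K: "K \<in> carrier_mat n n" and R: "R \<in> carrier_mat n n"
    and E: "has_mat_derivative n n E (\<lambda>t. K * E t)"
    and comm: "\<And>t. K * E t = E t * K" and E0: "E 0 = 1\<^sub>m n"
    and decay: "mat_tendsto n n E (0\<^sub>m n n) at_top"
    and X: "mat_tendsto n n (\<lambda>T. mat_integral n n T (\<lambda>t. E t * R * mat_adjoint (E t))) X at_top"
  shows "lyapunov_sol K R = X"
proof -
  have Xc: "X \<in> carrier_mat n n" using mat_tendstoD(2)[OF X] .
  have Kad: "mat_adjoint K \<in> carrier_mat n n" using K by simp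
  note sol = lyapunov_limit[OF K R E E0 decay X]
  have uniq: "Y = X" if Y: "Y \<in> carrier_mat n n" "K * Y + Y * mat_adjoint K + R = 0\<^sub>m n n" for Y
  proof -
    have Z: "Y - X \<in> carrier_mat n n" using Xc by (rule minus_carrier_mat)
    have d: "K * (Y - X) = K * Y - K * X" "(Y - X) * mat_adjoint K = Y * mat_adjoint K - X * mat_adjoint K"
      using mult_minus_distrib_mat[OF K Y(1) Xc] minus_mult_distrib_mat[OF Y(1) Xc Kad] .
    have c: "K * Y \<in> carrier_mat n n" "K * X \<in> carrier_mat n n"
      "Y * mat_adjoint K \<in> carrier_mat n n" "X * mat_adjoint K \<in> carrier_mat n n"
      using K Kad Y Xc by (auto intro!: mult_carrier_mat)
    have "K * (Y - X) + (Y - X) * mat_adjoint K = 0\<^sub>m n n"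
    proof (rule eq_matI)
      fix i j assume "i < dim_row (0\<^sub>m n n)" "j < dim_col (0\<^sub>m n n)"
      then have ij: "i < n" "j < n" by auto
      have "(K * Y + Y * mat_adjoint K + R) $$ (i, j) = (K * X + X * mat_adjoint K + R) $$ (i, j)"
        unfolding Y(2) sol ..
      then have "(K * Y) $$ (i, j) + (Y * mat_adjoint K) $$ (i, j) =
          (K * X) $$ (i, j) + (X * mat_adjoint K) $$ (i, j)"
        using ij R c[THEN carrier_matD(1)] c[THEN carrier_matD(2)] by (simp del: index_mult_mat)
      then show "(K * (Y - X) + (Y - X) * mat_adjoint K) $$ (i, j) = 0\<^sub>m n n $$ (i, j)"
        unfolding d using ij c[THEN carrier_matD(1)] c[THEN carrier_matD(2)]
        by (simp del: index_mult_mat add: algebra_simps)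
    qed (use c in \<open>auto simp: d\<close>)
    from lyapunov_homogeneous[OF K Z E comm E0 decay this] show ?thesis
      by (rule minus_mat_eq_0[OF Y(1) Xc])
  qed
  have dim: "dim_row K = n" using K by simp
  show ?thesis
    unfolding lyapunov_sol_def dim
    by (rule the_equality) (use Xc sol uniq in blast)+
qed

section \<open>Exponential polynomials\<close>

text \<open>The entry of \<open>exp (t J)\<close> at distance \<open>m\<close> above the diagonal,
  within a Jordan block with eigenvalue \<mu>.\<close>

definition exp_pow :: "complex \<Rightarrow> nat \<Rightarrow> real \<Rightarrow> complex" where
  "exp_pow \<mu> m t = exp (\<mu> * of_real t) * of_real t ^ m / fact m"

lemma exp_pow_at_0 [simp]: "exp_pow \<mu> m 0 = (if m = 0 then 1 else 0)"
  by (simp add: exp_pow_def power_0_left)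

lemma exp_pow_derivative:
  "(exp_pow \<mu> m has_vector_derivative
     \<mu> * exp_pow \<mu> m t + (if m = 0 then 0 else exp_pow \<mu> (m - 1) t)) (at t within S)"
proof (cases m)
  case 0
  have "((\<lambda>z. exp (\<mu> * z)) has_field_derivative exp (\<mu> * of_real t) * \<mu>) (at (of_real t))"
    by (auto intro!: derivative_eq_intros)
  from has_vector_derivative_real_field[OF this] 0 show ?thesis
    by (simp add: exp_pow_def[abs_def] mult.commute)
next
  case (Suc k)
  have "((\<lambda>z. exp (\<mu> * z) * z ^ Suc k / fact (Suc k)) has_field_derivative
     (exp (\<mu> * of_real t) * \<mu> * of_real t ^ Suc k + of_nat (Suc k) * of_real t ^ k * exp (\<mu> * of_real t)) / fact (Suc k))
     (at (of_real t))"
    by (auto intro!: derivative_eq_intros simp del: power_Suc fact_Suc of_nat_Suc)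
      (cases k; simp add: algebra_simps)
  also have "(exp (\<mu> * of_real t) * \<mu> * of_real t ^ Suc k + of_nat (Suc k) * of_real t ^ k * exp (\<mu> * of_real t)) / fact (Suc k)
     = \<mu> * exp_pow \<mu> m t + exp_pow \<mu> k t"
    using Suc by (simp add: exp_pow_def field_simps del: of_nat_Suc)
  finally show ?thesis
    using has_vector_derivative_real_field Suc by (fastforce simp: exp_pow_def[abs_def])
qed

lemma exp_pow_continuous: "continuous_on S (exp_pow \<mu> m)"
  by (rule continuous_on_vector_derivative[OF exp_pow_derivative])

text \<open>Integrated form of \<open>exp_pow_derivative\<close>: a recursion in \<open>m\<close>
  for the integrals. No division by \<mu> takes place, so the case \<mu> = 0 is included; it yields
  \<open>exp_pow_integral_0\<close>.\<close>

lemma exp_pow_integral: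
  assumes "0 \<le> T"
  shows "\<mu> * integral {0..T} (exp_pow \<mu> m) +
      (if m = 0 then 0 else integral {0..T} (exp_pow \<mu> (m - 1))) =
    exp_pow \<mu> m T - (if m = 0 then 1 else 0)"
proof -
  have *: "exp_pow \<mu> k integrable_on {0..T}" for k
    by (intro integrable_continuous_interval exp_pow_continuous)
  have "((\<lambda>t. \<mu> * exp_pow \<mu> m t + (if m = 0 then 0 else exp_pow \<mu> (m - 1) t)) has_integral
      exp_pow \<mu> m T - exp_pow \<mu> m 0) {0..T}"
    using assms by (intro fundamental_theorem_of_calculus exp_pow_derivative) auto
  moreover have "((\<lambda>t. \<mu> * exp_pow \<mu> m t + (if m = 0 then 0 else exp_pow \<mu> (m - 1) t)) has_integral
      \<mu> * integral {0..T} (exp_pow \<mu> m) + (if m = 0 then 0 else integral {0..T} (exp_pow \<mu> (m - 1)))) {0..T}"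
    using * by (intro has_integral_add has_integral_mult_right integrable_integral)
      (auto intro: has_integral_0)
  ultimately show ?thesis by (auto dest: has_integral_unique)
qed

text \<open>A single term of the exponential series with nonnegative terms.\<close>

lemma power_over_fact_le_exp:
  assumes "0 \<le> (x::real)"
  shows "x ^ m / fact m \<le> exp x"
proof -
  have "(\<Sum>k\<in>{m}. x ^ k /\<^sub>R fact k) \<le> (\<Sum>k. x ^ k /\<^sub>R fact k)"
    using assms by (intro sum_le_suminf summable_exp_generic) auto
  then show ?thesis by (simp add: exp_def divide_inverse mult.commute)
qed

lemma norm_exp_pow: "0 \<le> t \<Longrightarrow> norm (exp_pow \<mu> m t) = exp (Re \<mu> * t) * t ^ m / fact m"
  by (simp add: exp_pow_def norm_mult norm_divide norm_power norm_exp_eq_Re)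

text \<open>Half of the decay rate, \<epsilon> = \<open>- Re \<mu> / 2\<close>, is spent on
  absorbing the polynomial factor through
  \<open>(\<epsilon> * t) ^ m / fact m \<le> exp (\<epsilon> * t)\<close>; the other half
  remains.\<close>

lemma exp_pow_decay:
  assumes "Re \<mu> < 0"
  obtains C \<epsilon> where "0 \<le> C" "0 < \<epsilon>" "\<And>t. 0 \<le> t \<Longrightarrow> norm (exp_pow \<mu> m t) \<le> C * exp (- \<epsilon> * t)"
proof
  define \<epsilon> where "\<epsilon> = - Re \<mu> / 2"
  have e: "0 < \<epsilon>" "Re \<mu> = - \<epsilon> - \<epsilon>" using assms by (auto simp: \<epsilon>_def)
  show "0 \<le> 1 / \<epsilon> ^ m" "0 < \<epsilon>" using e by auto
  fix t :: real assume t: "0 \<le> t"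
  have "(\<epsilon> * t) ^ m / fact m \<le> exp (\<epsilon> * t)" using e t by (intro power_over_fact_le_exp) auto
  then have "t ^ m / fact m \<le> exp (\<epsilon> * t) / \<epsilon> ^ m"
    using e by (simp add: field_simps power_mult_distrib)
  then have "exp (Re \<mu> * t) * (t ^ m / fact m) \<le> exp (Re \<mu> * t) * (exp (\<epsilon> * t) / \<epsilon> ^ m)"
    by (intro mult_left_mono) auto
  also have "\<dots> = 1 / \<epsilon> ^ m * exp (- \<epsilon> * t)"
    by (simp add: e(2) left_diff_distrib flip: exp_add)
  finally show "norm (exp_pow \<mu> m t) \<le> 1 / \<epsilon> ^ m * exp (- \<epsilon> * t)"
    using t by (simp add: norm_exp_pow)
qed

lemma exp_pow_tendsto_0:
  assumes "Re \<mu> < 0"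
  shows "(exp_pow \<mu> m \<longlongrightarrow> 0) at_top"
proof -
  obtain C \<epsilon> where C: "0 \<le> C" "0 < \<epsilon>" "\<And>t. 0 \<le> t \<Longrightarrow> norm (exp_pow \<mu> m t) \<le> C * exp (- \<epsilon> * t)"
    using exp_pow_decay[OF assms] by blast
  have "((\<lambda>t. C * exp (- \<epsilon> * t)) \<longlongrightarrow> 0) at_top" using C(2) by real_asymp
  then show ?thesis
    by (rule Lim_null_comparison[rotated]) (use C(3) in \<open>auto intro: eventually_mono[OF eventually_ge_at_top[of 0]]\<close>)
qed

text \<open>Induction on \<open>m\<close>: the recursion \<open>exp_pow_integral\<close> can be
  divided by \<mu>, and its boundary term decays.\<close>

lemma exp_pow_integral_convergent:
  assumes "Re \<mu> < 0"
  shows "\<exists>L. ((\<lambda>T. integral {0..T} (exp_pow \<mu> m)) \<longlongrightarrow> L) at_top"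
proof (induction m)
  have ne: "\<mu> \<noteq> 0" using assms by auto
  case 0
  have "((\<lambda>T. (exp_pow \<mu> 0 T - 1) / \<mu>) \<longlongrightarrow> (0 - 1) / \<mu>) at_top"
    using ne by (intro tendsto_intros exp_pow_tendsto_0 assms) auto
  moreover have "\<forall>\<^sub>F T in at_top. (exp_pow \<mu> 0 T - 1) / \<mu> = integral {0..T} (exp_pow \<mu> 0)"
    using eventually_ge_at_top[of 0]
    by eventually_elim (use exp_pow_integral[of _ \<mu> 0] ne in \<open>auto simp: field_simps\<close>)
  ultimately show ?case by (blast intro: Lim_transform_eventually)
next
  have ne: "\<mu> \<noteq> 0" using assms by auto
  case (Suc m)
  then obtain L where L: "((\<lambda>T. integral {0..T} (exp_pow \<mu> m)) \<longlongrightarrow> L) at_top" by blast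
  have "((\<lambda>T. (exp_pow \<mu> (Suc m) T - integral {0..T} (exp_pow \<mu> m)) / \<mu>) \<longlongrightarrow> (0 - L) / \<mu>) at_top"
    using ne by (intro tendsto_intros exp_pow_tendsto_0 assms L) auto
  moreover have "\<forall>\<^sub>F T in at_top. (exp_pow \<mu> (Suc m) T - integral {0..T} (exp_pow \<mu> m)) / \<mu> =
      integral {0..T} (exp_pow \<mu> (Suc m))"
    using eventually_ge_at_top[of 0]
    by eventually_elim (use exp_pow_integral[of _ \<mu> "Suc m"] ne in \<open>auto simp: field_simps\<close>)
  ultimately show ?case by (blast intro: Lim_transform_eventually)
qed

text \<open>The integrand has modulus \<open>t ^ m / fact m\<close>, yet the recursion shows that
  oscillation costs one power of \<open>T\<close>: the boundary term is of order
  \<open>T ^ m\<close>, and the remaining integral is covered by induction. This makes different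
  imaginary eigenvalues asymptotically orthogonal.\<close>

lemma exp_pow_integral_oscillating:
  assumes "Re \<mu> = 0" "\<mu> \<noteq> 0"
  shows "((\<lambda>T. integral {0..T} (exp_pow \<mu> m) / of_real T ^ Suc m) \<longlongrightarrow> 0) at_top"
proof (induction m)
  have *: "((\<lambda>T. exp_pow \<mu> k T / of_real T ^ Suc k) \<longlongrightarrow> 0) at_top" for k
  proof (rule Lim_null_comparison)
    show "\<forall>\<^sub>F T in at_top. norm (exp_pow \<mu> k T / of_real T ^ Suc k) \<le> 1 / T"
      using eventually_gt_at_top[of 0]
    proof eventually_elim
      case (elim T)
      then have "norm (exp_pow \<mu> k T / of_real T ^ Suc k) = 1 / fact k / T"
        using assms by (simp add: norm_divide norm_exp_pow norm_mult norm_power field_simps)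
      also have "\<dots> \<le> 1 / T" using elim fact_ge_1[of k, where 'a=real] by (simp add: divide_simps)
      finally show ?case .
    qed
    show "((\<lambda>T::real. 1 / T) \<longlongrightarrow> 0) at_top" by real_asymp
  qed
  {
    case 0
    have "((\<lambda>T. (exp_pow \<mu> 0 T / of_real T ^ Suc 0 - of_real (1 / T)) / \<mu>) \<longlongrightarrow> (0 - of_real 0) / \<mu>) at_top"
      using assms by (intro tendsto_divide tendsto_diff * tendsto_of_real tendsto_const) (auto, real_asymp)
    moreover have "\<forall>\<^sub>F T in at_top. (exp_pow \<mu> 0 T / of_real T ^ Suc 0 - of_real (1 / T)) / \<mu> =
        integral {0..T} (exp_pow \<mu> 0) / of_real T ^ Suc 0"
      using eventually_gt_at_top[of 0]
    proof eventually_elim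
      case (elim T)
      then have "exp_pow \<mu> 0 T = 1 + \<mu> * integral {0..T} (exp_pow \<mu> 0)"
        using exp_pow_integral[of T \<mu> 0] by (simp add: algebra_simps)
      then show ?case using elim assms by (simp add: field_simps)
    qed
    ultimately show ?case by (auto intro: Lim_transform_eventually)
  next
    case (Suc m)
    have "((\<lambda>T. (exp_pow \<mu> (Suc m) T / of_real T ^ Suc (Suc m) -
        integral {0..T} (exp_pow \<mu> m) / of_real T ^ Suc m * of_real (1 / T)) / \<mu>) \<longlongrightarrow> (0 - 0 * of_real 0) / \<mu>) at_top"
      using assms by (intro tendsto_divide tendsto_diff tendsto_mult Suc * tendsto_of_real tendsto_const) (auto, real_asymp)
    moreover have "\<forall>\<^sub>F T in at_top. (exp_pow \<mu> (Suc m) T / of_real T ^ Suc (Suc m) -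
        integral {0..T} (exp_pow \<mu> m) / of_real T ^ Suc m * of_real (1 / T)) / \<mu> =
        integral {0..T} (exp_pow \<mu> (Suc m)) / of_real T ^ Suc (Suc m)"
      using eventually_gt_at_top[of 0]
    proof eventually_elim
      case (elim T)
      then have "\<mu> * integral {0..T} (exp_pow \<mu> (Suc m)) = exp_pow \<mu> (Suc m) T - integral {0..T} (exp_pow \<mu> m)"
        using exp_pow_integral[of T \<mu> "Suc m"] by (simp add: algebra_simps)
      then have "integral {0..T} (exp_pow \<mu> (Suc m)) = (exp_pow \<mu> (Suc m) T - integral {0..T} (exp_pow \<mu> m)) / \<mu>"
        using assms by (simp add: field_simps)
      then show ?case using elim by (simp add: diff_divide_distrib mult_ac)
    qed
    ultimately show ?case by (auto intro: Lim_transform_eventually)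
  }
qed

lemma exp_pow_integral_0:
  assumes "0 \<le> T"
  shows "integral {0..T} (exp_pow 0 m) = of_real T ^ Suc m / fact (Suc m)"
  using exp_pow_integral[OF assms, of 0 "Suc m"] by (simp add: exp_pow_def)

lemma cnj_exp: "cnj (exp z) = exp (cnj z)"
  by (simp add: complex_eq_iff Re_exp Im_exp)

text \<open>Exponential polynomials are closed under \<open>f * cnj g\<close>, so every entry of a
  Gramian reduces to integrals of single functions \<open>exp_pow\<close>.\<close>

lemma exp_pow_mult_cnj:
  "exp_pow \<mu> a t * cnj (exp_pow \<nu> b t) = of_nat ((a + b) choose a) * exp_pow (\<mu> + cnj \<nu>) (a + b) t"
proof -
  have "of_nat ((a + b) choose a) = (fact (a + b) / (fact a * fact b) :: complex)"
    by (simp add: binomial_fact)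
  then show ?thesis
    by (simp add: exp_pow_def cnj_exp exp_add distrib_right power_add field_simps)
qed

text \<open>The binomial theorem. For the entries of a Jordan block it is the semigroup law of the
  exponential.\<close>

lemma exp_pow_add: "exp_pow \<mu> m (x + y) = (\<Sum>k\<le>m. exp_pow \<mu> k x * exp_pow \<mu> (m - k) y)"
proof -
  have "exp_pow \<mu> m (x + y) = exp (\<mu> * (of_real x + of_real y)) * ((of_real x + of_real y) ^ m / fact m)"
    by (simp add: exp_pow_def)
  also have "(of_real x + of_real y) ^ m / fact m =
      (\<Sum>k\<le>m. (of_real x ^ k / fact k) * (of_real y ^ (m - k) / fact (m - k) :: complex))"
    unfolding binomial_ring sum_divide_distrib
    by (intro sum.cong refl) (auto simp: binomial_fact field_simps)
  finally show ?thesis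
    by (simp add: exp_pow_def sum_distrib_left exp_add distrib_left mult_ac)
qed

lemma exp_pow_uminus: "exp_pow \<mu> m (- t) = (-1) ^ m * exp_pow (- \<mu>) m t"
  by (simp add: exp_pow_def power_minus[of "of_real t"])

text \<open>The substitution of \<open>T - t\<close> for \<open>t\<close>. Scaled antistable entries
  depend on \<open>t - T\<close>; in reversed time they become decaying functions on an interval
  that starts at 0.\<close>

lemma integral_diff_reflect:
  fixes f :: "real \<Rightarrow> 'a::euclidean_space"
  shows "integral {0..T} (\<lambda>t. f (t - T)) = integral {0..T} (\<lambda>t. f (- t))"
proof -
  have "integral {0..T} (f \<circ> (+) (- T)) = integral {0 + (- T)..T + (- T)} f"
    by (rule integral_shift_Icc_real)
  also have "\<dots> = integral {0..T} (\<lambda>t. f (- t))"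
    using integral_reflect_real[of 0 "-T" f] by simp
  finally show ?thesis by (simp add: o_def)
qed

section \<open>Jordan matrices and their exponentials\<close>

text \<open>A Jordan matrix in terms of global indices: \<open>bid r\<close> is the number of the block of row \<open>r\<close> and
  \<open>lam r\<close> its eigenvalue.\<close>

locale jordan_index =
  fixes n :: nat and lam :: "nat \<Rightarrow> complex" and bid :: "nat \<Rightarrow> nat"
  assumes bid_mono: "r \<le> s \<Longrightarrow> s < n \<Longrightarrow> bid r \<le> bid s"
    and lam_eq: "r < n \<Longrightarrow> s < n \<Longrightarrow> bid r = bid s \<Longrightarrow> lam r = lam s"
begin

definition jmat :: "complex mat" where
  "jmat = mat n n (\<lambda>(r, s). if bid r = bid s then (if r = s then lam r else if s = Suc r then 1 else 0) else 0)"

definition jexp :: "real \<Rightarrow> complex mat" where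
  "jexp t = mat n n (\<lambda>(r, s). if bid r = bid s \<and> r \<le> s then exp_pow (lam r) (s - r) t else 0)"

lemma jmat_carrier [simp]: "jmat \<in> carrier_mat n n"
  by (simp add: jmat_def)

lemma jexp_carrier [simp]: "jexp t \<in> carrier_mat n n"
  by (simp add: jexp_def)

lemma jexp_index:
  "r < n \<Longrightarrow> s < n \<Longrightarrow>
    jexp t $$ (r, s) = (if bid r = bid s \<and> r \<le> s then exp_pow (lam r) (s - r) t else 0)"
  by (simp add: jexp_def)

lemma jexp_0: "jexp 0 = 1\<^sub>m n"
  by (rule eq_matI) (auto simp: jexp_def)

lemma bid_between:
  assumes "r \<le> u" "u \<le> s" "s < n" "bid r = bid s"
  shows "bid u = bid s" "lam u = lam s"
proof -
  show 1: "bid u = bid s" using bid_mono[of r u] bid_mono[of u s] assms by auto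
  then show "lam u = lam s" using lam_eq[of u s] assms by auto
qed

lemma jmat_mult_index:
  assumes M: "M \<in> carrier_mat n m" and r: "r < n" and s: "s < m"
  shows "(jmat * M) $$ (r, s) =
    lam r * M $$ (r, s) + (if Suc r < n \<and> bid (Suc r) = bid r then M $$ (Suc r, s) else 0)"
proof -
  have "(jmat * M) $$ (r, s) = (\<Sum>u<n. (if u = r then lam r * M $$ (r, s) else 0) +
      (if u = Suc r then (if bid (Suc r) = bid r then M $$ (Suc r, s) else 0) else 0))"
    unfolding index_mult_sum[OF jmat_carrier M r s]
    by (intro sum.cong refl) (use r in \<open>auto simp: jmat_def\<close>)
  then show ?thesis using r by (simp add: sum.distrib)
qed

lemma mult_jmat_index:
  assumes M: "M \<in> carrier_mat m n" and r: "r < m" and s: "s < n"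
  shows "(M * jmat) $$ (r, s) =
    M $$ (r, s) * lam s + (if s \<noteq> 0 \<and> bid (s - 1) = bid s then M $$ (r, s - 1) else 0)"
proof -
  have "(M * jmat) $$ (r, s) = (\<Sum>u<n. (if u = s then M $$ (r, s) * lam s else 0) +
      (if u = s - 1 then (if s \<noteq> 0 \<and> bid (s - 1) = bid s then M $$ (r, s - 1) else 0) else 0))"
    unfolding index_mult_sum[OF M jmat_carrier r s]
    by (intro sum.cong refl) (use s in \<open>auto simp: jmat_def\<close>)
  then show ?thesis using s by (auto simp: sum.distrib)
qed

lemma jmat_jexp_index:
  assumes "r < n" "s < n"
  shows "(jmat * jexp t) $$ (r, s) = (if bid r = bid s \<and> r \<le> s then
    lam r * exp_pow (lam r) (s - r) t + (if s = r then 0 else exp_pow (lam r) (s - r - 1) t) else 0)"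
proof (cases "bid r = bid s \<and> r < s")
  case True
  then have "bid (Suc r) = bid s" "lam (Suc r) = lam s" "lam r = lam s"
    using bid_between[of r "Suc r" s] bid_between[of r r s] assms by auto
  then show ?thesis
    using True assms by (simp add: jmat_mult_index[of _ n] jexp_index del: index_mult_mat(1))
next
  case False
  have "\<not> (Suc r \<le> s \<and> bid r = bid s)" using False by auto
  then show ?thesis
    using False assms by (auto simp: jmat_mult_index[of _ n] jexp_index simp del: index_mult_mat(1))
qed

text \<open>Left multiplication by \<open>jmat\<close> picks up the next row, right multiplication
  the previous column. The entries of \<open>jexp t\<close> depend only on the distance from the
  diagonal inside a block, so both give the same formula.\<close>

lemma jexp_commute: "jmat * jexp t = jexp t * jmat"
proof (rule eq_matI)
  fix r s assume "r < dim_row (jexp t * jmat)" "s < dim_col (jexp t * jmat)"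
  then have rs: "r < n" "s < n" by (auto simp: jmat_def jexp_def)
  have "(jexp t * jmat) $$ (r, s) = (if bid r = bid s \<and> r \<le> s then
    lam r * exp_pow (lam r) (s - r) t + (if s = r then 0 else exp_pow (lam r) (s - r - 1) t) else 0)"
  proof (cases "bid r = bid s \<and> r < s")
    case True
    then have "bid (s - 1) = bid s" "lam (s - 1) = lam s" "lam r = lam s" "s - 1 - r = s - r - 1"
      using bid_between[of r "s - 1" s] bid_between[of r r s] rs by auto
    then show ?thesis
      using True rs by (auto simp: mult_jmat_index[of _ n] jexp_index simp del: index_mult_mat(1))
  next
    case False
    then show ?thesis
      using rs by (auto simp: mult_jmat_index[of _ n] jexp_index simp del: index_mult_mat(1))
  qed
  then show "(jmat * jexp t) $$ (r, s) = (jexp t * jmat) $$ (r, s)"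
    using jmat_jexp_index[OF rs] by simp
qed (auto simp: jmat_def jexp_def)

lemma jexp_derivative: "has_mat_derivative n n jexp (\<lambda>t. jmat * jexp t)"
proof (rule has_mat_derivativeI)
  fix t r s assume rs: "r < n" "s < n"
  show "((\<lambda>t. jexp t $$ (r, s)) has_vector_derivative (jmat * jexp t) $$ (r, s)) (at t)"
    using exp_pow_derivative[of "lam r" "s - r" t UNIV]
    by (auto simp: jmat_jexp_index[OF rs] jexp_index[OF rs] has_vector_derivative_const)
qed (auto intro!: mult_carrier_mat[OF jmat_carrier])

lemma jexp_neg_derivative:
  "has_mat_derivative n n (\<lambda>t. jexp (- t)) (\<lambda>t. (- jmat) * jexp (- t))"
proof (rule has_mat_derivativeI)
  fix t r s assume rs: "r < n" "s < n"
  have "((\<lambda>t. jexp t $$ (r, s)) \<circ> uminus has_vector_derivative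
      (- 1) *\<^sub>R (jmat * jexp (- t)) $$ (r, s)) (at t)"
    using has_mat_derivativeD(3)[OF jexp_derivative rs]
    by (intro vector_diff_chain_at) (auto intro!: derivative_eq_intros)
  moreover have "((- jmat) * jexp (- t)) $$ (r, s) = - (jmat * jexp (- t)) $$ (r, s)"
    using rs by (simp add: index_mult_sum[of _ n n _ n] sum_negf jmat_def del: index_mult_mat(1))
  ultimately show "((\<lambda>t. jexp (- t) $$ (r, s)) has_vector_derivative ((- jmat) * jexp (- t)) $$ (r, s)) (at t)"
    by (simp add: o_def)
qed (auto intro!: mult_carrier_mat[of _ n n])

end

section \<open>Lyapunov solutions as improper integrals\<close>

lemma index_mult_mult_adjoint:
  assumes "A \<in> carrier_mat m n" "R \<in> carrier_mat n n" "B \<in> carrier_mat l n" "r < m" "s < l"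
  shows "(A * R * mat_adjoint B) $$ (r, s) =
    (\<Sum>c<n. \<Sum>d<n. R $$ (c, d) * (A $$ (r, c) * cnj (B $$ (s, d))))"
proof -
  have "(A * R * mat_adjoint B) $$ (r, s) = (\<Sum>d<n. (\<Sum>c<n. A $$ (r, c) * R $$ (c, d)) * cnj (B $$ (s, d)))"
    using assms by (subst index_mult_sum[of _ m n _ l])
      (auto simp: index_mult_sum[OF assms(1,2)] simp del: index_mult_mat(1) intro!: sum.cong mult_carrier_mat[of _ m n])
  also have "\<dots> = (\<Sum>d<n. \<Sum>c<n. R $$ (c, d) * (A $$ (r, c) * cnj (B $$ (s, d))))"
    by (simp add: sum_distrib_left mult_ac)
  also have "\<dots> = (\<Sum>c<n. \<Sum>d<n. R $$ (c, d) * (A $$ (r, c) * cnj (B $$ (s, d))))"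
    by (rule sum.swap)
  finally show ?thesis .
qed

lemma mat_integral_congruence_index:
  assumes E: "mat_continuous m n E" and R: "R \<in> carrier_mat n n" and rs: "r < m" "s < m"
  shows "mat_integral m m T (\<lambda>t. E t * R * mat_adjoint (E t)) $$ (r, s) =
    (\<Sum>c<n. \<Sum>d<n. R $$ (c, d) * integral {0..T} (\<lambda>t. E t $$ (r, c) * cnj (E t $$ (s, d))))"
proof -
  note Ec = mat_continuousD(1)[OF E]
  have "integral {0..T} (\<lambda>t. \<Sum>c<n. \<Sum>d<n. R $$ (c, d) * (E t $$ (r, c) * cnj (E t $$ (s, d)))) =
      (\<Sum>c<n. \<Sum>d<n. R $$ (c, d) * integral {0..T} (\<lambda>t. E t $$ (r, c) * cnj (E t $$ (s, d))))"
    using mat_continuousD(2)[OF E] rs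
    by (intro integral_unique has_integral_sum has_integral_mult_right integrable_integral
        integrable_continuous_interval continuous_on_mult continuous_on_cnj) auto
  then show ?thesis using rs by (simp add: index_mult_mult_adjoint[OF Ec R Ec])
qed

lemma mat_limit_exists:
  assumes "\<And>t. f t \<in> carrier_mat m n"
    and "\<And>i j. i < m \<Longrightarrow> j < n \<Longrightarrow> \<exists>L. ((\<lambda>t. f t $$ (i, j)) \<longlongrightarrow> L) F"
  obtains X where "mat_tendsto m n f X F"
proof -
  obtain L where L: "\<And>i j. i < m \<Longrightarrow> j < n \<Longrightarrow> ((\<lambda>t. f t $$ (i, j)) \<longlongrightarrow> L i j) F"
    using assms(2) by metis
  have "mat_tendsto m n f (mat m n (\<lambda>(i, j). L i j)) F"
    using assms(1) L by (intro mat_tendstoI) auto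
  then show ?thesis by (rule that)
qed

lemma congruence_limit_exists:
  assumes E: "mat_continuous n n E" and R: "R \<in> carrier_mat n n"
    and conv: "\<And>r c s d. r < n \<Longrightarrow> c < n \<Longrightarrow> s < n \<Longrightarrow> d < n \<Longrightarrow>
      \<exists>L. ((\<lambda>T. integral {0..T} (\<lambda>t. E t $$ (r, c) * cnj (E t $$ (s, d)))) \<longlongrightarrow> L) at_top"
  obtains X where "mat_tendsto n n (\<lambda>T. mat_integral n n T (\<lambda>t. E t * R * mat_adjoint (E t))) X at_top"
proof -
  have "\<exists>L. ((\<lambda>T. mat_integral n n T (\<lambda>t. E t * R * mat_adjoint (E t)) $$ (r, s)) \<longlongrightarrow> L) at_top"
    if rs: "r < n" "s < n" for r s
  proof -
    define I where "I c d T = integral {0..T} (\<lambda>t. E t $$ (r, c) * cnj (E t $$ (s, d)))" for c d T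
    \<comment> \<open>The limits are chosen as a function of \<open>c\<close> and \<open>d\<close>,
      as the limit of the double sum needs one limit for each of its terms.\<close>
    have L: "(I c d \<longlongrightarrow> (SOME L. (I c d \<longlongrightarrow> L) at_top)) at_top" if "c < n" "d < n" for c d
      using someI_ex[OF conv[of r c s d]] rs that unfolding I_def by blast
    have lim: "((\<lambda>T. \<Sum>c<n. \<Sum>d<n. R $$ (c, d) * I c d T) \<longlongrightarrow>
        (\<Sum>c<n. \<Sum>d<n. R $$ (c, d) * (SOME L. (I c d \<longlongrightarrow> L) at_top))) at_top"
      by (intro tendsto_sum tendsto_mult tendsto_const L) auto
    show ?thesis
      unfolding mat_integral_congruence_index[OF E R rs] I_def[symmetric]
      using lim by blast
  qed
  from mat_limit_exists[OF mat_integral_carrier this] that show ?thesis by blast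
qed

lemma exp_pow_pair_integral_convergent:
  assumes "Re \<mu> < 0" "Re \<nu> < 0"
  shows "\<exists>L. ((\<lambda>T. integral {0..T} (\<lambda>t. exp_pow \<mu> a t * cnj (exp_pow \<nu> b t))) \<longlongrightarrow> L) at_top"
proof -
  obtain L where "((\<lambda>T. integral {0..T} (exp_pow (\<mu> + cnj \<nu>) (a + b))) \<longlongrightarrow> L) at_top"
    using exp_pow_integral_convergent[of "\<mu> + cnj \<nu>"] assms by auto
  then have "((\<lambda>T. of_nat ((a + b) choose a) * integral {0..T} (exp_pow (\<mu> + cnj \<nu>) (a + b))) \<longlongrightarrow>
      of_nat ((a + b) choose a) * L) at_top"
    by (intro tendsto_intros)
  then show ?thesis by (simp only: exp_pow_mult_cnj integral_mult_right) blast
qed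

lemma uminus_mult_mat:
  fixes A :: "complex mat"
  assumes "A \<in> carrier_mat n n" "B \<in> carrier_mat n n"
  shows "(- A) * B = - (A * B)" "B * (- A) = - (B * A)"
  using assms by (auto intro!: eq_matI simp: index_mult_sum[of _ n n _ n] sum_negf simp del: index_mult_mat(1))

context jordan_index
begin

lemma jexp_continuous: "mat_continuous n n jexp"
  using has_mat_derivative_continuous[OF jexp_derivative] .

lemma jexp_neg_continuous: "mat_continuous n n (\<lambda>t. jexp (- t))"
  using has_mat_derivative_continuous[OF jexp_neg_derivative] .

text \<open>Products of entries have exponents with negative real part, so their integrals converge;
  by uniqueness, the definite description in \<open>lyapunov_sol\<close> denotes the limit.\<close>

lemma lyapunov_sol_stable:
  assumes neg: "\<And>r. r < n \<Longrightarrow> Re (lam r) < 0" and R: "R \<in> carrier_mat n n"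
  shows "mat_tendsto n n (\<lambda>T. mat_integral n n T (\<lambda>t. jexp t * R * mat_adjoint (jexp t)))
    (lyapunov_sol jmat R) at_top"
proof -
  have conv: "\<exists>L. ((\<lambda>T. integral {0..T} (\<lambda>t. jexp t $$ (r, c) * cnj (jexp t $$ (s, d)))) \<longlongrightarrow> L) at_top"
    if "r < n" "c < n" "s < n" "d < n" for r c s d
    using that exp_pow_pair_integral_convergent[OF neg[of r] neg[of s]]
    by (cases "bid r = bid c \<and> r \<le> c"; cases "bid s = bid d \<and> s \<le> d")
      (auto simp: jexp_index intro: exI[of _ 0])
  obtain X where X: "mat_tendsto n n (\<lambda>T. mat_integral n n T (\<lambda>t. jexp t * R * mat_adjoint (jexp t))) X at_top"
    by (rule congruence_limit_exists[OF jexp_continuous R conv])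
  have "mat_tendsto n n jexp (0\<^sub>m n n) at_top"
  proof (rule mat_tendstoI)
    fix r s assume "r < n" "s < n"
    then show "((\<lambda>t. jexp t $$ (r, s)) \<longlongrightarrow> 0\<^sub>m n n $$ (r, s)) at_top"
      by (cases "bid r = bid s"; cases "r \<le> s") (simp_all add: jexp_index exp_pow_tendsto_0 neg)
  qed auto
  from lyapunov_sol_eqI[OF jmat_carrier R jexp_derivative jexp_commute jexp_0 this X]
  show ?thesis using X by simp
qed

text \<open>The stable argument in reversed time: \<open>jexp (- t)\<close> is the flow of
  \<open>- jmat\<close>, and up to signs its entries are exponential polynomials for the eigenvalues
  \<open>- lam r\<close>.\<close>

lemma lyapunov_sol_antistable:
  assumes pos: "\<And>r. r < n \<Longrightarrow> Re (lam r) > 0" and R: "R \<in> carrier_mat n n"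
  shows "mat_tendsto n n (\<lambda>T. mat_integral n n T (\<lambda>t. jexp (- t) * R * mat_adjoint (jexp (- t))))
    (lyapunov_sol (- jmat) R) at_top"
proof -
  have neg: "Re (- lam r) < 0" if "r < n" for r using pos[OF that] by simp
  have conv: "\<exists>L. ((\<lambda>T. integral {0..T} (\<lambda>t. jexp (- t) $$ (r, c) * cnj (jexp (- t) $$ (s, d)))) \<longlongrightarrow> L) at_top"
    if rcsd: "r < n" "c < n" "s < n" "d < n" for r c s d
  proof (cases "(bid r = bid c \<and> r \<le> c) \<and> (bid s = bid d \<and> s \<le> d)")
    case True
    obtain L where "((\<lambda>T. integral {0..T} (\<lambda>t. exp_pow (- lam r) (c - r) t * cnj (exp_pow (- lam s) (d - s) t))) \<longlongrightarrow> L) at_top"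
      using exp_pow_pair_integral_convergent[OF neg[OF rcsd(1)] neg[OF rcsd(3)]] by blast
    then have "((\<lambda>T. (-1) ^ (c - r) * (-1) ^ (d - s) * integral {0..T}
        (\<lambda>t. exp_pow (- lam r) (c - r) t * cnj (exp_pow (- lam s) (d - s) t))) \<longlongrightarrow>
        (-1) ^ (c - r) * (-1) ^ (d - s) * L) at_top"
      by (intro tendsto_intros)
    moreover have "(\<lambda>t. jexp (- t) $$ (r, c) * cnj (jexp (- t) $$ (s, d))) =
        (\<lambda>t. (-1) ^ (c - r) * (-1) ^ (d - s) *
          (exp_pow (- lam r) (c - r) t * cnj (exp_pow (- lam s) (d - s) t)))"
      using True rcsd by (simp add: jexp_index exp_pow_uminus mult_ac)
    ultimately show ?thesis by (simp only: integral_mult_right) blast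
  next
    case False
    then have "(\<lambda>t. jexp (- t) $$ (r, c) * cnj (jexp (- t) $$ (s, d))) = (\<lambda>t. 0)"
      using rcsd by (auto simp: jexp_index)
    then show ?thesis by auto
  qed
  obtain X where X: "mat_tendsto n n (\<lambda>T. mat_integral n n T (\<lambda>t. jexp (- t) * R * mat_adjoint (jexp (- t)))) X at_top"
    by (rule congruence_limit_exists[OF jexp_neg_continuous R conv])
  have "((\<lambda>t. (-1) ^ (s - r) * exp_pow (- lam r) (s - r) t) \<longlongrightarrow> (-1) ^ (s - r) * 0) at_top" if "r < n" for r s
    by (intro tendsto_intros exp_pow_tendsto_0 neg that)
  then have lim: "((\<lambda>t. exp_pow (lam r) (s - r) (- t)) \<longlongrightarrow> 0) at_top" if "r < n" for r s
    using that by (simp add: exp_pow_uminus)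
  have decay: "mat_tendsto n n (\<lambda>t. jexp (- t)) (0\<^sub>m n n) at_top"
  proof (rule mat_tendstoI)
    fix r s assume "r < n" "s < n"
    then show "((\<lambda>t. jexp (- t) $$ (r, s)) \<longlongrightarrow> 0\<^sub>m n n $$ (r, s)) at_top"
      by (cases "bid r = bid s"; cases "r \<le> s") (simp_all add: jexp_index lim)
  qed auto
  have comm: "(- jmat) * jexp (- t) = jexp (- t) * (- jmat)" for t
    using uminus_mult_mat[OF jmat_carrier jexp_carrier] jexp_commute by simp
  have "- jmat \<in> carrier_mat n n" by simp
  from lyapunov_sol_eqI[OF this R jexp_neg_derivative comm _ decay X] jexp_0
  show ?thesis using X by simp
qed

end

section \<open>The scaled Gramian\<close>

text \<open>\<open>h r\<close> is the number of rows below row \<open>r\<close> in its block, so \<open>r + h r\<close> is the last row of the block.\<close>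

locale jordan_scaling = jordan_index +
  fixes h :: "nat \<Rightarrow> nat"
  assumes h_less: "r < n \<Longrightarrow> r + h r < n"
    and h_bid: "r < n \<Longrightarrow> bid (r + h r) = bid r"
    and h_diff: "r \<le> s \<Longrightarrow> s < n \<Longrightarrow> bid r = bid s \<Longrightarrow> h r = h s + (s - r)"
begin

lemma h_last: "r < n \<Longrightarrow> h (r + h r) = 0"
  using h_diff[of r "r + h r"] h_less h_bid by simp

text \<open>The three kinds of rows are rescaled so that their Gramian neither vanishes nor explodes as
  \<open>T \<rightarrow> \<infinity>\<close>.\<close>

definition scaled_entry :: "real \<Rightarrow> nat \<Rightarrow> nat \<Rightarrow> real \<Rightarrow> complex" where
  "scaled_entry T r m t =
    (if Re (lam r) < 0 then exp_pow (lam r) m t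
     else if Re (lam r) = 0 then of_real (1 / (T ^ h r * sqrt T)) * exp_pow (lam r) m t
     else exp_pow (lam r) m (t - T))"

definition scaled_exp :: "real \<Rightarrow> real \<Rightarrow> complex mat" where
  "scaled_exp T t = mat n n (\<lambda>(r, c). if bid r = bid c \<and> r \<le> c then scaled_entry T r (c - r) t else 0)"

text \<open>At time 0 the scaled exponential is the identity on stable rows, diagonal on imaginary
  rows and \<open>exp (- J T)\<close> on antistable rows.\<close>

definition scaling :: "real \<Rightarrow> complex mat" where
  "scaling T = scaled_exp T 0"

definition stable_proj :: "complex mat" where
  "stable_proj = mat n n (\<lambda>(r, c). if r = c \<and> Re (lam r) < 0 then 1 else 0)"

lemma scaled_exp_carrier [simp]: "scaled_exp T t \<in> carrier_mat n n"
  by (simp add: scaled_exp_def)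

lemma scaling_carrier [simp]: "scaling T \<in> carrier_mat n n"
  by (simp add: scaling_def)

lemma scaled_exp_index:
  "r < n \<Longrightarrow> c < n \<Longrightarrow>
    scaled_exp T t $$ (r, c) = (if bid r = bid c \<and> r \<le> c then scaled_entry T r (c - r) t else 0)"
  by (simp add: scaled_exp_def)

lemma scaled_entry_continuous: "continuous_on S (scaled_entry T r m)"
proof -
  have "continuous_on S (\<lambda>t. exp_pow (lam r) m (t - T))"
    by (rule continuous_on_compose2[OF exp_pow_continuous[of UNIV]]) (auto intro!: continuous_intros)
  moreover have "continuous_on S (\<lambda>t. c * exp_pow (lam r) m t)" for c
    by (intro continuous_intros exp_pow_continuous)
  ultimately show ?thesis
    unfolding scaled_entry_def[abs_def]
    by (cases "Re (lam r) < 0"; cases "Re (lam r) = 0") (simp_all only: if_True if_False exp_pow_continuous simp_thms)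
qed

lemma scaled_exp_continuous: "mat_continuous n n (scaled_exp T)"
proof (rule mat_continuousI)
  fix r c assume "r < n" "c < n"
  then show "continuous_on UNIV (\<lambda>t. scaled_exp T t $$ (r, c))"
    by (cases "bid r = bid c"; cases "r \<le> c") (simp_all add: scaled_exp_index scaled_entry_continuous)
qed simp

text \<open>The semigroup law \<open>exp_pow_add\<close>: the weights depend only on the row, and
  the shift by \<open>T\<close> goes into the first summand.\<close>

lemma scaled_entry_add: "scaled_entry T r m (x + y) = (\<Sum>k\<le>m. scaled_entry T r k x * exp_pow (lam r) (m - k) y)"
proof -
  have *: "x + y - T = (x - T) + y" by simp
  show ?thesis unfolding scaled_entry_def * exp_pow_add by (auto simp: sum_distrib_left mult_ac)
qed

text \<open>Between columns \<open>r\<close> and \<open>c\<close> of a block the product is the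
  convolution in \<open>scaled_entry_add\<close>, taken at \<open>x = 0\<close>. Thus the scaled
  exponential at any time is the ordinary one multiplied from the left by a matrix that does not
  depend on \<open>t\<close>.\<close>

lemma scaling_mult_jexp: "scaling T * jexp t = scaled_exp T t"
proof (rule eq_matI)
  fix r c assume "r < dim_row (scaled_exp T t)" "c < dim_col (scaled_exp T t)"
  then have rc: "r < n" "c < n" by (auto simp: scaled_exp_def)
  have "(scaling T * jexp t) $$ (r, c) = (\<Sum>u<n. scaling T $$ (r, u) * jexp t $$ (u, c))"
    using rc by (intro index_mult_sum[of _ n n _ n]) auto
  also have "\<dots> = (if bid r = bid c \<and> r \<le> c then scaled_entry T r (c - r) t else 0)"
  proof (cases "bid r = bid c \<and> r \<le> c")
    case True
    have "(\<Sum>u<n. scaling T $$ (r, u) * jexp t $$ (u, c)) =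
        (\<Sum>u\<in>{r..c}. scaled_entry T r (u - r) 0 * exp_pow (lam r) (c - u) t)"
    proof (rule sum.mono_neutral_cong_right)
      show "scaling T $$ (r, u) * jexp t $$ (u, c) = scaled_entry T r (u - r) 0 * exp_pow (lam r) (c - u) t"
        if "u \<in> {r..c}" for u
        using that True rc bid_between[of r u c] bid_between[of r r c]
        by (simp add: scaling_def scaled_exp_index jexp_index)
    qed (use True rc in \<open>auto simp: scaling_def scaled_exp_index jexp_index\<close>)
    also have "\<dots> = (\<Sum>k\<le>c - r. scaled_entry T r k 0 * exp_pow (lam r) (c - r - k) t)"
      using True by (intro sum.reindex_bij_witness[of _ "\<lambda>k. k + r" "\<lambda>u. u - r"]) auto
    also have "\<dots> = scaled_entry T r (c - r) t"
      using scaled_entry_add[of T r "c - r" 0 t] by simp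
    finally show ?thesis using True by simp
  next
    case False
    then show ?thesis
      using rc by (auto simp: scaling_def scaled_exp_index jexp_index intro!: sum.neutral)
  qed
  finally show "(scaling T * jexp t) $$ (r, c) = scaled_exp T t $$ (r, c)"
    using rc by (simp add: scaled_exp_index)
qed (auto simp: scaling_def scaled_exp_def jexp_def)

text \<open>The matrix is upper triangular, and its diagonal entries are 1,
  \<open>1 / (T ^ h r * sqrt T)\<close> or \<open>exp (- lam r * T)\<close>, according to the kind
  of row.\<close>

lemma scaling_det: "T > 0 \<Longrightarrow> det (scaling T) \<noteq> 0"
proof -
  assume T: "T > 0"
  have "upper_triangular (scaling T)"
    by (auto simp: upper_triangular_def scaling_def scaled_exp_def)
  then have "det (scaling T) = prod_list (diag_mat (scaling T))"
    by (intro det_upper_triangular[of _ n]) auto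
  moreover have "0 \<notin> set (diag_mat (scaling T))"
    using T by (auto simp: diag_mat_def scaling_def scaled_exp_index scaled_entry_def exp_pow_def
        scaled_exp_carrier[THEN carrier_matD(1)])
  ultimately show ?thesis by (simp add: prod_list_zero_iff)
qed

text \<open>The weights of imaginary rows and the matrix \<open>exp (- J T)\<close> on antistable
  rows both vanish in the limit. For this reason only the stable part enters the limiting AECS
  objective.\<close>

lemma scaling_limit: "mat_tendsto n n scaling stable_proj at_top"
proof (rule mat_tendstoI)
  fix r c assume rc: "r < n" "c < n"
  have lim: "((\<lambda>T. scaled_entry T r m 0) \<longlongrightarrow> (if Re (lam r) < 0 \<and> m = 0 then 1 else 0)) at_top" for m
  proof -
    consider "Re (lam r) < 0" | "Re (lam r) = 0" | "Re (lam r) > 0" by linarith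
    then show ?thesis
    proof cases
      case 2
      have "((\<lambda>T. 1 / (T ^ h r * sqrt T)) \<longlongrightarrow> 0) at_top"
        by real_asymp
      then have "((\<lambda>T. of_real (1 / (T ^ h r * sqrt T)) * exp_pow (lam r) m 0) \<longlongrightarrow> of_real 0 * exp_pow (lam r) m 0) at_top"
        by (intro tendsto_intros)
      then show ?thesis using 2 by (simp add: scaled_entry_def)
    next
      case 3
      have "((\<lambda>T. (-1) ^ m * exp_pow (- lam r) m T) \<longlongrightarrow> (-1) ^ m * 0) at_top"
        using 3 by (intro tendsto_intros exp_pow_tendsto_0) auto
      then show ?thesis using 3 by (simp add: scaled_entry_def exp_pow_uminus)
    qed (auto simp: scaled_entry_def)
  qed
  show "((\<lambda>T. scaling T $$ (r, c)) \<longlongrightarrow> stable_proj $$ (r, c)) at_top"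
    using lim[of "c - r"] rc
    by (cases "bid r = bid c"; cases "r \<le> c"; cases "Re (lam r) < 0"; cases "r = c")
      (simp_all add: scaling_def scaled_exp_index stable_proj_def)
qed (auto simp: stable_proj_def)

end

section \<open>Limits of the entries of the scaled Gramian\<close>

lemma exp_integral_decay:
  fixes \<epsilon> T :: real
  assumes "0 < \<epsilon>" "0 \<le> T"
  shows "((\<lambda>t. exp (- \<epsilon> * t)) has_integral (1 - exp (- \<epsilon> * T)) / \<epsilon>) {0..T}"
    and "((\<lambda>t. exp (- \<epsilon> * (T - t))) has_integral (1 - exp (- \<epsilon> * T)) / \<epsilon>) {0..T}"
proof -
  have "((\<lambda>t. exp (- \<epsilon> * t)) has_integral (- exp (- \<epsilon> * T) / \<epsilon> - - exp (- \<epsilon> * 0) / \<epsilon>)) {0..T}"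
    using assms by (intro fundamental_theorem_of_calculus)
      (auto intro!: derivative_eq_intros simp flip: has_real_derivative_iff_has_vector_derivative)
  then show "((\<lambda>t. exp (- \<epsilon> * t)) has_integral (1 - exp (- \<epsilon> * T)) / \<epsilon>) {0..T}"
    by (simp add: diff_divide_distrib)
  have "((\<lambda>t. exp (- \<epsilon> * (T - t))) has_integral (exp (- \<epsilon> * (T - T)) / \<epsilon> - exp (- \<epsilon> * (T - 0)) / \<epsilon>)) {0..T}"
    using assms by (intro fundamental_theorem_of_calculus)
      (auto intro!: derivative_eq_intros simp flip: has_real_derivative_iff_has_vector_derivative)
  then show "((\<lambda>t. exp (- \<epsilon> * (T - t))) has_integral (1 - exp (- \<epsilon> * T)) / \<epsilon>) {0..T}"
    by (simp add: diff_divide_distrib)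
qed

text \<open>The dominating function may change with \<open>T\<close>. The range
  \<open>1 \<le> T\<close> suffices for the limit and is the one on which powers of \<open>T\<close>
  increase with the exponent, as the bounds on imaginary rows require.\<close>

lemma integral_tendsto_0_dominated:
  fixes f :: "real \<Rightarrow> real \<Rightarrow> complex"
  assumes cont: "\<And>T. continuous_on {0..T} (f T)"
    and bound: "\<And>T t. 1 \<le> T \<Longrightarrow> 0 \<le> t \<Longrightarrow> t \<le> T \<Longrightarrow> norm (f T t) \<le> b T t"
    and int: "\<And>T. 1 \<le> T \<Longrightarrow> (b T has_integral B T) {0..T}"
    and B: "(B \<longlongrightarrow> 0) at_top"
  shows "((\<lambda>T. integral {0..T} (f T)) \<longlongrightarrow> 0) at_top"
proof (rule Lim_null_comparison[OF _ B])
  show "\<forall>\<^sub>F T in at_top. norm (integral {0..T} (f T)) \<le> B T"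
    using eventually_ge_at_top[of 1]
  proof eventually_elim
    case (elim T)
    have "norm (integral {0..T} (f T)) \<le> integral {0..T} (b T)"
      using bound[OF elim] integrable_continuous_interval[OF cont] has_integral_integrable[OF int[OF elim]]
      by (intro integral_norm_bound_integral) auto
    then show ?case using int[OF elim] by (simp add: integral_unique)
  qed
qed

lemma tendsto_inverse_power:
  "((\<lambda>T. of_real (1 / T ^ k) :: complex) \<longlongrightarrow> (if k = 0 then 1 else 0)) at_top"
proof (cases k)
  case (Suc j)
  have "((\<lambda>T. 1 / T ^ Suc j :: real) \<longlongrightarrow> 0) at_top" by real_asymp
  then have "((\<lambda>T. of_real (1 / T ^ Suc j) :: complex) \<longlongrightarrow> of_real 0) at_top"
    by (intro tendsto_of_real)
  then show ?thesis using Suc by simp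
qed simp

context jordan_scaling
begin

lemma scaled_entry_decay_neg:
  assumes "Re (lam r) < 0"
  obtains C \<epsilon> where "0 \<le> C" "0 < \<epsilon>"
    "\<And>T t. 0 \<le> t \<Longrightarrow> norm (scaled_entry T r m t) \<le> C * exp (- \<epsilon> * t)"
  using exp_pow_decay[OF assms, of m] assms by (auto simp: scaled_entry_def)

text \<open>Antistable entries are concentrated at the right end: up to sign they are decaying
  exponential polynomials in \<open>T - t\<close>.\<close>

lemma scaled_entry_decay_pos:
  assumes "Re (lam r) > 0"
  obtains C \<epsilon> where "0 \<le> C" "0 < \<epsilon>"
    "\<And>T t. t \<le> T \<Longrightarrow> norm (scaled_entry T r m t) \<le> C * exp (- \<epsilon> * (T - t))"
proof -
  obtain C \<epsilon> where C: "0 \<le> C" "0 < \<epsilon>" "\<And>t. 0 \<le> t \<Longrightarrow> norm (exp_pow (- lam r) m t) \<le> C * exp (- \<epsilon> * t)"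
    using exp_pow_decay[of "- lam r" m] assms by auto
  have "norm (scaled_entry T r m t) \<le> C * exp (- \<epsilon> * (T - t))" if "t \<le> T" for T t
  proof -
    have "scaled_entry T r m t = (-1) ^ m * exp_pow (- lam r) m (T - t)"
      using assms exp_pow_uminus[of "lam r" m "T - t"] by (simp add: scaled_entry_def)
    then show ?thesis using C(3)[of "T - t"] that by (simp add: norm_mult norm_power)
  qed
  then show ?thesis using that C by blast
qed

text \<open>The weight \<open>T ^ h r\<close> absorbs the growth of \<open>t ^ m\<close>, as a
  column of the block is at distance at most \<open>h r\<close>. What remains,
  \<open>1 / sqrt T\<close>, has squared integral 1 over \<open>[0, T]\<close>.\<close>

lemma scaled_entry_bound_zero:
  assumes "Re (lam r) = 0" "m \<le> h r" "1 \<le> T" "0 \<le> t" "t \<le> T"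
  shows "norm (scaled_entry T r m t) \<le> 1 / sqrt T"
proof -
  have "t ^ m / fact m \<le> t ^ m" using assms fact_ge_1[of m, where 'a=real]
    by (simp add: divide_le_eq mult_left_le_one_le) (simp add: mult_le_cancel_left1 mult_ge1_I)
  also have "\<dots> \<le> T ^ m" using assms by (intro power_mono)
  also have "\<dots> \<le> T ^ h r" using assms by (intro power_increasing)
  finally have "t ^ m / fact m / T ^ h r \<le> 1" using assms by (simp add: divide_le_eq mult.commute)
  moreover have "norm (scaled_entry T r m t) = t ^ m / fact m / T ^ h r / sqrt T"
    using assms by (simp add: scaled_entry_def norm_mult norm_divide norm_power norm_exp_pow)
  ultimately show ?thesis using divide_right_mono[of "t ^ m / fact m / T ^ h r" 1 "sqrt T"] assms by simp
qed

text \<open>An entry that decays from one end of the interval has bounded integral, so a factor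
  \<open>1 / sqrt T\<close> from an imaginary row sends the product to zero. A stable and an
  antistable entry decay from opposite ends, and their product is exponentially small in
  \<open>T\<close> throughout. The integrand is only bounded, not prescribed, so that both orders of
  the factors and their conjugates are covered.\<close>

lemma cross_integral_tendsto_0:
  fixes f :: "real \<Rightarrow> real \<Rightarrow> complex"
  assumes sgn: "sgn (Re (lam r)) < sgn (Re (lam s))" and mk: "m \<le> h r" "k \<le> h s"
    and cont: "\<And>T. continuous_on {0..T} (f T)"
    and bound: "\<And>T t. norm (f T t) \<le> norm (scaled_entry T r m t) * norm (scaled_entry T s k t)"
  shows "((\<lambda>T. integral {0..T} (f T)) \<longlongrightarrow> 0) at_top"
proof -
  consider "Re (lam r) < 0" "Re (lam s) = 0" | "Re (lam r) < 0" "Re (lam s) > 0"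
    | "Re (lam r) = 0" "Re (lam s) > 0"
    using sgn by (auto simp: sgn_if split: if_splits)
  then show ?thesis
  proof cases
    case 1
    obtain C \<epsilon> where C: "0 \<le> C" "0 < \<epsilon>"
        "\<And>T t. 0 \<le> t \<Longrightarrow> norm (scaled_entry T r m t) \<le> C * exp (- \<epsilon> * t)"
      using scaled_entry_decay_neg[OF 1(1)] by metis
    show ?thesis
    proof (rule integral_tendsto_0_dominated[OF cont])
      show "norm (f T t) \<le> C * exp (- \<epsilon> * t) * (1 / sqrt T)" if "1 \<le> T" "0 \<le> t" "t \<le> T" for T t
        using order_trans[OF bound mult_mono[OF C(3) scaled_entry_bound_zero]] that 1 mk C(1) by simp
      show "((\<lambda>t. C * exp (- \<epsilon> * t) * (1 / sqrt T)) has_integral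
          C * ((1 - exp (- \<epsilon> * T)) / \<epsilon>) * (1 / sqrt T)) {0..T}" if "1 \<le> T" for T
        using exp_integral_decay(1)[OF C(2)] that by (intro has_integral_mult_left has_integral_mult_right) auto
      show "((\<lambda>T. C * ((1 - exp (- \<epsilon> * T)) / \<epsilon>) * (1 / sqrt T)) \<longlongrightarrow> 0) at_top"
        using C(2) by real_asymp
    qed
  next
    case 2
    obtain C \<epsilon> where C: "0 \<le> C" "0 < \<epsilon>"
        "\<And>T t. 0 \<le> t \<Longrightarrow> norm (scaled_entry T r m t) \<le> C * exp (- \<epsilon> * t)"
      using scaled_entry_decay_neg[OF 2(1)] by metis
    obtain D \<delta> where D: "0 \<le> D" "0 < \<delta>"
        "\<And>T t. t \<le> T \<Longrightarrow> norm (scaled_entry T s k t) \<le> D * exp (- \<delta> * (T - t))"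
      using scaled_entry_decay_pos[OF 2(2)] by metis
    \<comment> \<open>With the smaller rate, \<epsilon> \<open>t\<close> + \<delta>
      \<open>(T - t)\<close> is at least \<gamma> \<open>T\<close> at every \<open>t\<close> in the
      interval.\<close>
    define \<gamma> where "\<gamma> = min \<epsilon> \<delta>"
    have g: "0 < \<gamma>" "\<gamma> \<le> \<epsilon>" "\<gamma> \<le> \<delta>" using C(2) D(2) by (auto simp: \<gamma>_def)
    show ?thesis
    proof (rule integral_tendsto_0_dominated[OF cont])
      show "norm (f T t) \<le> C * D * exp (- \<gamma> * T)" if "1 \<le> T" "0 \<le> t" "t \<le> T" for T t
      proof -
        have "norm (f T t) \<le> (C * exp (- \<epsilon> * t)) * (D * exp (- \<delta> * (T - t)))"
          using order_trans[OF bound mult_mono[OF C(3) D(3)]] that C(1) by simp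
        also have "\<dots> = C * D * exp (- (\<epsilon> * t + \<delta> * (T - t)))"
          by (simp add: exp_add[symmetric] algebra_simps)
        also have "\<dots> \<le> C * D * exp (- \<gamma> * T)"
        proof -
          have "\<gamma> * t \<le> \<epsilon> * t" "\<gamma> * (T - t) \<le> \<delta> * (T - t)"
            using that g by (auto intro!: mult_right_mono)
          then have "\<gamma> * T \<le> \<epsilon> * t + \<delta> * (T - t)" by (simp add: algebra_simps)
          then show ?thesis using C(1) D(1) by (intro mult_left_mono) auto
        qed
        finally show ?thesis .
      qed
      show "((\<lambda>t. C * D * exp (- \<gamma> * T)) has_integral T * (C * D * exp (- \<gamma> * T))) {0..T}" if "1 \<le> T" for T
        using has_integral_const_real[of "C * D * exp (- \<gamma> * T)" 0 T] that by simp
      show "((\<lambda>T. T * (C * D * exp (- \<gamma> * T))) \<longlongrightarrow> 0) at_top"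
        using g(1) by real_asymp
    qed
  next
    case 3
    obtain C \<epsilon> where C: "0 \<le> C" "0 < \<epsilon>"
        "\<And>T t. t \<le> T \<Longrightarrow> norm (scaled_entry T s k t) \<le> C * exp (- \<epsilon> * (T - t))"
      using scaled_entry_decay_pos[OF 3(2)] by metis
    show ?thesis
    proof (rule integral_tendsto_0_dominated[OF cont])
      show "norm (f T t) \<le> (1 / sqrt T) * (C * exp (- \<epsilon> * (T - t)))" if "1 \<le> T" "0 \<le> t" "t \<le> T" for T t
        using order_trans[OF bound mult_mono[OF scaled_entry_bound_zero C(3)]] that 3 mk by simp
      show "((\<lambda>t. (1 / sqrt T) * (C * exp (- \<epsilon> * (T - t)))) has_integral
          (1 / sqrt T) * (C * ((1 - exp (- \<epsilon> * T)) / \<epsilon>))) {0..T}" if "1 \<le> T" for T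
        using exp_integral_decay(2)[OF C(2)] that by (intro has_integral_mult_right) auto
      show "((\<lambda>T. (1 / sqrt T) * (C * ((1 - exp (- \<epsilon> * T)) / \<epsilon>))) \<longlongrightarrow> 0) at_top"
        using C(2) by real_asymp
    qed
  qed
qed

text \<open>For \<open>B = B_tilde Q p\<close> this is the rescaled Gramian, as
  \<open>scaled_gram_eq\<close> will show. It is studied for a general \<open>B\<close> because the
  limits concern its entries one by one.\<close>

definition scaled_gram :: "complex mat \<Rightarrow> real \<Rightarrow> complex mat" where
  "scaled_gram B T = mat_integral n n T (\<lambda>t. scaled_exp T t * B * mat_adjoint (scaled_exp T t))"

lemma scaled_gram_carrier [simp]: "scaled_gram B T \<in> carrier_mat n n"
  by (simp add: scaled_gram_def)

lemma scaled_gram_index: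
  assumes "B \<in> carrier_mat n n" "r < n" "s < n"
  shows "scaled_gram B T $$ (r, s) = (\<Sum>c<n. \<Sum>d<n. B $$ (c, d) *
    integral {0..T} (\<lambda>t. scaled_exp T t $$ (r, c) * cnj (scaled_exp T t $$ (s, d))))"
  unfolding scaled_gram_def using assms by (intro mat_integral_congruence_index scaled_exp_continuous)

lemma scaled_gram_cross:
  assumes B: "B \<in> carrier_mat n n" and rs: "r < n" "s < n"
    and sgn: "sgn (Re (lam r)) \<noteq> sgn (Re (lam s))"
  shows "((\<lambda>T. scaled_gram B T $$ (r, s)) \<longlongrightarrow> 0) at_top"
proof -
  have "((\<lambda>T. integral {0..T} (\<lambda>t. scaled_exp T t $$ (r, c) * cnj (scaled_exp T t $$ (s, d)))) \<longlongrightarrow> 0) at_top"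
    if cd: "c < n" "d < n" for c d
  proof (cases "(bid r = bid c \<and> r \<le> c) \<and> (bid s = bid d \<and> s \<le> d)")
    case True
    then have mk: "c - r \<le> h r" "d - s \<le> h s"
      using h_diff[of r c] h_diff[of s d] cd by auto
    let ?f = "\<lambda>T t. scaled_exp T t $$ (r, c) * cnj (scaled_exp T t $$ (s, d))"
    have f: "norm (?f T t) = norm (scaled_entry T r (c - r) t) * norm (scaled_entry T s (d - s) t)" for T t
      using True rs cd by (simp add: scaled_exp_index norm_mult)
    have cont: "continuous_on {0..T} (?f T)" for T
      using mat_continuousD(2)[OF scaled_exp_continuous] rs cd by (intro continuous_intros) auto
    show ?thesis
      using cross_integral_tendsto_0[of r s "c - r" "d - s" ?f] cross_integral_tendsto_0[of s r "d - s" "c - r" ?f]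
        sgn mk cont f by (auto simp: mult.commute neq_iff)
  next
    case False
    then have "(\<lambda>t. scaled_exp T t $$ (r, c) * cnj (scaled_exp T t $$ (s, d))) = (\<lambda>t. 0)" for T
      using rs cd by (auto simp: scaled_exp_index)
    then show ?thesis by simp
  qed
  then have "((\<lambda>T. scaled_gram B T $$ (r, s)) \<longlongrightarrow> (\<Sum>c<n. \<Sum>d<n. B $$ (c, d) * 0)) at_top"
    unfolding scaled_gram_index[OF B rs] by (intro tendsto_sum tendsto_mult tendsto_const) auto
  then show ?thesis by simp
qed

text \<open>With \<open>a = c - r\<close> and \<open>b = d - s\<close>, the weights turn the
  integral into \<open>T ^ - (h c + h d)\<close> times a multiple of the integral of
  \<open>exp_pow \<mu> (a + b)\<close> over \<open>T ^ (a + b + 1)\<close>. The first factor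
  survives only if both columns are the last ones of their blocks, the second only if the
  eigenvalues agree.\<close>

lemma zero_pair_limit:
  assumes rc: "c < n" "bid r = bid c" "r \<le> c" and sd: "d < n" "bid s = bid d" "s \<le> d"
    and zero: "Re (lam r) = 0" "Re (lam s) = 0"
  shows "((\<lambda>T. integral {0..T} (\<lambda>t. scaled_entry T r (c - r) t * cnj (scaled_entry T s (d - s) t))) \<longlongrightarrow>
    (if lam r = lam s \<and> h c = 0 \<and> h d = 0 then 1 / (fact (h r) * fact (h s) * of_nat (h r + h s + 1)) else 0)) at_top"
proof -
  define a b \<mu> where "a = c - r" and "b = d - s" and "\<mu> = lam r + cnj (lam s)"
  have ha: "h r = h c + a" and hb: "h s = h d + b"
    using h_diff[of r c] h_diff[of s d] assms by (auto simp: a_def b_def)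
  define L :: complex where "L = (if lam r = lam s then 1 / fact (Suc (a + b)) else 0)"
  have L: "((\<lambda>T. integral {0..T} (exp_pow \<mu> (a + b)) / of_real T ^ Suc (a + b)) \<longlongrightarrow> L) at_top"
  proof (cases "lam r = lam s")
    case True
    then have "\<mu> = 0" using zero by (simp add: \<mu>_def complex_eq_iff)
    have "\<forall>\<^sub>F T in at_top. L = integral {0..T} (exp_pow \<mu> (a + b)) / of_real T ^ Suc (a + b)"
      using eventually_gt_at_top[of 0]
      by eventually_elim (simp add: \<open>\<mu> = 0\<close> exp_pow_integral_0 L_def True del: fact_Suc power_Suc)
    then show ?thesis by (rule Lim_transform_eventually[OF tendsto_const])
  next
    case False
    then have "\<mu> \<noteq> 0" "Re \<mu> = 0" using zero by (auto simp: \<mu>_def complex_eq_iff)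
    then show ?thesis using False exp_pow_integral_oscillating by (simp add: L_def)
  qed
  have "((\<lambda>T. of_nat ((a + b) choose a) * (of_real (1 / T ^ (h c + h d)) *
      (integral {0..T} (exp_pow \<mu> (a + b)) / of_real T ^ Suc (a + b)))) \<longlongrightarrow>
      of_nat ((a + b) choose a) * ((if h c + h d = 0 then 1 else 0) * L)) at_top"
    by (intro tendsto_mult tendsto_const tendsto_inverse_power L)
  moreover have "\<forall>\<^sub>F T in at_top. of_nat ((a + b) choose a) * (of_real (1 / T ^ (h c + h d)) *
      (integral {0..T} (exp_pow \<mu> (a + b)) / of_real T ^ Suc (a + b))) =
      integral {0..T} (\<lambda>t. scaled_entry T r (c - r) t * cnj (scaled_entry T s (d - s) t))"
    using eventually_gt_at_top[of 0]
  proof eventually_elim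
    case (elim T)
    have "(\<lambda>t. scaled_entry T r (c - r) t * cnj (scaled_entry T s (d - s) t)) =
        (\<lambda>t. of_real (1 / (T ^ h r * sqrt T)) * of_real (1 / (T ^ h s * sqrt T)) *
          (exp_pow (lam r) a t * cnj (exp_pow (lam s) b t)))"
      using zero by (simp add: scaled_entry_def a_def b_def)
    also have "\<dots> = (\<lambda>t. of_real (1 / (T ^ h r * sqrt T)) * of_real (1 / (T ^ h s * sqrt T)) *
          (of_nat ((a + b) choose a) * exp_pow \<mu> (a + b) t))"
      unfolding exp_pow_mult_cnj \<mu>_def ..
    finally have "integral {0..T} (\<lambda>t. scaled_entry T r (c - r) t * cnj (scaled_entry T s (d - s) t)) =
        of_real (1 / (T ^ h r * sqrt T) * (1 / (T ^ h s * sqrt T))) *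
          (of_nat ((a + b) choose a) * integral {0..T} (exp_pow \<mu> (a + b)))"
      by simp
    also have "1 / (T ^ h r * sqrt T) * (1 / (T ^ h s * sqrt T)) = 1 / T ^ (h c + h d) / T ^ Suc (a + b)"
      using elim by (simp add: ha hb power_add field_simps)
    finally show ?case by simp
  qed
  ultimately have lim: "((\<lambda>T. integral {0..T} (\<lambda>t. scaled_entry T r (c - r) t * cnj (scaled_entry T s (d - s) t))) \<longlongrightarrow>
      of_nat ((a + b) choose a) * ((if h c + h d = 0 then 1 else 0) * L)) at_top"
    by (rule Lim_transform_eventually)
  \<comment> \<open>The binomial coefficient comes from multiplying the two exponential polynomials
    and the factorial from integrating the result; together they give the constants of
    \<open>C_mat\<close>.\<close>
  have "of_nat ((a + b) choose a) / fact (Suc (a + b)) = (1 / (fact a * fact b * of_nat (a + b + 1)) :: complex)"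
    unfolding fact_Suc Suc_eq_plus1[symmetric] by (simp add: binomial_fact del: of_nat_Suc)
  then have "of_nat ((a + b) choose a) * ((if h c + h d = 0 then 1 else 0) * L) =
      (if lam r = lam s \<and> h c = 0 \<and> h d = 0 then 1 / (fact (h r) * fact (h s) * of_nat (h r + h s + 1)) else 0)"
    by (auto simp: L_def ha hb)
  then show ?thesis using lim by simp
qed

text \<open>Of the double sum over columns only the term with both columns at the end of their
  blocks remains, by \<open>zero_pair_limit\<close>.\<close>

lemma scaled_gram_zero:
  assumes B: "B \<in> carrier_mat n n" and rs: "r < n" "s < n"
    and zero: "Re (lam r) = 0" "Re (lam s) = 0"
  shows "((\<lambda>T. scaled_gram B T $$ (r, s)) \<longlongrightarrow> (if lam r = lam s then
    B $$ (r + h r, s + h s) / (fact (h r) * fact (h s) * of_nat (h r + h s + 1)) else 0)) at_top"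
proof -
  define K :: complex where
    "K = (if lam r = lam s then 1 / (fact (h r) * fact (h s) * of_nat (h r + h s + 1)) else 0)"
  have last: "bid r = bid c \<and> r \<le> c \<and> h c = 0 \<longleftrightarrow> c = r + h r" if "c < n" "r < n" for c r
    using h_diff[of r c] h_last[of r] h_bid[of r] that by auto
  have lim: "((\<lambda>T. integral {0..T} (\<lambda>t. scaled_exp T t $$ (r, c) * cnj (scaled_exp T t $$ (s, d)))) \<longlongrightarrow>
      (if c = r + h r \<and> d = s + h s then K else 0)) at_top" if cd: "c < n" "d < n" for c d
  proof (cases "(bid r = bid c \<and> r \<le> c) \<and> (bid s = bid d \<and> s \<le> d)")
    case True
    have "(if lam r = lam s \<and> h c = 0 \<and> h d = 0
        then 1 / (fact (h r) * fact (h s) * of_nat (h r + h s + 1)) else 0) =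
      (if c = r + h r \<and> d = s + h s then K else 0)"
      using True last[OF cd(1) rs(1)] last[OF cd(2) rs(2)] by (auto simp: K_def)
    then show ?thesis
      using zero_pair_limit[of c r d s] zero rs cd True by (simp only: scaled_exp_index simp_thms if_True)
  next
    case False
    then have "(\<lambda>t. scaled_exp T t $$ (r, c) * cnj (scaled_exp T t $$ (s, d))) = (\<lambda>t. 0)" for T
      using rs cd by (auto simp: scaled_exp_index)
    then show ?thesis using False last[OF cd(1) rs(1)] last[OF cd(2) rs(2)] by auto
  qed
  have "((\<lambda>T. scaled_gram B T $$ (r, s)) \<longlongrightarrow>
      (\<Sum>c<n. \<Sum>d<n. B $$ (c, d) * (if c = r + h r \<and> d = s + h s then K else 0))) at_top"
    unfolding scaled_gram_index[OF B rs] by (intro tendsto_sum tendsto_mult tendsto_const lim) auto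
  moreover have "(\<Sum>d<n. B $$ (c, d) * (if c = r + h r \<and> d = s + h s then K else 0)) =
      (if c = r + h r then B $$ (r + h r, s + h s) * K else 0)" for c
  proof (cases "c = r + h r")
    case True
    then have "(\<Sum>d<n. B $$ (c, d) * (if c = r + h r \<and> d = s + h s then K else 0)) =
        (\<Sum>d<n. if d = s + h s then B $$ (c, d) * K else 0)"
      by (intro sum.cong) auto
    then show ?thesis using True h_less rs by simp
  qed simp
  moreover have "(\<Sum>c<n. if c = r + h r then B $$ (r + h r, s + h s) * K else 0) = B $$ (r + h r, s + h s) * K"
    using h_less rs by simp
  ultimately show ?thesis by (cases "lam r = lam s") (simp_all add: K_def)
qed

text \<open>Stable rows are not rescaled and have no entries outside the stable columns. Hence,
  already for finite \<open>T\<close>, the entry is that of the integral in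
  \<open>lyapunov_sol_stable\<close> for the truncated Jordan matrix.\<close>

lemma scaled_gram_neg:
  assumes B: "B \<in> carrier_mat n n" and n1: "n1 \<le> n" "\<And>r. r < n \<Longrightarrow> Re (lam r) < 0 \<longleftrightarrow> r < n1"
    and rs: "r < n1" "s < n1"
  shows "((\<lambda>T. scaled_gram B T $$ (r, s)) \<longlongrightarrow>
    lyapunov_sol (jordan_index.jmat n1 lam bid) (sub_block B 0 0 n1 n1) $$ (r, s)) at_top"
proof -
  interpret sub: jordan_index n1 lam bid
    using n1 by unfold_locales (auto intro: bid_mono lam_eq)
  let ?R = "sub_block B 0 0 n1 n1"
  have R: "?R \<in> carrier_mat n1 n1" by (simp add: sub_block_def)
  have neg: "Re (lam r) < 0" if "r < n1" for r using n1 that by auto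
  have "scaled_gram B T $$ (r, s) =
      mat_integral n1 n1 T (\<lambda>t. sub.jexp t * ?R * mat_adjoint (sub.jexp t)) $$ (r, s)" for T
  proof -
    have z: "scaled_exp T t $$ (r, c) = 0" if "r < n1" "c < n" "\<not> c < n1" for r c t
      using that n1(1) n1(2)[of c] neg[OF that(1)] lam_eq[of r c] by (auto simp: scaled_exp_index)
    have e: "scaled_exp T t $$ (r, c) = sub.jexp t $$ (r, c)" if "r < n1" "c < n1" for r c t
      using that n1 neg[of r] by (simp add: scaled_exp_index sub.jexp_index scaled_entry_def)
    have "scaled_gram B T $$ (r, s) = (\<Sum>c<n. \<Sum>d<n. B $$ (c, d) *
        integral {0..T} (\<lambda>t. scaled_exp T t $$ (r, c) * cnj (scaled_exp T t $$ (s, d))))"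
      using rs n1 by (intro scaled_gram_index B) auto
    also have "\<dots> = (\<Sum>c<n1. \<Sum>d<n. B $$ (c, d) *
        integral {0..T} (\<lambda>t. scaled_exp T t $$ (r, c) * cnj (scaled_exp T t $$ (s, d))))"
      using n1 rs by (intro sum.mono_neutral_right) (auto simp: z)
    also have "\<dots> = (\<Sum>c<n1. \<Sum>d<n1. B $$ (c, d) *
        integral {0..T} (\<lambda>t. scaled_exp T t $$ (r, c) * cnj (scaled_exp T t $$ (s, d))))"
      using n1 rs by (intro sum.cong sum.mono_neutral_right) (auto simp: z)
    also have "\<dots> = (\<Sum>c<n1. \<Sum>d<n1. ?R $$ (c, d) *
        integral {0..T} (\<lambda>t. sub.jexp t $$ (r, c) * cnj (sub.jexp t $$ (s, d))))"
      using rs by (intro sum.cong refl) (simp add: sub_block_def e)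
    finally show ?thesis unfolding mat_integral_congruence_index[OF sub.jexp_continuous R rs] .
  qed
  then show ?thesis
    using mat_tendstoD(3)[OF sub.lyapunov_sol_stable[OF neg R] rs] by simp
qed

text \<open>As in the stable case, after a shift of all indices by \<open>s0\<close>; reflecting
  time turns \<open>jexp (t - T)\<close> into \<open>jexp (- t)\<close>, the flow used in
  \<open>lyapunov_sol_antistable\<close>.\<close>

lemma scaled_gram_pos:
  assumes B: "B \<in> carrier_mat n n" and n2: "n = s0 + n2" "\<And>r. r < n \<Longrightarrow> Re (lam r) > 0 \<longleftrightarrow> s0 \<le> r"
    and rs: "r < n2" "s < n2"
  shows "((\<lambda>T. scaled_gram B T $$ (s0 + r, s0 + s)) \<longlongrightarrow>
    lyapunov_sol (- jordan_index.jmat n2 (\<lambda>r. lam (s0 + r)) (\<lambda>r. bid (s0 + r))) (sub_block B s0 s0 n2 n2) $$ (r, s)) at_top"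
proof -
  interpret sub: jordan_index n2 "\<lambda>r. lam (s0 + r)" "\<lambda>r. bid (s0 + r)"
    using n2 by unfold_locales (auto intro: bid_mono lam_eq)
  let ?R = "sub_block B s0 s0 n2 n2"
  have R: "?R \<in> carrier_mat n2 n2" by (simp add: sub_block_def)
  have less: "s0 + r < n" if "r < n2" for r using n2(1) that by simp
  have less': "c - s0 < n2" if "c < n" "s0 \<le> c" for c using n2(1) that by simp
  have pos: "Re (lam (s0 + r)) > 0" if "r < n2" for r using n2(2)[OF less[OF that]] by auto
  have "scaled_gram B T $$ (s0 + r, s0 + s) =
      mat_integral n2 n2 T (\<lambda>t. sub.jexp (- t) * ?R * mat_adjoint (sub.jexp (- t))) $$ (r, s)" for T
  proof -
    have z: "scaled_exp T t $$ (s0 + r, c) = 0" if "r < n2" "c < s0" for r c t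
      using that n2(1) n2(2)[of c] less[of r] lam_eq[of "s0 + r" c] pos[of r]
        scaled_exp_index[of "s0 + r" c] by (cases "bid (s0 + r) = bid c") simp_all
    have e: "scaled_exp T t $$ (s0 + r, s0 + c) = sub.jexp (t - T) $$ (r, c)" if "r < n2" "c < n2" for r c t
      using that less[of r] less[of c] pos[of r] by (simp add: scaled_exp_index sub.jexp_index scaled_entry_def)
    have split: "(\<Sum>c<n. f c) = (\<Sum>c<n2. f (s0 + c))" if "\<And>c. c < s0 \<Longrightarrow> f c = 0" for f :: "nat \<Rightarrow> complex"
    proof -
      have "(\<Sum>c<n. f c) = (\<Sum>c\<in>{s0..<n}. f c)"
        using that by (intro sum.mono_neutral_right) auto
      also have "\<dots> = (\<Sum>c<n2. f (s0 + c))"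
        by (intro sum.reindex_bij_witness[of _ "\<lambda>c. s0 + c" "\<lambda>c. c - s0"]) (auto simp: less less')
      finally show ?thesis .
    qed
    have "scaled_gram B T $$ (s0 + r, s0 + s) = (\<Sum>c<n. \<Sum>d<n. B $$ (c, d) *
        integral {0..T} (\<lambda>t. scaled_exp T t $$ (s0 + r, c) * cnj (scaled_exp T t $$ (s0 + s, d))))"
      using rs less by (intro scaled_gram_index B)
    also have "\<dots> = (\<Sum>c<n2. \<Sum>d<n. B $$ (s0 + c, d) *
        integral {0..T} (\<lambda>t. scaled_exp T t $$ (s0 + r, s0 + c) * cnj (scaled_exp T t $$ (s0 + s, d))))"
      using rs by (intro split sum.neutral) (auto simp: z)
    also have "\<dots> = (\<Sum>c<n2. \<Sum>d<n2. B $$ (s0 + c, s0 + d) *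
        integral {0..T} (\<lambda>t. scaled_exp T t $$ (s0 + r, s0 + c) * cnj (scaled_exp T t $$ (s0 + s, s0 + d))))"
      by (rule sum.cong[OF refl], rule split) (simp add: z rs)
    also have "\<dots> = (\<Sum>c<n2. \<Sum>d<n2. ?R $$ (c, d) *
        integral {0..T} (\<lambda>t. sub.jexp (- t) $$ (r, c) * cnj (sub.jexp (- t) $$ (s, d))))"
      using rs integral_diff_reflect[of T "\<lambda>t. sub.jexp t $$ (r, c) * cnj (sub.jexp t $$ (s, d))" for c d]
      by (intro sum.cong refl) (simp add: sub_block_def e)
    finally show ?thesis unfolding mat_integral_congruence_index[OF sub.jexp_neg_continuous R rs] .
  qed
  then show ?thesis
    using mat_tendstoD(3)[OF sub.lyapunov_sol_antistable[OF pos R] rs] by simp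
qed

end

section \<open>Lower bounds for the scaled Gramian, uniform in the horizon\<close>

lemma quad_form_mat_integral_Re:
  assumes f: "mat_continuous n n f" and v: "v \<in> carrier_vec n"
  shows "((\<lambda>t. Re (quad_form (f t) v)) has_integral Re (quad_form (mat_integral n n T f) v)) {0..T}"
  using has_integral_linear[OF quad_form_mat_integral[OF f v] bounded_linear_Re] by (simp add: o_def)

lemma quad_form_mat_integral_Im:
  assumes f: "mat_continuous n n f" and v: "v \<in> carrier_vec n"
  shows "((\<lambda>t. Im (quad_form (f t) v)) has_integral Im (quad_form (mat_integral n n T f) v)) {0..T}"
  using has_integral_linear[OF quad_form_mat_integral[OF f v] bounded_linear_Im] by (simp add: o_def)

lemma mat_adjoint_mat_integral:
  assumes f: "mat_continuous n n f"
  shows "mat_adjoint (mat_integral n n T f) = mat_integral n n T (\<lambda>t. mat_adjoint (f t))"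
proof (rule eq_matI)
  fix i j assume "i < dim_row (mat_integral n n T (\<lambda>t. mat_adjoint (f t)))"
    "j < dim_col (mat_integral n n T (\<lambda>t. mat_adjoint (f t)))"
  then have ij: "i < n" "j < n" by (auto simp: mat_integral_def)
  have "((\<lambda>t. f t $$ (j, i)) has_integral integral {0..T} (\<lambda>t. f t $$ (j, i))) {0..T}"
    using mat_continuousD(2)[OF f] ij by (intro integrable_integral integrable_continuous_interval)
  from has_integral_linear[OF this bounded_linear_cnj]
  have "integral {0..T} (\<lambda>t. cnj (f t $$ (j, i))) = cnj (integral {0..T} (\<lambda>t. f t $$ (j, i)))"
    by (auto simp: o_def intro: integral_unique)
  then show "mat_adjoint (mat_integral n n T f) $$ (i, j) = mat_integral n n T (\<lambda>t. mat_adjoint (f t)) $$ (i, j)"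
    using ij carrier_matD[OF mat_continuousD(1)[OF f]]
    by (simp add: carrier_matD[OF mat_integral_carrier])
qed (auto simp: mat_integral_def)

lemma pos_semidef_mat_integral:
  assumes f: "mat_continuous n n f" and psd: "\<And>t. pos_semidef n (f t)"
  shows "pos_semidef n (mat_integral n n T f)"
  unfolding pos_semidef_def
proof (intro conjI ballI)
  show "mat_adjoint (mat_integral n n T f) = mat_integral n n T f"
    using psd unfolding mat_adjoint_mat_integral[OF f] by (simp add: pos_semidef_def)
  fix v :: "complex Matrix.vec" assume v: "v \<in> carrier_vec n"
  have q: "0 \<le> quad_form (f t) v" for t using psd v by (simp add: pos_semidef_def)
  then have "0 \<le> Re (quad_form (f t) v)" "Im (quad_form (f t) v) = 0" for t
    by (simp_all add: less_eq_complex_def)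
  then have "0 \<le> Re (quad_form (mat_integral n n T f) v)" "Im (quad_form (mat_integral n n T f) v) = 0"
    using has_integral_nonneg[OF quad_form_mat_integral_Re[OF f v]]
      has_integral_unique[OF quad_form_mat_integral_Im[OF f v], of 0] by (auto simp: has_integral_0)
  then show "0 \<le> quad_form (mat_integral n n T f) v" by (simp add: less_eq_complex_def)
qed simp

lemma integral_ge_on_subinterval:
  fixes g :: "real \<Rightarrow> real"
  assumes I: "(g has_integral I) {0..T}" and nonneg: "\<And>t. 0 \<le> g t"
    and ab: "0 \<le> a" "a \<le> b" "b \<le> T" and ge: "\<And>t. a \<le> t \<Longrightarrow> t \<le> b \<Longrightarrow> m \<le> g t"
  shows "m * (b - a) \<le> I"
proof -
  have int: "g integrable_on {a..b}"
    by (rule integrable_subinterval_real[OF has_integral_integrable[OF I]]) (use ab in simp)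
  have "m * (b - a) = integral {a..b} (\<lambda>t. m)" using ab by simp
  also have "\<dots> \<le> integral {a..b} g" by (rule integral_le[OF _ int]) (use ge in auto)
  also have "\<dots> \<le> integral {0..T} g"
    by (rule integral_subset_le[OF _ int has_integral_integrable[OF I]]) (use ab nonneg in auto)
  also have "\<dots> = I" using I by (rule integral_unique)
  finally show ?thesis .
qed

text \<open>Only finitely many points of the open unit interval are roots; around any other point,
  continuity keeps the squared modulus above half of its value there.\<close>

lemma poly_bounded_away_from_0:
  fixes p :: "complex poly"
  assumes "p \<noteq> 0"
  obtains a b m where "0 \<le> a" "a < b" "b \<le> 1" "0 < m"
    "\<And>s::real. a \<le> s \<Longrightarrow> s \<le> b \<Longrightarrow> m \<le> (cmod (poly p (of_real s)))\<^sup>2"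
proof -
  have "finite ((of_real :: real \<Rightarrow> complex) -` {z. poly p z = 0})"
    using poly_roots_finite[OF assms] by (intro finite_vimageI) (auto simp: inj_def)
  then have "infinite ({0<..<1} - (of_real :: real \<Rightarrow> complex) -` {z. poly p z = 0})"
    by (simp add: Diff_infinite_finite)
  then have "{0<..<1} - (of_real :: real \<Rightarrow> complex) -` {z. poly p z = 0} \<noteq> {}"
    by (rule infinite_imp_nonempty)
  then obtain s1 where s1: "0 < s1" "s1 < 1" "poly p (of_real s1) \<noteq> 0"
    by (auto simp: set_eq_iff)
  define g where "g s = (cmod (poly p (of_real s)))\<^sup>2" for s :: real
  have g1: "0 < g s1" using s1 by (simp add: g_def)
  have "isCont g s1" unfolding g_def by (intro continuous_intros)
  then obtain d where d: "0 < d" "\<And>s. \<bar>s - s1\<bar> < d \<Longrightarrow> \<bar>g s - g s1\<bar> < g s1 / 2"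
    using g1 unfolding continuous_at_eps_delta dist_real_def by (auto dest: spec[of _ "g s1 / 2"])
  define e where "e = min (d / 2) (min s1 (1 - s1))"
  have e: "0 < e" "e < d" "e \<le> s1" "e \<le> 1 - s1" using s1 d(1) by (auto simp: e_def)
  show ?thesis
  proof (rule that[of "s1 - e" "s1 + e" "g s1 / 2"])
    fix s assume "s1 - e \<le> s" "s \<le> s1 + e"
    then have "\<bar>s - s1\<bar> < d" using e by auto
    from d(2)[OF this] have "g s1 / 2 \<le> g s" by (simp add: abs_if field_simps split: if_splits)
    then show "g s1 / 2 \<le> (cmod (poly p (of_real s)))\<^sup>2" by (simp add: g_def)
  qed (use e g1 in auto)
qed

context jordan_scaling
begin

lemma scaled_exp_adjoint_mult_vec:
  assumes "x \<in> carrier_vec n" "c < n"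
  shows "(mat_adjoint (scaled_exp T t) *\<^sub>v x) $ c = (\<Sum>r<n. cnj (scaled_exp T t $$ (r, c)) * x $ r)"
proof -
  have "mat_adjoint (scaled_exp T t) \<in> carrier_mat n n" by simp
  from index_mult_vec_sum[OF this assms] show ?thesis
    using assms by (simp add: carrier_matD[OF scaled_exp_carrier])
qed

text \<open>The first nonzero entry of \<open>x\<close> detects \<open>x\<close> in the column of its own index if the eigenvalue is
  not imaginary, and in the last column of its block, where a fixed nonzero polynomial in \<open>t / T\<close>
  appears, if it is.\<close>

lemma scaled_exp_coercive:
  assumes x: "x \<in> carrier_vec n" "x \<noteq> 0\<^sub>v n"
  obtains \<delta> c a b m where "0 < \<delta>" "c < n"
    "\<And>T. 1 \<le> T \<Longrightarrow> 0 \<le> a T \<and> a T \<le> b T \<and> b T \<le> T \<and> \<delta> \<le> m T * (b T - a T)"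
    "\<And>T t. 1 \<le> T \<Longrightarrow> a T \<le> t \<Longrightarrow> t \<le> b T \<Longrightarrow>
      m T \<le> (cmod ((mat_adjoint (scaled_exp T t) *\<^sub>v x) $ c))\<^sup>2"
proof -
  have ex: "\<exists>r. r < n \<and> x $ r \<noteq> 0"
  proof (rule ccontr)
    assume "\<not> ?thesis"
    then have "x = 0\<^sub>v n" using x(1) by (intro eq_vecI) auto
    then show False using x(2) by simp
  qed
  define r0 where "r0 = (LEAST r. r < n \<and> x $ r \<noteq> 0)"
  have r0: "r0 < n" "x $ r0 \<noteq> 0"
    using LeastI_ex[OF ex] by (simp_all add: r0_def)
  have least: "x $ r = 0" if "r < r0" "r < n" for r
    using not_less_Least[of r "\<lambda>r. r < n \<and> x $ r \<noteq> 0"] that by (simp add: r0_def)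
  \<comment> \<open>Rows before \<open>r0\<close> are annihilated by \<open>x\<close>, and rows
    after \<open>r0\<close> have a zero in column \<open>r0\<close> because the scaled exponential
    is upper triangular.\<close>
  have col: "(mat_adjoint (scaled_exp T t) *\<^sub>v x) $ r0 = cnj (scaled_entry T r0 0 t) * x $ r0" for T t
  proof -
    have "(mat_adjoint (scaled_exp T t) *\<^sub>v x) $ r0 = (\<Sum>r<n. if r = r0 then cnj (scaled_entry T r0 0 t) * x $ r0 else 0)"
      unfolding scaled_exp_adjoint_mult_vec[OF x(1) r0(1)]
    proof (rule sum.cong[OF refl])
      fix r assume "r \<in> {..<n}"
      then show "cnj (scaled_exp T t $$ (r, r0)) * x $ r = (if r = r0 then cnj (scaled_entry T r0 0 t) * x $ r0 else 0)"
        using least[of r] r0 by (cases "r < r0"; cases "r = r0") (simp_all add: scaled_exp_index)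
    qed
    then show ?thesis using r0 by simp
  qed
  \<comment> \<open>The interval is placed where the entry has not decayed: \<open>[0, 1]\<close>
    for a stable row, \<open>[T - 1, T]\<close> for an antistable one. On imaginary rows the squared
    entry is of order \<open>1 / T\<close>, which is balanced by an interval covering a fixed
    fraction of \<open>[0, T]\<close>.\<close>
  consider "Re (lam r0) < 0" | "Re (lam r0) > 0" | "Re (lam r0) = 0" by linarith
  then show ?thesis
  proof cases
    case 1
    define m where "m = (exp (Re (lam r0)) * cmod (x $ r0))\<^sup>2"
    show ?thesis
    proof (rule that[of m r0 "\<lambda>T. 0" "\<lambda>T. 1" "\<lambda>T. m"])
      fix T t :: real assume t: "0 \<le> t" "t \<le> 1"
      have "Re (lam r0) * 1 \<le> Re (lam r0) * t" using 1 t by (intro mult_left_mono_neg) auto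
      then show "m \<le> (cmod ((mat_adjoint (scaled_exp T t) *\<^sub>v x) $ r0))\<^sup>2"
        using 1 t unfolding col m_def
        by (intro power_mono) (simp_all add: scaled_entry_def norm_mult norm_exp_pow mult_right_mono)
    qed (use r0 in \<open>auto simp: m_def\<close>)
  next
    case 2
    define m where "m = (exp (- Re (lam r0)) * cmod (x $ r0))\<^sup>2"
    show ?thesis
    proof (rule that[of m r0 "\<lambda>T. T - 1" "\<lambda>T. T" "\<lambda>T. m"])
      fix T t :: real assume t: "T - 1 \<le> t" "t \<le> T"
      have "Re (lam r0) * (- 1) \<le> Re (lam r0) * (t - T)" using 2 t by (intro mult_left_mono) auto
      then show "m \<le> (cmod ((mat_adjoint (scaled_exp T t) *\<^sub>v x) $ r0))\<^sup>2"
        using 2 t unfolding col m_def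
        by (intro power_mono) (simp_all add: scaled_entry_def norm_mult exp_pow_def norm_exp_eq_Re mult_right_mono)
    qed (use r0 in \<open>auto simp: m_def\<close>)
  next
    case 3
    define Blk where "Blk = {r. r < n \<and> bid r = bid r0}"
    \<comment> \<open>Its value at \<open>t / T\<close> is \<open>sqrt T\<close> times the entry of
      interest, up to a factor of modulus 1. Inside a block the exponents \<open>h r\<close> are
      distinct, so the coefficients cannot cancel and \<open>x $ r0\<close> makes \<open>p\<close>
      nonzero.\<close>
    define p where "p = (\<Sum>r\<in>Blk. monom (x $ r / fact (h r)) (h r))"
    have fin: "finite Blk" by (simp add: Blk_def)
    have inj: "r = r0" if "r \<in> Blk" "h r = h r0" for r
    proof (cases "r \<le> r0")
      case True
      have "h r = h r0 + (r0 - r)" using h_diff[OF True r0(1)] that by (simp add: Blk_def)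
      then show ?thesis using that True by simp
    next
      case False
      have "h r0 = h r + (r - r0)" using h_diff[of r0 r] False that by (simp add: Blk_def)
      then show ?thesis using that False by simp
    qed
    have "coeff p (h r0) = (\<Sum>r\<in>Blk. if r = r0 then x $ r0 / fact (h r0) else 0)"
      unfolding p_def coeff_sum using inj by (intro sum.cong refl) auto
    then have "coeff p (h r0) \<noteq> 0" using fin r0 by (simp add: Blk_def)
    then have "p \<noteq> 0" by auto
    then obtain a b m where
      abm: "0 \<le> a" "a < b" "b \<le> 1" "0 < m"
        "\<And>s::real. a \<le> s \<Longrightarrow> s \<le> b \<Longrightarrow> m \<le> (cmod (poly p (of_real s)))\<^sup>2"
      using poly_bounded_away_from_0 by blast
    define c where "c = r0 + h r0"
    have c: "c < n" "bid c = bid r0" using h_less h_bid r0 by (auto simp: c_def)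
    have rc: "r \<le> c \<and> c - r = h r \<and> lam r = lam r0" if "r \<in> Blk" for r
    proof -
      have r: "bid r = bid c" "r < n" using that c by (auto simp: Blk_def)
      have hc: "h c = 0" using h_last r0 by (simp add: c_def)
      have le: "r \<le> c"
      proof (rule ccontr)
        assume "\<not> r \<le> c"
        then have "h c = h r + (r - c)" using h_diff[of c r] r by simp
        then show False using hc \<open>\<not> r \<le> c\<close> by simp
      qed
      then have "h r = h c + (c - r)" using h_diff[of r c] r c by simp
      then show ?thesis using le hc lam_eq[of r r0] r c r0 by simp
    qed
    have last: "(mat_adjoint (scaled_exp T t) *\<^sub>v x) $ c =
        cnj (exp (lam r0 * of_real t)) / of_real (sqrt T) * poly p (of_real (t / T))" if "0 < T" for T t
    proof -
      have "(mat_adjoint (scaled_exp T t) *\<^sub>v x) $ c = (\<Sum>r\<in>Blk. cnj (scaled_exp T t $$ (r, c)) * x $ r)"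
        unfolding scaled_exp_adjoint_mult_vec[OF x(1) c(1)]
        by (rule sum.mono_neutral_right) (use c in \<open>auto simp: scaled_exp_index Blk_def\<close>)
      also have "\<dots> = (\<Sum>r\<in>Blk. cnj (exp (lam r0 * of_real t)) / of_real (sqrt T) *
          (x $ r / fact (h r) * of_real (t / T) ^ h r))"
      proof (rule sum.cong[OF refl])
        fix r assume r: "r \<in> Blk"
        have "scaled_exp T t $$ (r, c) = of_real (1 / (T ^ h r * sqrt T)) * exp_pow (lam r0) (h r) t"
          using rc[OF r] r c 3 by (simp add: scaled_exp_index Blk_def scaled_entry_def)
        then show "cnj (scaled_exp T t $$ (r, c)) * x $ r = cnj (exp (lam r0 * of_real t)) / of_real (sqrt T) *
          (x $ r / fact (h r) * of_real (t / T) ^ h r)"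
          using that by (simp add: exp_pow_def power_divide mult_ac)
      qed
      also have "\<dots> = cnj (exp (lam r0 * of_real t)) / of_real (sqrt T) * poly p (of_real (t / T))"
        unfolding p_def poly_sum poly_monom sum_distrib_left ..
      finally show ?thesis .
    qed
    show ?thesis
    proof (rule that[of "m * (b - a)" c "\<lambda>T. a * T" "\<lambda>T. b * T" "\<lambda>T. m / T"])
      fix T t :: real assume T: "1 \<le> T" and t: "a * T \<le> t" "t \<le> b * T"
      have "m \<le> (cmod (poly p (of_real (t / T))))\<^sup>2"
        using T t by (intro abm(5)) (simp_all add: pos_le_divide_eq pos_divide_le_eq)
      then have "m / T \<le> (cmod (poly p (of_real (t / T))))\<^sup>2 / T" using T by (intro divide_right_mono) auto
      also have "\<dots> = (cmod ((mat_adjoint (scaled_exp T t) *\<^sub>v x) $ c))\<^sup>2"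
        using T 3 last[of T t] by (simp add: norm_mult norm_divide norm_exp_eq_Re power_divide)
      finally show "m / T \<le> (cmod ((mat_adjoint (scaled_exp T t) *\<^sub>v x) $ c))\<^sup>2" .
    next
      fix T :: real assume T: "1 \<le> T"
      have "a * T \<le> b * T" "b * T \<le> 1 * T" using T abm by (intro mult_right_mono; simp)+
      moreover have "m / T * (b * T - a * T) = m * (b - a)" using T by (simp add: field_simps)
      ultimately show "0 \<le> a * T \<and> a * T \<le> b * T \<and> b * T \<le> T \<and> m * (b - a) \<le> m / T * (b * T - a * T)"
        using T abm(1) by simp
    qed (use c abm in auto)
  qed
qed

lemma scaled_gram_integrand_continuous:
  assumes "B \<in> carrier_mat n n"
  shows "mat_continuous n n (\<lambda>t. scaled_exp T t * B * mat_adjoint (scaled_exp T t))"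
  by (rule mat_continuous_mult[OF mat_continuous_mult[OF scaled_exp_continuous mat_continuous_const[OF assms]]
        mat_continuous_adjoint[OF scaled_exp_continuous]])

text \<open>The bound \<delta> may depend on \<open>x\<close> but not on \<open>T\<close>, which is
  what keeps the form positive at \<open>x\<close> in the limit. A single coordinate of
  \<open>mat_adjoint (scaled_exp T t) *\<^sub>v x\<close>, large on a subinterval, is enough because
  the form of \<open>B\<close> dominates the squared norm.\<close>

lemma scaled_gram_coercive:
  assumes B: "B \<in> carrier_mat n n" and \<epsilon>: "0 < \<epsilon>"
    and ge: "\<And>y. y \<in> carrier_vec n \<Longrightarrow> \<epsilon> * (\<Sum>i<n. (cmod (y $ i))\<^sup>2) \<le> Re (quad_form B y)"
    and x: "x \<in> carrier_vec n" "x \<noteq> 0\<^sub>v n"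
  obtains \<delta> where "0 < \<delta>" "\<And>T. 1 \<le> T \<Longrightarrow> \<delta> \<le> Re (quad_form (scaled_gram B T) x)"
proof -
  obtain \<delta> c a b m where \<delta>: "0 < \<delta>" and c: "c < n" and
    ab: "\<And>T. 1 \<le> T \<Longrightarrow> 0 \<le> a T \<and> a T \<le> b T \<and> b T \<le> T \<and> \<delta> \<le> m T * (b T - a T)" and
    m: "\<And>T t. 1 \<le> T \<Longrightarrow> a T \<le> t \<Longrightarrow> t \<le> b T \<Longrightarrow>
      m T \<le> (cmod ((mat_adjoint (scaled_exp T t) *\<^sub>v x) $ c))\<^sup>2"
    using scaled_exp_coercive[OF x] by blast
  have "\<epsilon> * \<delta> \<le> Re (quad_form (scaled_gram B T) x)" if T: "1 \<le> T" for T
  proof -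
    define y where "y t = mat_adjoint (scaled_exp T t) *\<^sub>v x" for t
    have y: "y t \<in> carrier_vec n" for t
      unfolding y_def using x by (intro mult_mat_vec_carrier[of _ n n]) auto
    have q: "quad_form (scaled_exp T t * B * mat_adjoint (scaled_exp T t)) x = quad_form B (y t)" for t
      unfolding y_def using x B by (intro quad_form_congruence) auto
    note cont = scaled_gram_integrand_continuous[OF B, of T]
    have int: "((\<lambda>t. Re (quad_form B (y t))) has_integral Re (quad_form (scaled_gram B T) x)) {0..T}"
      using quad_form_mat_integral_Re[OF cont x(1)] unfolding q scaled_gram_def .
    have "\<epsilon> * m T * (b T - a T) \<le> Re (quad_form (scaled_gram B T) x)"
    proof (rule integral_ge_on_subinterval[OF int])
      show "0 \<le> Re (quad_form B (y t))" for t
        by (rule order_trans[OF _ ge[OF y]]) (use \<epsilon> in \<open>auto intro!: mult_nonneg_nonneg sum_nonneg\<close>)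
      fix t assume "a T \<le> t" "t \<le> b T"
      then have "m T \<le> (cmod (y t $ c))\<^sup>2" unfolding y_def by (rule m[OF T])
      also have "(cmod (y t $ c))\<^sup>2 \<le> (\<Sum>i<n. (cmod (y t $ i))\<^sup>2)"
        using c by (intro member_le_sum) auto
      finally have "\<epsilon> * m T \<le> \<epsilon> * (\<Sum>i<n. (cmod (y t $ i))\<^sup>2)" using \<epsilon> by (intro mult_left_mono) auto
      also have "\<dots> \<le> Re (quad_form B (y t))" using ge[OF y] .
      finally show "\<epsilon> * m T \<le> Re (quad_form B (y t))" .
    qed (use ab[OF T] in auto)
    moreover have "\<epsilon> * \<delta> \<le> \<epsilon> * m T * (b T - a T)"
      using mult_left_mono[of \<delta> "m T * (b T - a T)" \<epsilon>] ab[OF T] \<epsilon> by (simp add: mult.assoc)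
    ultimately show ?thesis by simp
  qed
  then show ?thesis using that[of "\<epsilon> * \<delta>"] \<epsilon> \<delta> by simp
qed

lemma pos_semidef_scaled_gram:
  assumes "pos_semidef n B"
  shows "pos_semidef n (scaled_gram B T)"
  unfolding scaled_gram_def
  by (intro pos_semidef_mat_integral scaled_gram_integrand_continuous pos_semidef_congruence[OF assms]
      scaled_exp_carrier) (use assms in \<open>simp add: pos_semidef_def\<close>)

end

section \<open>Compactness of the simplex\<close>

text \<open>Bolzano-Weierstrass, by induction on the number of coordinates: each new coordinate
  costs one further subsequence.\<close>

lemma bounded_sequences_subseq:
  fixes f :: "nat \<Rightarrow> nat \<Rightarrow> real"
  assumes "\<And>k i. i < n \<Longrightarrow> \<bar>f k i\<bar> \<le> B"
  shows "\<exists>r q. strict_mono r \<and> (\<forall>i<n. (\<lambda>k. f (r k) i) \<longlonglongrightarrow> q i)"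
  using assms
proof (induction n)
  case 0
  show ?case by (intro exI[of _ id]) (auto simp: strict_mono_def)
next
  case (Suc n)
  then obtain r q where r: "strict_mono r" "\<forall>i<n. (\<lambda>k. f (r k) i) \<longlonglongrightarrow> q i" by auto
  have "bounded (range (\<lambda>k. f (r k) n))"
    unfolding bounded_iff using Suc.prems[of n] by (intro exI[of _ B]) auto
  from bounded_imp_convergent_subsequence[OF this] obtain l s where
    s: "strict_mono s" "((\<lambda>k. f (r k) n) \<circ> s) \<longlonglongrightarrow> l" by blast
  have "(\<lambda>k. f ((r \<circ> s) k) i) \<longlonglongrightarrow> (q(n := l)) i" if "i < Suc n" for i
  proof (cases "i = n")
    case True
    then show ?thesis using s(2) by (simp add: o_def)
  next
    case False
    then have "(\<lambda>k. f (r k) i) \<longlonglongrightarrow> q i" using that r(2) by auto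
    from LIMSEQ_subseq_LIMSEQ[OF this s(1)] show ?thesis using False by (simp add: o_def)
  qed
  moreover have "strict_mono (r \<circ> s)" using r(1) s(1) by (rule strict_mono_o)
  ultimately show ?case by blast
qed

lemma prob_simplexD:
  assumes "p \<in> prob_simplex n"
  shows "p \<in> carrier_vec n" "dim_vec p = n" "i < n \<Longrightarrow> 0 \<le> p $ i" "i < n \<Longrightarrow> p $ i \<le> 1" "(\<Sum>i<n. p $ i) = 1"
proof -
  show *: "p \<in> carrier_vec n" "dim_vec p = n" "i < n \<Longrightarrow> 0 \<le> p $ i" "(\<Sum>i<n. p $ i) = 1" for i
    using assms by (auto simp: prob_simplex_def)
  show "i < n \<Longrightarrow> p $ i \<le> 1"
    using member_le_sum[of i "{..<n}" "\<lambda>i. p $ i"] * by auto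
qed

lemma prob_simplex_closed:
  assumes p: "\<And>k. p k \<in> prob_simplex n" and q: "q \<in> carrier_vec n"
    and lim: "\<And>i. i < n \<Longrightarrow> (\<lambda>k. p k $ i) \<longlonglongrightarrow> q $ i"
  shows "q \<in> prob_simplex n"
proof -
  have "0 \<le> q $ i" if "i < n" for i
    by (rule LIMSEQ_le_const[OF lim[OF that]]) (use prob_simplexD(3)[OF p that] in auto)
  moreover have "(\<lambda>k. \<Sum>i<n. p k $ i) \<longlonglongrightarrow> (\<Sum>i<n. q $ i)" using lim by (intro tendsto_sum) auto
  then have "(\<Sum>i<n. q $ i) = 1" unfolding prob_simplexD(5)[OF p] by (simp add: tendsto_const_iff)
  ultimately show ?thesis using q by (auto simp: prob_simplex_def)
qed

lemma euclid_norm_tendsto_0_iff: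
  assumes p: "\<And>k. p k \<in> carrier_vec n" and q: "q \<in> carrier_vec n"
  shows "(\<lambda>k. euclid_norm (p k - q)) \<longlonglongrightarrow> 0 \<longleftrightarrow> (\<forall>i<n. (\<lambda>k. p k $ i) \<longlonglongrightarrow> q $ i)"
proof
  have norm: "euclid_norm (p k - q) = sqrt (\<Sum>i<n. (p k $ i - q $ i)\<^sup>2)" for k
    using p[of k] q by (auto simp: euclid_norm_def intro!: sum.cong)
  {
    assume l: "(\<lambda>k. euclid_norm (p k - q)) \<longlonglongrightarrow> 0"
    show "\<forall>i<n. (\<lambda>k. p k $ i) \<longlonglongrightarrow> q $ i"
    proof (intro allI impI)
      fix i assume i: "i < n"
      have "\<bar>p k $ i - q $ i\<bar> \<le> euclid_norm (p k - q)" for k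
      proof -
        have "\<bar>p k $ i - q $ i\<bar> = sqrt ((p k $ i - q $ i)\<^sup>2)" by simp
        also have "\<dots> \<le> euclid_norm (p k - q)"
          unfolding norm using i by (intro real_sqrt_le_mono member_le_sum) auto
        finally show ?thesis .
      qed
      then have "(\<lambda>k. p k $ i - q $ i) \<longlonglongrightarrow> 0"
        by (intro Lim_null_comparison[OF _ l]) auto
      then show "(\<lambda>k. p k $ i) \<longlonglongrightarrow> q $ i" by (simp add: LIM_zero_iff)
    qed
  }
  {
    assume l: "\<forall>i<n. (\<lambda>k. p k $ i) \<longlonglongrightarrow> q $ i"
    have "(\<lambda>k. sqrt (\<Sum>i<n. (p k $ i - q $ i)\<^sup>2)) \<longlonglongrightarrow> sqrt (\<Sum>i<n. (q $ i - q $ i)\<^sup>2)"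
      using l by (intro tendsto_real_sqrt tendsto_sum tendsto_power tendsto_diff tendsto_const) auto
    then show "(\<lambda>k. euclid_norm (p k - q)) \<longlonglongrightarrow> 0" unfolding norm by simp
  }
qed

lemma euclid_norm_nonneg: "0 \<le> euclid_norm v"
  by (simp add: euclid_norm_def sum_nonneg)

text \<open>Otherwise the distance stays above some \<open>e\<close> along times tending to
  infinity. Compactness of the simplex yields a convergent subsequence, whose limit is a cluster
  point and so lies in \<open>S\<close>, but the distance to that limit tends to zero. The argument
  also excludes an empty \<open>S\<close>, for which the distance would be infinite.\<close>

lemma dist_to_set_tendsto_0:
  assumes p: "\<And>T. 0 < T \<Longrightarrow> p T \<in> prob_simplex n"
    and cluster: "\<And>q. cluster_point n p q \<Longrightarrow> q \<in> S"
  shows "((\<lambda>T. dist_to_set (p T) S) \<longlongrightarrow> 0) at_top"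
proof (rule order_tendstoI)
  fix a :: ereal assume "a < 0"
  moreover have "0 \<le> dist_to_set (p T) S" for T
    unfolding dist_to_set_def by (intro INF_greatest) (simp add: euclid_norm_nonneg)
  ultimately have "a < dist_to_set (p T) S" for T by (rule less_le_trans)
  then show "\<forall>\<^sub>F T in at_top. a < dist_to_set (p T) S" by simp
next
  fix e :: ereal assume e: "0 < e"
  show "\<forall>\<^sub>F T in at_top. dist_to_set (p T) S < e"
  proof (rule ccontr)
    assume "\<not> ?thesis"
    \<comment> \<open>The lower bound \<open>Suc k\<close> makes all times positive, which
      \<open>cluster_point\<close> and the hypothesis on \<open>p\<close> require.\<close>
    then have "\<exists>T\<ge>real (Suc k). e \<le> dist_to_set (p T) S" for k
      unfolding eventually_at_top_linorder not_less[symmetric] by blast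
    then obtain \<tau> where \<tau>: "\<And>k. real (Suc k) \<le> \<tau> k" "\<And>k. e \<le> dist_to_set (p (\<tau> k)) S" by metis
    have pos: "0 < \<tau> k" for k using \<tau>(1)[of k] by simp
    have top: "filterlim \<tau> at_top sequentially"
    proof (rule filterlim_at_top_mono[OF filterlim_real_sequentially])
      show "\<forall>\<^sub>F k in sequentially. real k \<le> \<tau> k"
        using order_trans[OF _ \<tau>(1)] by (intro always_eventually) simp
    qed
    have "\<bar>p (\<tau> k) $ i\<bar> \<le> 1" if "i < n" for k i
      using prob_simplexD(3,4)[OF p[OF pos[of k]] that] by auto
    from bounded_sequences_subseq[of n "\<lambda>k i. p (\<tau> k) $ i", OF this] obtain r q' where
      r: "strict_mono r" "\<forall>i<n. (\<lambda>k. p (\<tau> (r k)) $ i) \<longlonglongrightarrow> q' i" by blast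
    define q where "q = Matrix.vec n q'"
    have q: "q \<in> carrier_vec n" "\<forall>i<n. (\<lambda>k. p (\<tau> (r k)) $ i) \<longlonglongrightarrow> q $ i"
      using r(2) by (auto simp: q_def)
    have pc: "p (\<tau> (r k)) \<in> carrier_vec n" for k using prob_simplexD(1)[OF p[OF pos]] .
    have l: "(\<lambda>k. euclid_norm (p (\<tau> (r k)) - q)) \<longlonglongrightarrow> 0"
      using euclid_norm_tendsto_0_iff[of "\<lambda>k. p (\<tau> (r k))", OF pc q(1)] q(2) by blast
    have "cluster_point n p q"
      unfolding cluster_point_def
    proof (intro conjI exI[of _ "\<tau> \<circ> r"] allI)
      show "filterlim (\<tau> \<circ> r) at_top sequentially"
        unfolding o_def by (rule filterlim_compose[OF top filterlim_subseq[OF r(1)]])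
    qed (use q(1) pos l in \<open>auto simp: o_def\<close>)
    then have "q \<in> S" by (rule cluster)
    have "(\<lambda>k. ereal (euclid_norm (p (\<tau> (r k)) - q))) \<longlonglongrightarrow> 0"
      using l by (simp add: zero_ereal_def)
    from order_tendstoD(2)[OF this e] obtain k where "ereal (euclid_norm (p (\<tau> (r k)) - q)) < e"
      by (auto simp: eventually_sequentially)
    moreover have "dist_to_set (p (\<tau> (r k))) S \<le> ereal (euclid_norm (p (\<tau> (r k)) - q))"
      unfolding dist_to_set_def using \<open>q \<in> S\<close> by (rule INF_lower)
    ultimately show False using \<tau>(2)[of "r k"] by simp
  qed
qed

section \<open>Traces\<close>

lemma mat_trace_sum: "A \<in> carrier_mat n n \<Longrightarrow> mat_trace A = (\<Sum>i<n. A $$ (i, i))"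
  by (simp add: mat_trace_def)

lemma mat_trace_adjoint:
  fixes A :: "complex mat"
  assumes "A \<in> carrier_mat n n"
  shows "mat_trace (mat_adjoint A) = cnj (mat_trace A)"
  using assms by (subst (1 2) mat_trace_sum[of _ n]) auto

lemma mat_trace_minus:
  fixes A :: "complex mat"
  assumes "A \<in> carrier_mat n n" "B \<in> carrier_mat n n"
  shows "mat_trace (A - B) = mat_trace A - mat_trace B"
  using assms by (simp add: mat_trace_sum[of _ n] minus_carrier_mat[OF assms(2)] sum_subtractf)

lemma mat_trace_smult:
  fixes A :: "complex mat"
  assumes "A \<in> carrier_mat n n"
  shows "mat_trace (c \<cdot>\<^sub>m A) = c * mat_trace A"
  using assms by (simp add: mat_trace_sum[of _ n] sum_distrib_left)

text \<open>The diagonal entries are values of the form at unit vectors.\<close>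

lemma mat_trace_pos_semidef:
  assumes M: "pos_semidef m M" and X: "X \<in> carrier_mat m n"
  shows "0 \<le> Re (mat_trace (mat_adjoint X * M * X))"
proof -
  have Mc: "M \<in> carrier_mat m m" using M by (simp add: pos_semidef_def)
  have "pos_semidef n (mat_adjoint X * M * mat_adjoint (mat_adjoint X))"
    using X by (intro pos_semidef_congruence[OF M]) simp
  then have psd: "pos_semidef n (mat_adjoint X * M * X)" by simp
  have c: "mat_adjoint X * M * X \<in> carrier_mat n n" using psd by (simp add: pos_semidef_def)
  have "0 \<le> Re ((mat_adjoint X * M * X) $$ (i, i))" if i: "i < n" for i
  proof -
    have "quad_form (mat_adjoint X * M * X) (unit_vec n i) =
        (\<Sum>a<n. \<Sum>b<n. if a = i \<and> b = i then (mat_adjoint X * M * X) $$ (i, i) else 0)"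
      unfolding quad_form_sum[OF c unit_vec_carrier] by (intro sum.cong refl) (auto simp: unit_vec_def)
    also have "\<dots> = (\<Sum>a<n. if a = i then (mat_adjoint X * M * X) $$ (i, i) else 0)"
      by (intro sum.cong refl) (use i in auto)
    also have "\<dots> = (mat_adjoint X * M * X) $$ (i, i)" using i by simp
    finally show ?thesis
      using psd unfolding pos_semidef_def by (metis less_eq_complex_def unit_vec_carrier zero_complex.sel(1))
  qed
  then show ?thesis unfolding mat_trace_sum[OF c] by (auto intro!: sum_nonneg)
qed

text \<open>The inverse quadratic form as a supremum of functions that are affine in \<open>M\<close>.\<close>

lemma mat_trace_inverse_ge:
  assumes M: "M \<in> carrier_mat m m" "pos_def M" and V: "V \<in> carrier_mat m n" and X: "X \<in> carrier_mat m n"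
  shows "2 * Re (mat_trace (mat_adjoint X * V)) - Re (mat_trace (mat_adjoint X * M * X)) \<le>
    Re (mat_trace (mat_adjoint V * mat_inv M * V))"
proof -
  have inv: "invertible_mat M" using pos_def_det_ne_0[OF M] invertible_mat_det[OF M(1)] by simp
  define I where "I = mat_inv M"
  have I: "I \<in> carrier_mat m m" "I * M = 1\<^sub>m m" "M * I = 1\<^sub>m m"
    using mat_inv[OF M(1) inv] by (simp_all add: I_def)
  have Mad: "mat_adjoint M = M" using M by (simp add: pos_def_def)
  have "M * mat_adjoint I = 1\<^sub>m m"
    using arg_cong[OF I(2), of mat_adjoint] mat_adjoint_mult[OF I(1) M(1)] Mad by simp
  from mat_inv_unique[OF M(1) _ this] I(1) have Iad: "mat_adjoint I = I" by (simp add: I_def)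
  \<comment> \<open>Completion of the square: expanding \<open>0 \<le> tr (N^* M N)\<close> gives
    the claim, with equality at \<open>X = M^-1 V\<close>.\<close>
  define N where "N = I * V - X"
  have IV: "I * V \<in> carrier_mat m n" using I V by simp
  have N: "N \<in> carrier_mat m n" unfolding N_def using X by (rule minus_carrier_mat)
  have Va: "mat_adjoint V \<in> carrier_mat n m" and Xa: "mat_adjoint X \<in> carrier_mat n m" using V X by simp_all
  have VaI: "mat_adjoint V * I \<in> carrier_mat n m" using Va I by simp
  have Nad: "mat_adjoint N = mat_adjoint V * I - mat_adjoint X"
  proof -
    have "mat_adjoint N = mat_adjoint (I * V) - mat_adjoint X"
      unfolding N_def by (rule mat_adjoint_minus[OF IV X])
    then show ?thesis using mat_adjoint_mult[OF I(1) V] Iad by simp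
  qed
  have MX: "M * X \<in> carrier_mat m n" using M X by simp
  have MN: "M * N = V - M * X"
    unfolding N_def using mult_minus_distrib_mat[OF M(1) IV X] assoc_mult_mat[OF M(1) I(1) V] I(3) V by simp
  have c: "mat_adjoint V * I * V \<in> carrier_mat n n" "mat_adjoint V * X \<in> carrier_mat n n"
    "mat_adjoint X * V \<in> carrier_mat n n" "mat_adjoint X * M * X \<in> carrier_mat n n"
    using VaI V Va X Xa M by auto
  have "mat_adjoint N * M * N = mat_adjoint N * (M * N)"
    using N M by (intro assoc_mult_mat[of _ n m _ m _ n]) auto
  also have "\<dots> = (mat_adjoint V * I - mat_adjoint X) * V - (mat_adjoint V * I - mat_adjoint X) * (M * X)"
    unfolding Nad MN using minus_carrier_mat[OF Xa] by (intro mult_minus_distrib_mat[OF _ V MX])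
  also have "(mat_adjoint V * I - mat_adjoint X) * V = mat_adjoint V * I * V - mat_adjoint X * V"
    by (rule minus_mult_distrib_mat[OF VaI Xa V])
  also have "(mat_adjoint V * I - mat_adjoint X) * (M * X) = mat_adjoint V * X - mat_adjoint X * M * X"
  proof -
    have "I * (M * X) = I * M * X" using assoc_mult_mat[OF I(1) M(1) X] by simp
    also have "\<dots> = X" unfolding I(2) using X by simp
    finally have "mat_adjoint V * I * (M * X) = mat_adjoint V * X"
      using assoc_mult_mat[OF Va I(1) MX] by simp
    then show ?thesis
      using minus_mult_distrib_mat[OF VaI Xa MX] assoc_mult_mat[OF Xa M(1) X] by simp
  qed
  finally have eq: "mat_adjoint N * M * N = (mat_adjoint V * I * V - mat_adjoint X * V) -
    (mat_adjoint V * X - mat_adjoint X * M * X)" .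
  have "mat_adjoint V * X = mat_adjoint (mat_adjoint X * V)"
    using mat_adjoint_mult[OF Xa V] by simp
  then have "Re (mat_trace (mat_adjoint V * X)) = Re (mat_trace (mat_adjoint X * V))"
    using mat_trace_adjoint[OF c(3)] by simp
  moreover have "mat_trace (mat_adjoint N * M * N) = mat_trace (mat_adjoint V * I * V) - mat_trace (mat_adjoint X * V)
    - (mat_trace (mat_adjoint V * X) - mat_trace (mat_adjoint X * M * X))"
    unfolding eq using c
    by (simp add: mat_trace_minus[of _ n] minus_carrier_mat[OF c(3)] minus_carrier_mat[OF c(4)])
  moreover have "0 \<le> Re (mat_trace (mat_adjoint N * M * N))"
    using pos_def_imp_pos_semidef[OF M] N by (rule mat_trace_pos_semidef)
  ultimately show ?thesis by (simp add: I_def)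
qed

lemma pos_semidef_limit:
  assumes f: "mat_tendsto n n f L F" and psd: "\<And>t. pos_semidef n (f t)" and F: "F \<noteq> bot"
  shows "pos_semidef n L"
  unfolding pos_semidef_def
proof (intro conjI ballI)
  show L: "L \<in> carrier_mat n n" using mat_tendstoD(2)[OF f] .
  have "mat_adjoint (f t) = f t" for t using psd by (simp add: pos_semidef_def)
  then show "mat_adjoint L = L"
    using mat_tendsto_unique[OF mat_tendsto_adjoint[OF f] _ F] f by simp
  fix v :: "complex Matrix.vec" assume v: "v \<in> carrier_vec n"
  have lim: "((\<lambda>t. quad_form (f t) v) \<longlongrightarrow> quad_form L v) F"
    unfolding quad_form_sum[OF mat_tendstoD(1)[OF f] v] quad_form_sum[OF L v]
    by (intro tendsto_sum tendsto_mult tendsto_const mat_tendstoD(3)[OF f]) auto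
  have q: "0 \<le> quad_form (f t) v" for t using psd v by (simp add: pos_semidef_def)
  have "0 \<le> Re (quad_form L v)"
    by (rule tendsto_lowerbound[OF tendsto_Re[OF lim] _ F]) (use q in \<open>auto simp: less_eq_complex_def\<close>)
  moreover have "((\<lambda>t. Im (quad_form (f t) v)) \<longlongrightarrow> 0) F"
    using q by (simp add: less_eq_complex_def)
  then have "Im (quad_form L v) = 0" using tendsto_unique[OF F tendsto_Im[OF lim]] by simp
  ultimately show "0 \<le> quad_form L v" by (simp add: less_eq_complex_def)
qed

text \<open>\<open>mat_tendsto\<close> asks for the right size at every \<open>t\<close>, which
  \<open>mat_inv\<close> does not guarantee at singular matrices. The witness \<open>g\<close> is
  the adjugate formula, which is total and eventually agrees with the inverse.\<close>

lemma mat_tendsto_mat_inv: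
  assumes f: "mat_tendsto n n f L F" and ev: "\<forall>\<^sub>F t in F. det (f t) \<noteq> 0" and L: "det L \<noteq> 0"
  obtains g where "mat_tendsto n n g (mat_inv L) F" "\<forall>\<^sub>F t in F. g t = mat_inv (f t)"
proof
  show "mat_tendsto n n (\<lambda>t. inverse (det (f t)) \<cdot>\<^sub>m adj_mat (f t)) (mat_inv L) F"
  proof (rule mat_tendstoI)
    fix i j assume ij: "i < n" "j < n"
    note a = mat_tendsto_adj_mat[OF f]
    have "((\<lambda>t. inverse (det (f t)) * adj_mat (f t) $$ (i, j)) \<longlongrightarrow> inverse (det L) * adj_mat L $$ (i, j)) F"
      by (intro tendsto_mult tendsto_inverse mat_tendsto_det[OF f] mat_tendstoD(3)[OF a] ij L)
    then show "((\<lambda>t. (inverse (det (f t)) \<cdot>\<^sub>m adj_mat (f t)) $$ (i, j)) \<longlongrightarrow> mat_inv L $$ (i, j)) F"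
      using ij carrier_matD[OF mat_tendstoD(1)[OF a]] carrier_matD[OF mat_tendstoD(2)[OF a]]
      by (simp add: mat_inv_adj_mat[OF mat_tendstoD(2)[OF f] L])
  qed (use mat_tendstoD(1)[OF mat_tendsto_adj_mat[OF f]] mat_tendstoD(2)[OF mat_tendsto_adj_mat[OF f]]
      mat_inv_adj_mat[OF mat_tendstoD(2)[OF f] L] in auto)
  show "\<forall>\<^sub>F t in F. inverse (det (f t)) \<cdot>\<^sub>m adj_mat (f t) = mat_inv (f t)"
    using ev by eventually_elim (simp add: mat_inv_adj_mat[OF mat_tendstoD(1)[OF f]])
qed

section \<open>Limits of optimal solutions\<close>

lemma det_mat_adjoint:
  assumes "A \<in> carrier_mat n n"
  shows "det (mat_adjoint A) = cnj (det A)"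
proof -
  have c: "transpose_mat (mat_adjoint A) \<in> carrier_mat n n" using assms by simp
  have sg: "cnj (signof p) = (signof p :: complex)" for p :: "nat \<Rightarrow> nat"
    by (cases p rule: sign_cases) simp_all
  have "det (mat_adjoint A) = det (transpose_mat (mat_adjoint A))"
    using det_transpose[of "mat_adjoint A" n] assms by simp
  also have "\<dots> = (\<Sum>p | p permutes {0..<n}. signof p * (\<Prod>i = 0..<n. transpose_mat (mat_adjoint A) $$ (i, p i)))"
    by (rule det_def'[OF c])
  also have "\<dots> = (\<Sum>p | p permutes {0..<n}. cnj (signof p * (\<Prod>i = 0..<n. A $$ (i, p i))))"
  proof (intro sum.cong refl)
    fix p assume "p \<in> {p. p permutes {0..<n}}"
    then have "p i < n" if "i < n" for i using that permutes_in_image[of p "{0..<n}" i] by simp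
    then have "(\<Prod>i = 0..<n. transpose_mat (mat_adjoint A) $$ (i, p i)) = (\<Prod>i = 0..<n. cnj (A $$ (i, p i)))"
      using assms by (intro prod.cong refl) simp
    then show "signof p * (\<Prod>i = 0..<n. transpose_mat (mat_adjoint A) $$ (i, p i)) =
        cnj (signof p * (\<Prod>i = 0..<n. A $$ (i, p i)))" by (simp add: sg)
  qed
  also have "\<dots> = cnj (det A)" unfolding det_def'[OF assms] by simp
  finally show ?thesis .
qed

text \<open>Vectors with real entries are special complex vectors, on which both forms
  agree.\<close>

lemma pos_def_of_real:
  assumes A: "A \<in> carrier_mat n n" and cA: "pos_def (map_mat complex_of_real A)"
  shows "pos_def A"
  unfolding pos_def_def
proof (intro conjI ballI impI)
  let ?A = "map_mat complex_of_real A"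
  have cAc: "?A \<in> carrier_mat n n" using A by simp
  have q: "mat_adjoint ?A = ?A" "\<And>v. v \<in> carrier_vec n \<Longrightarrow> v \<noteq> 0\<^sub>v n \<Longrightarrow> 0 < quad_form ?A v"
    using cA pos_def_quad_form[OF cAc] by auto
  show "square_mat A" using A by simp
  show "mat_adjoint A = A"
  proof (rule eq_matI)
    fix i j assume ij: "i < dim_row A" "j < dim_col A"
    then have "mat_adjoint ?A $$ (i, j) = ?A $$ (i, j)" using q(1) by simp
    then show "mat_adjoint A $$ (i, j) = A $$ (i, j)" using ij A by simp
  qed (use A in auto)
  fix v :: "real Matrix.vec" assume v: "v \<in> carrier_vec (dim_row A)" "v \<noteq> 0\<^sub>v (dim_row A)"
  have vn: "v \<in> carrier_vec n" using v A by simp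
  define w where "w = map_vec complex_of_real v"
  have w: "w \<in> carrier_vec n" using vn by (simp add: w_def)
  have "w \<noteq> 0\<^sub>v n"
  proof
    assume "w = 0\<^sub>v n"
    then have "w $ i = 0" if "i < n" for i using that by simp
    then have "v = 0\<^sub>v n" using vn by (intro eq_vecI) (auto simp: w_def)
    then show False using v A by simp
  qed
  have "quad_form ?A w = of_real ((A *\<^sub>v v) \<bullet>c v)"
    unfolding quad_form_sum[OF cAc w] using A vn
    by (auto simp: w_def scalar_prod_def lessThan_atLeast0 sum_distrib_right intro!: sum.cong)
  then show "0 < (A *\<^sub>v v) \<bullet>c v" using q(2)[OF w \<open>w \<noteq> 0\<^sub>v n\<close>] by (simp add: less_complex_def)
qed

lemma pos_def_mix:
  assumes M: "pos_semidef n A" and N: "B \<in> carrier_mat n n" "pos_def B" and e: "0 < e" "e \<le> 1"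
  shows "pos_def (of_real (1 - e) \<cdot>\<^sub>m A + of_real e \<cdot>\<^sub>m B)"
proof -
  have A: "A \<in> carrier_mat n n" "mat_adjoint A = A" using M by (auto simp: pos_semidef_def)
  have B: "mat_adjoint B = B" using N by (simp add: pos_def_def)
  let ?C = "of_real (1 - e) \<cdot>\<^sub>m A + of_real e \<cdot>\<^sub>m B"
  have C: "?C \<in> carrier_mat n n" using A N by simp
  have "mat_adjoint ?C = of_real (1 - e) \<cdot>\<^sub>m mat_adjoint A + of_real e \<cdot>\<^sub>m mat_adjoint B"
    using A(1) N(1) by (intro eq_matI) auto
  moreover have "0 < quad_form ?C v" if v: "v \<in> carrier_vec n" "v \<noteq> 0\<^sub>v n" for v
  proof -
    have "quad_form ?C v = of_real (1 - e) * quad_form A v + of_real e * quad_form B v"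
      unfolding quad_form_sum[OF C v(1)] quad_form_sum[OF A(1) v(1)] quad_form_sum[OF N(1) v(1)]
        sum_distrib_left sum.distrib[symmetric]
      using A(1) N(1) by (intro sum.cong refl) (auto simp: algebra_simps)
    moreover have "0 \<le> quad_form A v" using M v by (simp add: pos_semidef_def)
    moreover have "0 < quad_form B v" using N v pos_def_quad_form by blast
    ultimately show ?thesis using e
      by (auto simp: less_complex_def less_eq_complex_def intro!: add_nonneg_pos)
  qed
  ultimately show ?thesis unfolding pos_def_quad_form[OF C] using A B by simp
qed

lemma prob_simplex_mix:
  assumes p: "p \<in> prob_simplex n" and u: "u \<in> prob_simplex n" and e: "0 \<le> e" "e \<le> 1"
  shows "(1 - e) \<cdot>\<^sub>v p + e \<cdot>\<^sub>v u \<in> prob_simplex n"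
proof -
  note P = prob_simplexD[OF p] and Q = prob_simplexD[OF u]
  have "(\<Sum>i<n. (1 - e) * p $ i + e * u $ i) = 1"
    using P(5) Q(5) by (simp add: sum.distrib flip: sum_distrib_left)
  then show ?thesis using P Q e by (auto simp: prob_simplex_def)
qed

text \<open>What both problems need to know about the dynamics. The congruence \<open>G T\<close>
  must not depend on \<open>p\<close>. In \<open>conv\<close> the horizon and the distribution move
  together; this continuous convergence plays the role of uniform convergence on the simplex. The
  premise of \<open>nondegenerate\<close> covers \<open>n = 0\<close>, where the simplex is
  empty.\<close>

locale gramian_limit =
  fixes n :: nat and W :: "real \<Rightarrow> real Matrix.vec \<Rightarrow> real mat" and G :: "real \<Rightarrow> complex mat"
    and Winf :: "real Matrix.vec \<Rightarrow> complex mat" and M :: "real \<Rightarrow> real Matrix.vec \<Rightarrow> complex mat"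
  assumes W: "W T p \<in> carrier_mat n n"
    and G: "G T \<in> carrier_mat n n" and det_G: "0 < T \<Longrightarrow> det (G T) \<noteq> 0"
    and M_eq: "p \<in> prob_simplex n \<Longrightarrow> M T p = G T * map_mat complex_of_real (W T p) * mat_adjoint (G T)"
    and psd: "p \<in> prob_simplex n \<Longrightarrow> pos_semidef n (M T p)"
    and conv: "(\<And>k. ps k \<in> prob_simplex n) \<Longrightarrow> q \<in> prob_simplex n \<Longrightarrow>
      (\<And>i. i < n \<Longrightarrow> (\<lambda>k. ps k $ i) \<longlonglongrightarrow> q $ i) \<Longrightarrow> filterlim \<tau> at_top sequentially \<Longrightarrow>
      mat_tendsto n n (\<lambda>k. M (\<tau> k) (ps k)) (Winf q) sequentially"
    and nondegenerate: "prob_simplex n \<noteq> {} \<Longrightarrow> \<exists>u\<in>prob_simplex n. pos_def (Winf u)"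
begin

lemma M_carrier: "p \<in> prob_simplex n \<Longrightarrow> M T p \<in> carrier_mat n n"
  using psd by (simp add: pos_semidef_def)

lemma det_M:
  assumes "p \<in> prob_simplex n"
  shows "det (M T p) = of_real ((cmod (det (G T)))\<^sup>2 * det (W T p))"
proof -
  have cW: "map_mat complex_of_real (W T p) \<in> carrier_mat n n" using W by simp
  have Ga: "mat_adjoint (G T) \<in> carrier_mat n n" using G by simp
  have "det (M T p) = det (G T) * of_real (det (W T p)) * cnj (det (G T))"
    unfolding M_eq[OF assms] det_mult[OF mult_carrier_mat[OF G cW] Ga] det_mult[OF G cW]
      det_mat_adjoint[OF G] by simp
  also have "\<dots> = (det (G T) * cnj (det (G T))) * of_real (det (W T p))" by (simp add: mult_ac)
  also have "\<dots> = of_real ((cmod (det (G T)))\<^sup>2 * det (W T p))"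
    unfolding complex_norm_square[symmetric] by simp
  finally show ?thesis .
qed

lemma congruence_inverse:
  assumes T: "0 < T" and p: "p \<in> prob_simplex n"
  shows "map_mat complex_of_real (W T p) = mat_inv (G T) * M T p * mat_adjoint (mat_inv (G T))"
proof -
  let ?W = "map_mat complex_of_real (W T p)"
  have cW: "?W \<in> carrier_mat n n" using W by simp
  have inv: "invertible_mat (G T)" using invertible_mat_det[OF G] det_G[OF T] by simp
  define I where "I = mat_inv (G T)"
  have I: "I \<in> carrier_mat n n" "I * G T = 1\<^sub>m n" "G T * I = 1\<^sub>m n"
    using mat_inv[OF G inv] by (simp_all add: I_def)
  have Ga: "mat_adjoint (G T) \<in> carrier_mat n n" and Ia: "mat_adjoint I \<in> carrier_mat n n"
    using G I by simp_all
  have GI: "mat_adjoint (G T) * mat_adjoint I = 1\<^sub>m n"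
    using mat_adjoint_mult[OF I(1) G[of T]] I(2) by simp
  have "I * M T p * mat_adjoint I = I * (G T * (?W * (mat_adjoint (G T) * mat_adjoint I)))"
    unfolding M_eq[OF p] using I(1) G[of T] cW Ga Ia by (simp add: assoc_mult_mat[of _ n n _ n _ n])
  also have "\<dots> = I * G T * ?W" unfolding GI using assoc_mult_mat[OF I(1) G cW] cW by simp
  also have "\<dots> = ?W" unfolding I(2) using cW by simp
  finally show ?thesis unfolding I_def by simp
qed

text \<open>Semidefiniteness is automatic, so feasibility is the nonvanishing of a determinant. A
  competitor that is nondegenerate in the limit is therefore feasible for large horizons, see
  \<open>eventually_feasible\<close>.\<close>

lemma feasible_iff:
  assumes T: "0 < T" and p: "p \<in> prob_simplex n"
  shows "pos_def (W T p) \<longleftrightarrow> det (M T p) \<noteq> 0"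
proof
  assume "pos_def (W T p)"
  then show "det (M T p) \<noteq> 0"
    using pos_def_det_ne_0[OF W] det_G[OF T] unfolding det_M[OF p] by simp
next
  assume d: "det (M T p) \<noteq> 0"
  have cW: "map_mat complex_of_real (W T p) \<in> carrier_mat n n" using W by simp
  have "det (W T p) \<noteq> 0" using d unfolding det_M[OF p] by auto
  then have "det (map_mat complex_of_real (W T p)) \<noteq> 0" by simp
  moreover have "mat_inv (G T) \<in> carrier_mat n n"
    using mat_inv(1)[OF G] invertible_mat_det[OF G] det_G[OF T] by blast
  from pos_semidef_congruence[OF psd[OF p, of T] this]
  have "pos_semidef n (map_mat complex_of_real (W T p))"
    unfolding congruence_inverse[OF T p] .
  ultimately have "pos_def (map_mat complex_of_real (W T p))"
    using pos_semidef_det_ne_0 by blast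
  then show "pos_def (W T p)" by (rule pos_def_of_real[OF W])
qed

lemma feasible_det_pos:
  assumes T: "0 < T" and p: "p \<in> prob_simplex n" and W: "pos_def (W T p)"
  shows "0 < det (W T p)" "pos_def (M T p)"
proof -
  have d: "det (M T p) \<noteq> 0" using feasible_iff[OF T p] W by simp
  then show M: "pos_def (M T p)" using pos_semidef_det_ne_0 psd[OF p] by blast
  have "0 < (cmod (det (G T)))\<^sup>2 * det (W T p)"
    using pos_def_det_pos[OF M_carrier[OF p] M] unfolding det_M[OF p] by simp
  then show "0 < det (W T p)" using det_G[OF T] by (simp add: zero_less_mult_iff)
qed

text \<open>The simplex is closed, so the cluster point is a distribution; this permits the use of
  \<open>conv\<close> along the sequence of times.\<close>

lemma cluster_point_cases:
  assumes p: "\<And>T. 0 < T \<Longrightarrow> p T \<in> prob_simplex n" and q: "cluster_point n p q"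
  obtains \<tau> where "\<And>k. 0 < \<tau> k" "filterlim \<tau> at_top sequentially" "q \<in> prob_simplex n"
    "mat_tendsto n n (\<lambda>k. M (\<tau> k) (p (\<tau> k))) (Winf q) sequentially" "pos_semidef n (Winf q)"
proof -
  obtain \<tau> where \<tau>: "\<And>k. 0 < \<tau> k" "filterlim \<tau> at_top sequentially"
      "(\<lambda>k. euclid_norm (p (\<tau> k) - q)) \<longlonglongrightarrow> 0" and qc: "q \<in> carrier_vec n"
    using q unfolding cluster_point_def by blast
  have p\<tau>: "p (\<tau> k) \<in> prob_simplex n" for k using p \<tau>(1) .
  have lim: "(\<lambda>k. p (\<tau> k) $ i) \<longlonglongrightarrow> q $ i" if "i < n" for i
    using euclid_norm_tendsto_0_iff[of "\<lambda>k. p (\<tau> k)", OF prob_simplexD(1)[OF p\<tau>] qc] \<tau>(3) that by blast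
  have qs: "q \<in> prob_simplex n" by (rule prob_simplex_closed[OF p\<tau> qc lim])
  have M: "mat_tendsto n n (\<lambda>k. M (\<tau> k) (p (\<tau> k))) (Winf q) sequentially"
    by (rule conv[OF p\<tau> qs lim \<tau>(2)])
  have "pos_semidef n (Winf q)" by (rule pos_semidef_limit[OF M psd[OF p\<tau>]]) simp
  then show ?thesis using that \<tau>(1,2) qs M by blast
qed

lemma conv_const:
  assumes "r \<in> prob_simplex n" "filterlim \<tau> at_top sequentially"
  shows "mat_tendsto n n (\<lambda>k. M (\<tau> k) r) (Winf r) sequentially"
  using conv[of "\<lambda>k. r" r \<tau>] assms by simp

lemma eventually_feasible:
  assumes r: "r \<in> prob_simplex n" "pos_def (Winf r)"
    and \<tau>: "\<And>k. 0 < \<tau> k" "filterlim \<tau> at_top sequentially"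
  shows "\<forall>\<^sub>F k in sequentially. pos_def (W (\<tau> k) r)"
proof -
  note M = conv_const[OF r(1) \<tau>(2)]
  have "det (Winf r) \<noteq> 0" using pos_def_det_ne_0[OF mat_tendstoD(2)[OF M] r(2)] .
  from tendsto_imp_eventually_ne[OF mat_tendsto_det[OF M] this]
  show ?thesis by eventually_elim (use feasible_iff[OF \<tau>(1) r(1)] in blast)
qed

section \<open>The VCS problem\<close>

lemma VCS_cluster_point:
  assumes p: "\<And>T. 0 < T \<Longrightarrow>
      p T \<in> minimizers (\<lambda>p. - ln (det (W T p))) {p \<in> prob_simplex n. pos_def (W T p)}"
    and q: "cluster_point n p q"
  shows "q \<in> minimizers (\<lambda>p. - ln (Re (det (Winf p)))) {p \<in> prob_simplex n. pos_def (Winf p)}"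
proof -
  have ps: "p T \<in> prob_simplex n" "pos_def (W T (p T))" if "0 < T" for T
    using p[OF that] by (auto simp: minimizers_def is_arg_min_def)
  have opt: "\<not> - ln (det (W T r)) < - ln (det (W T (p T)))"
    if "0 < T" "r \<in> prob_simplex n" "pos_def (W T r)" for T r
    using p[OF that(1)] that(2,3) by (auto simp: minimizers_def is_arg_min_def)
  obtain \<tau> where \<tau>: "\<And>k. 0 < \<tau> k" "filterlim \<tau> at_top sequentially" and qs: "q \<in> prob_simplex n"
    and M: "mat_tendsto n n (\<lambda>k. M (\<tau> k) (p (\<tau> k))) (Winf q) sequentially" and psdq: "pos_semidef n (Winf q)"
    using cluster_point_cases[OF ps(1) q] by blast
  \<comment> \<open>By \<open>det_M\<close> both determinants carry the same nonnegative factor at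
    each time, so the inequality between those of the Gramians becomes one between quantities that
    converge.\<close>
  have ge: "Re (det (Winf r)) \<le> Re (det (Winf q))" if r: "r \<in> prob_simplex n" "pos_def (Winf r)" for r
  proof (rule tendsto_le[OF sequentially_bot])
    show "(\<lambda>k. Re (det (M (\<tau> k) (p (\<tau> k))))) \<longlonglongrightarrow> Re (det (Winf q))"
      by (intro tendsto_Re mat_tendsto_det[OF M])
    show "(\<lambda>k. Re (det (M (\<tau> k) r))) \<longlonglongrightarrow> Re (det (Winf r))"
      by (intro tendsto_Re mat_tendsto_det[OF conv_const[OF r(1) \<tau>(2)]])
    show "\<forall>\<^sub>F k in sequentially. Re (det (M (\<tau> k) r)) \<le> Re (det (M (\<tau> k) (p (\<tau> k))))"
      using eventually_feasible[OF r \<tau>]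
    proof eventually_elim
      case (elim k)
      have "0 < det (W (\<tau> k) r)" "0 < det (W (\<tau> k) (p (\<tau> k)))"
        using feasible_det_pos(1)[OF \<tau>(1)] r(1) elim ps[OF \<tau>(1)] by blast+
      moreover have "\<not> - ln (det (W (\<tau> k) r)) < - ln (det (W (\<tau> k) (p (\<tau> k))))"
        using opt[OF \<tau>(1) r(1) elim] .
      ultimately have "det (W (\<tau> k) r) \<le> det (W (\<tau> k) (p (\<tau> k)))" by (simp add: not_less)
      then show ?case
        unfolding det_M[OF r(1)] det_M[OF ps(1)[OF \<tau>(1)]] by (simp add: mult_left_mono)
    qed
  qed
  have Wc: "Winf r \<in> carrier_mat n n" if "r \<in> prob_simplex n" for r
    using mat_tendstoD(2)[OF conv_const[OF that \<tau>(2)]] .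
  have pos: "0 < Re (det (Winf r))" if "r \<in> prob_simplex n" "pos_def (Winf r)" for r
    using pos_def_det_pos[OF Wc] that by blast
  \<comment> \<open>Feasibility of \<open>q\<close> is a consequence of comparing it with one
    nondegenerate competitor.\<close>
  obtain u where u: "u \<in> prob_simplex n" "pos_def (Winf u)" using nondegenerate qs by blast
  have "0 < Re (det (Winf q))" using ge[OF u] pos[OF u] by simp
  then have "det (Winf q) \<noteq> 0" by auto
  then have "pos_def (Winf q)" by (rule pos_semidef_det_ne_0[OF psdq])
  moreover have "\<not> - ln (Re (det (Winf r))) < - ln (Re (det (Winf q)))"
    if "r \<in> prob_simplex n" "pos_def (Winf r)" for r
    using ge[OF that] pos[OF that] by (simp add: not_less)
  ultimately show ?thesis using qs by (auto simp: minimizers_def is_arg_min_def)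
qed

section \<open>The AECS problem\<close>

lemma trace_inverse_W:
  assumes T: "0 < T" and p: "p \<in> prob_simplex n" and pd: "pos_def (W T p)"
  shows "mat_trace (mat_inv (W T p)) =
    Re (mat_trace (mat_adjoint (G T) * mat_inv (M T p) * G T))"
proof -
  let ?W = "map_mat complex_of_real (W T p)"
  have inv: "invertible_mat (G T)" using invertible_mat_det[OF G] det_G[OF T] by simp
  define I where "I = mat_inv (G T)"
  have I: "I \<in> carrier_mat n n" "I * G T = 1\<^sub>m n" "G T * I = 1\<^sub>m n"
    using mat_inv[OF G inv] by (simp_all add: I_def)
  have Ga: "mat_adjoint (G T) \<in> carrier_mat n n" and Ia: "mat_adjoint I \<in> carrier_mat n n"
    using G I by simp_all
  have IG: "mat_adjoint I * mat_adjoint (G T) = 1\<^sub>m n"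
    using mat_adjoint_mult[OF G[of T] I(1)] I(3) by simp
  note Mc = M_carrier[OF p, of T]
  have "det (M T p) \<noteq> 0" using feasible_iff[OF T p] pd by simp
  then have "invertible_mat (M T p)" using invertible_mat_det[OF Mc] by simp
  note MI = mat_inv[OF Mc this]
  have cW: "?W \<in> carrier_mat n n" using W by simp
  have c: "mat_adjoint (G T) * mat_inv (M T p) * G T \<in> carrier_mat n n"
    by (rule mult_carrier_mat[OF mult_carrier_mat[OF Ga MI(1)] G])
  \<comment> \<open>From \<open>W = G^-1 M G^-*\<close> the inverse should be
    \<open>G^* M^-1 G\<close>; the product cancels from the inside out.\<close>
  have "?W * (mat_adjoint (G T) * mat_inv (M T p) * G T) =
      I * (M T p * ((mat_adjoint I * mat_adjoint (G T)) * (mat_inv (M T p) * G T)))"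
    unfolding congruence_inverse[OF T p] I_def[symmetric]
    using I(1) Mc Ia Ga MI(1) G[of T] by (simp add: assoc_mult_mat[of _ n n _ n _ n])
  also have "\<dots> = I * (M T p * (mat_inv (M T p) * G T))" unfolding IG using MI(1) G[of T] by simp
  also have "M T p * (mat_inv (M T p) * G T) = M T p * mat_inv (M T p) * G T"
    using assoc_mult_mat[OF Mc MI(1) G] by simp
  also have "I * (M T p * mat_inv (M T p) * G T) = 1\<^sub>m n" unfolding MI(3) using G[of T] I(2) by simp
  finally have inv1: "mat_inv ?W = mat_adjoint (G T) * mat_inv (M T p) * G T"
    using c by (intro mat_inv_unique[OF cW])
  have "invertible_mat (W T p)" using invertible_mat_det[OF W] pos_def_det_ne_0[OF W pd] by simp
  note WI = mat_inv[OF W this]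
  have "?W * map_mat complex_of_real (mat_inv (W T p)) = map_mat complex_of_real (W T p * mat_inv (W T p))"
    by (rule of_real_hom.mat_hom_mult[OF W WI(1), symmetric])
  also have "\<dots> = 1\<^sub>m n" unfolding WI(3) by (rule eq_matI) auto
  finally have "mat_inv ?W = map_mat complex_of_real (mat_inv (W T p))"
    using WI(1) by (intro mat_inv_unique[OF cW]) auto
  then have "mat_trace (mat_adjoint (G T) * mat_inv (M T p) * G T) = of_real (mat_trace (mat_inv (W T p)))"
    unfolding inv1[symmetric] using WI(1) by (simp add: mat_trace_def)
  then show ?thesis by simp
qed

end

text \<open>\<open>U\<close> embeds the stable coordinates, and \<open>Y\<close> will be
  \<open>Q^-1\<close>, so \<open>G_limit\<close> says that \<open>G\<close> tends to the stable rows
  of \<open>Y\<close>, padded by zeros. By \<open>Winf_U\<close> the stable coordinates form an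
  invariant subspace of \<open>Winf\<close>, with block \<open>Wneg\<close>.\<close>

locale gramian_limit_stable = gramian_limit +
  fixes m :: nat and U Y :: "complex mat" and Wneg :: "real Matrix.vec \<Rightarrow> complex mat"
  assumes U: "U \<in> carrier_mat n m" and U_isometry: "mat_adjoint U * U = 1\<^sub>m m"
    and Y: "Y \<in> carrier_mat n n" and det_Y: "det Y \<noteq> 0"
    and G_limit: "mat_tendsto n n G (U * (mat_adjoint U * Y)) at_top"
    and Wneg: "p \<in> prob_simplex n \<Longrightarrow> Wneg p \<in> carrier_mat m m"
    and Winf_U: "p \<in> prob_simplex n \<Longrightarrow> Winf p * U = U * Wneg p"
    and affine: "p \<in> prob_simplex n \<Longrightarrow> u \<in> prob_simplex n \<Longrightarrow> 0 \<le> e \<Longrightarrow> e \<le> 1 \<Longrightarrow>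
      Winf ((1 - e) \<cdot>\<^sub>v p + e \<cdot>\<^sub>v u) = of_real (1 - e) \<cdot>\<^sub>m Winf p + of_real e \<cdot>\<^sub>m Winf u"
begin

definition V :: "complex mat" where "V = mat_adjoint U * Y"

definition AECS_limit :: "real Matrix.vec \<Rightarrow> real" where
  "AECS_limit p = Re (mat_trace (mat_adjoint V * mat_inv (Wneg p) * V))"

lemma U_adjoint: "mat_adjoint U \<in> carrier_mat m n"
  using U by simp

lemma V: "V \<in> carrier_mat m n"
  unfolding V_def by (rule mult_carrier_mat[OF U_adjoint Y])

lemma V_adjoint: "mat_adjoint V \<in> carrier_mat n m" "mat_adjoint V = mat_adjoint Y * U"
proof -
  show "mat_adjoint V \<in> carrier_mat n m" using V by simp
  show "mat_adjoint V = mat_adjoint Y * U" unfolding V_def mat_adjoint_mult[OF U_adjoint Y] by simp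
qed

lemma U_cancel:
  assumes "B \<in> carrier_mat m k"
  shows "mat_adjoint U * (U * B) = B"
  unfolding assoc_mult_mat[OF U_adjoint U assms, symmetric] U_isometry using assms by simp

lemma Winf_carrier: "p \<in> prob_simplex n \<Longrightarrow> Winf p \<in> carrier_mat n n"
  using mat_tendstoD(2)[OF conv_const[OF _ filterlim_real_sequentially]] .

lemma pos_semidef_Winf: "p \<in> prob_simplex n \<Longrightarrow> pos_semidef n (Winf p)"
  using pos_semidef_limit[OF conv_const[OF _ filterlim_real_sequentially] psd] by simp

lemma Wneg_eq: "p \<in> prob_simplex n \<Longrightarrow> Wneg p = mat_adjoint U * Winf p * U"
  by (simp add: assoc_mult_mat[OF U_adjoint Winf_carrier U] Winf_U U_cancel[OF Wneg])

lemma pos_semidef_Wneg: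
  assumes p: "p \<in> prob_simplex n"
  shows "pos_semidef m (Wneg p)"
  using pos_semidef_congruence[OF pos_semidef_Winf[OF p] U_adjoint] by (simp add: Wneg_eq[OF p])

text \<open>As \<open>U\<close> intertwines \<open>Winf r\<close> and \<open>Wneg r\<close>, the
  compression of \<open>mat_inv (Winf r)\<close> by \<open>U\<close> inverts \<open>Wneg r\<close>.
  The limiting objective is thereby expressed through the inverse of the full limit matrix, which is
  the form that arises as \<open>T \<rightarrow> \<infinity>\<close>.\<close>

lemma AECS_limit_Winf:
  assumes r: "r \<in> prob_simplex n" "pos_def (Winf r)"
  shows "AECS_limit r = Re (mat_trace (mat_adjoint (U * V) * mat_inv (Winf r) * (U * V)))"
proof -
  note Wc = Winf_carrier[OF r(1)] and Nc = Wneg[OF r(1)]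
  have "invertible_mat (Winf r)" using pos_def_det_ne_0[OF Wc r(2)] invertible_mat_det[OF Wc] by simp
  note WI = mat_inv[OF Wc this]
  have UI: "mat_adjoint U * mat_inv (Winf r) \<in> carrier_mat m n" using U_adjoint WI(1) by (rule mult_carrier_mat)
  have UIU: "mat_adjoint U * mat_inv (Winf r) * U \<in> carrier_mat m m" using UI U by (rule mult_carrier_mat)
  have "mat_adjoint U * mat_inv (Winf r) * U * Wneg r = mat_adjoint U * mat_inv (Winf r) * (Winf r * U)"
    unfolding Winf_U[OF r(1)] by (rule assoc_mult_mat[OF UI U Nc])
  also have "\<dots> = mat_adjoint U * (mat_inv (Winf r) * Winf r) * U"
    using assoc_mult_mat[OF UI Wc U] assoc_mult_mat[OF U_adjoint WI(1) Wc] by simp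
  also have "\<dots> = 1\<^sub>m m" unfolding WI(2) using U_adjoint U_isometry by simp
  finally have "Wneg r * (mat_adjoint U * mat_inv (Winf r) * U) = 1\<^sub>m m"
    by (rule mat_mult_left_right_inverse[OF UIU Nc])
  then have inv: "mat_inv (Wneg r) = mat_adjoint U * mat_inv (Winf r) * U"
    by (rule mat_inv_unique[OF Nc UIU])
  have "mat_adjoint (U * V) * mat_inv (Winf r) * (U * V) = mat_adjoint V * mat_inv (Wneg r) * V"
    unfolding mat_adjoint_mult[OF U V] inv
    using V V_adjoint(1) U U_adjoint WI(1)
    by (simp add: assoc_mult_mat[of _ n m _ n _ n] assoc_mult_mat[of _ n n _ m _ n]
        assoc_mult_mat[of _ n m _ m _ n] assoc_mult_mat[of _ m n _ n _ m] assoc_mult_mat[of _ m n _ m _ n]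
        assoc_mult_mat[of _ n n _ n _ n] assoc_mult_mat[of _ m n _ n _ n])
  then show ?thesis unfolding AECS_limit_def by simp
qed

text \<open>At finite horizon the affine minorant with test matrix \<open>X\<close> lies below the
  optimal value, which lies below the value at \<open>r\<close>. The two outer quantities converge
  even when the optimal values involve inverses that degenerate, so the comparison survives for
  every \<open>X\<close>.\<close>

lemma AECS_cluster_lower_bound:
  assumes p: "\<And>T. 0 < T \<Longrightarrow>
      p T \<in> minimizers (\<lambda>p. mat_trace (mat_inv (W T p))) {p \<in> prob_simplex n. pos_def (W T p)}"
    and q: "cluster_point n p q" and r: "r \<in> prob_simplex n" "pos_def (Winf r)"
    and X: "X \<in> carrier_mat n n"
  shows "2 * Re (mat_trace (mat_adjoint X * (U * V))) - Re (mat_trace (mat_adjoint X * Winf q * X)) \<le> AECS_limit r"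
proof -
  have ps: "p T \<in> prob_simplex n" "pos_def (W T (p T))" if "0 < T" for T
    using p[OF that] by (auto simp: minimizers_def is_arg_min_def)
  have opt: "mat_trace (mat_inv (W T (p T))) \<le> mat_trace (mat_inv (W T r))"
    if "0 < T" "pos_def (W T r)" for T
    using p[OF that(1)] that(2) r(1) by (auto simp: minimizers_def is_arg_min_def not_less)
  obtain \<tau> where \<tau>: "\<And>k. 0 < \<tau> k" "filterlim \<tau> at_top sequentially"
    and M: "mat_tendsto n n (\<lambda>k. M (\<tau> k) (p (\<tau> k))) (Winf q) sequentially"
    using cluster_point_cases[OF ps(1) q] by blast
  have GU: "mat_tendsto n n (\<lambda>k. G (\<tau> k)) (U * V) sequentially"
    using mat_tendsto_compose[OF G_limit \<tau>(2)] unfolding V_def .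
  have Xa: "mat_adjoint X \<in> carrier_mat n n" using X by simp
  note feas = eventually_feasible[OF r \<tau>]
  note Mr = conv_const[OF r(1) \<tau>(2)]
  have dr: "det (Winf r) \<noteq> 0" using pos_def_det_ne_0[OF mat_tendstoD(2)[OF Mr] r(2)] .
  have "\<forall>\<^sub>F k in sequentially. det (M (\<tau> k) r) \<noteq> 0"
    using tendsto_imp_eventually_ne[OF mat_tendsto_det[OF Mr] dr] .
  from mat_tendsto_mat_inv[OF Mr this dr] obtain g where
    g: "mat_tendsto n n g (mat_inv (Winf r)) sequentially" "\<forall>\<^sub>F k in sequentially. g k = mat_inv (M (\<tau> k) r)"
    by blast
  show ?thesis
  proof (rule tendsto_le[OF sequentially_bot])
    show "(\<lambda>k. 2 * Re (mat_trace (mat_adjoint X * G (\<tau> k))) -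
        Re (mat_trace (mat_adjoint X * M (\<tau> k) (p (\<tau> k)) * X))) \<longlonglongrightarrow>
      2 * Re (mat_trace (mat_adjoint X * (U * V))) - Re (mat_trace (mat_adjoint X * Winf q * X))"
      by (intro tendsto_diff tendsto_mult tendsto_const tendsto_Re
          mat_tendsto_trace[OF mat_tendsto_mult[OF mat_tendsto_const[OF Xa] GU]]
          mat_tendsto_trace[OF mat_tendsto_mult[OF mat_tendsto_mult[OF mat_tendsto_const[OF Xa] M] mat_tendsto_const[OF X]]])
    show "(\<lambda>k. Re (mat_trace (mat_adjoint (G (\<tau> k)) * g k * G (\<tau> k)))) \<longlonglongrightarrow> AECS_limit r"
      unfolding AECS_limit_Winf[OF r]
      by (intro tendsto_Re mat_tendsto_trace[OF mat_tendsto_mult[OF mat_tendsto_mult[OF mat_tendsto_adjoint[OF GU] g(1)] GU]])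
    show "\<forall>\<^sub>F k in sequentially. 2 * Re (mat_trace (mat_adjoint X * G (\<tau> k))) -
        Re (mat_trace (mat_adjoint X * M (\<tau> k) (p (\<tau> k)) * X)) \<le>
        Re (mat_trace (mat_adjoint (G (\<tau> k)) * g k * G (\<tau> k)))"
      using feas g(2)
    proof eventually_elim
      case (elim k)
      note T = \<tau>(1)[of k]
      have "2 * Re (mat_trace (mat_adjoint X * G (\<tau> k))) -
          Re (mat_trace (mat_adjoint X * M (\<tau> k) (p (\<tau> k)) * X)) \<le>
          Re (mat_trace (mat_adjoint (G (\<tau> k)) * mat_inv (M (\<tau> k) (p (\<tau> k))) * G (\<tau> k)))"
        using M_carrier[OF ps(1)[OF T]] feasible_det_pos(2)[OF T ps[OF T]] G X by (rule mat_trace_inverse_ge)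
      also have "\<dots> = mat_trace (mat_inv (W (\<tau> k) (p (\<tau> k))))"
        using trace_inverse_W[OF T ps[OF T]] by simp
      also have "\<dots> \<le> mat_trace (mat_inv (W (\<tau> k) r))" using opt[OF T elim(1)] .
      also have "\<dots> = Re (mat_trace (mat_adjoint (G (\<tau> k)) * g k * G (\<tau> k)))"
        using trace_inverse_W[OF T r(1) elim(1)] elim(2) by simp
      finally show ?case .
    qed
  qed
qed

text \<open>The test matrices \<open>X = c U Z V\<close>: a rank one \<open>Z\<close> on the kernel of \<open>Wneg q\<close> excludes singular
  limits, and \<open>Z = (Wneg q)\<^sup>-\<^sup>1\<close> yields the optimal value.\<close>

lemma AECS_cluster_test:
  assumes p: "\<And>T. 0 < T \<Longrightarrow>
      p T \<in> minimizers (\<lambda>p. mat_trace (mat_inv (W T p))) {p \<in> prob_simplex n. pos_def (W T p)}"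
    and q: "cluster_point n p q" "q \<in> prob_simplex n" and r: "r \<in> prob_simplex n" "pos_def (Winf r)"
    and Z: "Z \<in> carrier_mat m m" "mat_adjoint Z = Z"
  shows "2 * c * Re (mat_trace (mat_adjoint V * Z * V)) -
    c\<^sup>2 * Re (mat_trace (mat_adjoint V * (Z * Wneg q * Z) * V)) \<le> AECS_limit r"
proof -
  have ZV: "Z * V \<in> carrier_mat m n" using Z(1) V by (rule mult_carrier_mat)
  define X1 where "X1 = U * (Z * V)"
  have X1: "X1 \<in> carrier_mat n n" unfolding X1_def using U ZV by (rule mult_carrier_mat)
  define X where "X = of_real c \<cdot>\<^sub>m X1"
  have X: "X \<in> carrier_mat n n" using X1 by (simp add: X_def)
  have Xa: "mat_adjoint X = of_real c \<cdot>\<^sub>m mat_adjoint X1"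
    unfolding X_def using X1 by (intro eq_matI) auto
  have VZ: "mat_adjoint V * Z \<in> carrier_mat n m" using V_adjoint(1) Z(1) by (rule mult_carrier_mat)
  have X1a: "mat_adjoint X1 = mat_adjoint V * Z * mat_adjoint U"
    unfolding X1_def mat_adjoint_mult[OF U ZV] mat_adjoint_mult[OF Z(1) V] Z(2) ..
  have X1ac: "mat_adjoint X1 \<in> carrier_mat n n" using X1 by simp
  note Wc = Winf_carrier[OF q(2)] and Nc = Wneg[OF q(2)]
  have UV: "U * V \<in> carrier_mat n n" using U V by (rule mult_carrier_mat)
  have e1: "mat_adjoint X1 * (U * V) = mat_adjoint V * Z * V"
  proof -
    have "mat_adjoint X1 * (U * V) = mat_adjoint V * Z * (mat_adjoint U * (U * V))"
      unfolding X1a by (rule assoc_mult_mat[OF VZ U_adjoint UV])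
    also have "mat_adjoint U * (U * V) = V"
      by (rule U_cancel[OF V])
    finally show ?thesis .
  qed
  have e2: "mat_adjoint X1 * Winf q * X1 = mat_adjoint V * (Z * Wneg q * Z) * V"
  proof -
    have "mat_adjoint X1 * Winf q * X1 = mat_adjoint X1 * (Winf q * U * (Z * V))"
      unfolding X1_def[symmetric] using assoc_mult_mat[OF X1ac Wc X1] assoc_mult_mat[OF Wc U ZV] by (simp add: X1_def)
    also have "Winf q * U * (Z * V) = U * (Wneg q * (Z * V))"
      unfolding Winf_U[OF q(2)] by (rule assoc_mult_mat[OF U Nc ZV])
    also have "mat_adjoint X1 * \<dots> = mat_adjoint V * Z * (mat_adjoint U * (U * (Wneg q * (Z * V))))"
      unfolding X1a by (rule assoc_mult_mat[OF VZ U_adjoint mult_carrier_mat[OF U mult_carrier_mat[OF Nc ZV]]])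
    also have "mat_adjoint U * (U * (Wneg q * (Z * V))) = Wneg q * (Z * V)"
      by (rule U_cancel[OF mult_carrier_mat[OF Nc ZV]])
    also have "mat_adjoint V * Z * (Wneg q * (Z * V)) = mat_adjoint V * (Z * Wneg q * Z) * V"
      using V_adjoint(1) Z(1) Nc V
      by (simp add: assoc_mult_mat[of _ n m _ m _ n] assoc_mult_mat[of _ m m _ m _ n] assoc_mult_mat[of _ m m _ m _ m])
    finally show ?thesis .
  qed
  have X1W: "mat_adjoint X1 * Winf q \<in> carrier_mat n n" using X1ac Wc by (rule mult_carrier_mat)
  have t1: "mat_trace (mat_adjoint X * (U * V)) = of_real c * mat_trace (mat_adjoint V * Z * V)"
    unfolding Xa mult_smult_assoc_mat[OF X1ac UV] e1
    by (rule mat_trace_smult[OF mult_carrier_mat[OF VZ V]])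
  have "mat_adjoint X * Winf q * X = of_real c \<cdot>\<^sub>m (of_real c \<cdot>\<^sub>m (mat_adjoint X1 * Winf q * X1))"
    unfolding Xa unfolding X_def mult_smult_assoc_mat[OF X1ac Wc] mult_smult_distrib[OF smult_carrier_mat[OF X1W] X1]
      mult_smult_assoc_mat[OF X1W X1] ..
  then have t2: "mat_trace (mat_adjoint X * Winf q * X) = of_real (c\<^sup>2) * mat_trace (mat_adjoint V * (Z * Wneg q * Z) * V)"
    using mat_trace_smult[OF smult_carrier_mat[OF mult_carrier_mat[OF X1W X1]]]
      mat_trace_smult[OF mult_carrier_mat[OF X1W X1]] by (simp add: e2 power2_eq_square)
  show ?thesis
    using AECS_cluster_lower_bound[OF p q(1) r X] unfolding t1 t2 by simp
qed

text \<open>\<open>Z\<close> is the rank one matrix \<open>x x^*\<close>, so the trace is the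
  squared norm of \<open>V^* x\<close>; \<open>y j\<close> is the conjugate of a coordinate of that
  vector. Since \<open>V^* = Y^* U\<close> with \<open>Y\<close> invertible and \<open>U\<close>
  isometric, it vanishes only for \<open>x = 0\<close>.\<close>

lemma kernel_test_pos:
  assumes x: "x \<in> carrier_vec m" "x \<noteq> 0\<^sub>v m"
  defines "Z \<equiv> mat m m (\<lambda>(a, b). x $ a * cnj (x $ b))"
  shows "0 < Re (mat_trace (mat_adjoint V * Z * V))"
proof -
  have Z: "Z \<in> carrier_mat m m" by (simp add: Z_def)
  define y where "y j = (\<Sum>b<m. V $$ (b, j) * cnj (x $ b))" for j
  have "(mat_adjoint V * Z * V) $$ (j, j) = of_real ((cmod (y j))\<^sup>2)" if j: "j < n" for j
  proof -
    have "(mat_adjoint V * Z * V) $$ (j, j) = (\<Sum>b<m. (\<Sum>a<m. cnj (V $$ (a, j)) * (x $ a * cnj (x $ b))) * V $$ (b, j))"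
      unfolding index_mult_sum[OF mult_carrier_mat[OF V_adjoint(1) Z] V j j]
    proof (intro sum.cong refl)
      fix b assume b: "b \<in> {..<m}"
      have "(mat_adjoint V * Z) $$ (j, b) = (\<Sum>a<m. cnj (V $$ (a, j)) * (x $ a * cnj (x $ b)))"
        using j b V by (subst index_mult_sum[OF V_adjoint(1) Z]) (auto simp: Z_def intro!: sum.cong)
      then show "(mat_adjoint V * Z) $$ (j, b) * V $$ (b, j) =
          (\<Sum>a<m. cnj (V $$ (a, j)) * (x $ a * cnj (x $ b))) * V $$ (b, j)" by simp
    qed
    also have "\<dots> = (\<Sum>b<m. cnj (y j) * (V $$ (b, j) * cnj (x $ b)))"
      by (intro sum.cong refl) (simp add: y_def sum_distrib_left sum_distrib_right mult_ac)
    also have "\<dots> = y j * cnj (y j)" by (simp add: y_def sum_distrib_left mult_ac)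
    finally show ?thesis unfolding complex_norm_square .
  qed
  then have tr: "Re (mat_trace (mat_adjoint V * Z * V)) = (\<Sum>j<n. (cmod (y j))\<^sup>2)"
    unfolding mat_trace_sum[OF mult_carrier_mat[OF mult_carrier_mat[OF V_adjoint(1) Z] V]] by simp
  have "\<exists>j<n. y j \<noteq> 0"
  proof (rule ccontr)
    assume "\<not> ?thesis"
    then have y0: "y j = 0" if "j < n" for j using that by blast
    have Ya: "mat_adjoint Y \<in> carrier_mat n n" using Y by simp
    have "mat_adjoint V *\<^sub>v x = 0\<^sub>v n"
    proof (rule eq_vecI)
      fix j assume "j < dim_vec (0\<^sub>v n)"
      then have j: "j < n" by simp
      have "(mat_adjoint V *\<^sub>v x) $ j = cnj (y j)"
        using j V unfolding index_mult_vec_sum[OF V_adjoint(1) x(1) j] y_def by simp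
      then show "(mat_adjoint V *\<^sub>v x) $ j = 0\<^sub>v n $ j" using y0[OF j] j by simp
    qed (use V in auto)
    then have "mat_adjoint Y *\<^sub>v (U *\<^sub>v x) = 0\<^sub>v n"
      unfolding V_adjoint(2) using assoc_mult_mat_vec[OF Ya U x(1)] by simp
    moreover have "U *\<^sub>v x \<in> carrier_vec n" using U x(1) by (rule mult_mat_vec_carrier)
    moreover have "det (mat_adjoint Y) \<noteq> 0" using det_mat_adjoint[OF Y] det_Y by simp
    ultimately have "U *\<^sub>v x = 0\<^sub>v n" using det_0_iff_vec_prod_zero[OF Ya] by blast
    then have "mat_adjoint U *\<^sub>v (U *\<^sub>v x) = 0\<^sub>v m" using U_adjoint by (intro eq_vecI) auto
    then have "x = 0\<^sub>v m" using assoc_mult_mat_vec[OF U_adjoint U x(1)] U_isometry x(1) by simp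
    then show False using x(2) by simp
  qed
  then obtain j where "j < n" "y j \<noteq> 0" by blast
  then show ?thesis unfolding tr by (intro sum_pos2[of _ j]) auto
qed

text \<open>For \<open>Z = x x^*\<close> with \<open>x\<close> in the kernel, the term quadratic in
  \<open>c\<close> disappears from \<open>AECS_cluster_test\<close>. A linear function of
  \<open>c\<close> with positive slope would then be bounded by the value at one fixed
  competitor.\<close>

lemma AECS_cluster_pos_def:
  assumes p: "\<And>T. 0 < T \<Longrightarrow>
      p T \<in> minimizers (\<lambda>p. mat_trace (mat_inv (W T p))) {p \<in> prob_simplex n. pos_def (W T p)}"
    and q: "cluster_point n p q" "q \<in> prob_simplex n"
  shows "pos_def (Wneg q)"
proof (rule ccontr)
  assume np: "\<not> pos_def (Wneg q)"
  note Nc = Wneg[OF q(2)]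
  have "det (Wneg q) = 0" using pos_semidef_det_ne_0[OF pos_semidef_Wneg[OF q(2)]] np by blast
  then obtain x where x: "x \<in> carrier_vec m" "x \<noteq> 0\<^sub>v m" "Wneg q *\<^sub>v x = 0\<^sub>v m"
    using det_0_iff_vec_prod_zero[OF Nc] by blast
  define Z where "Z = mat m m (\<lambda>(a, b). x $ a * cnj (x $ b))"
  have Z: "Z \<in> carrier_mat m m" by (simp add: Z_def)
  have Zad: "mat_adjoint Z = Z" by (rule eq_matI) (auto simp: Z_def)
  have WZ: "Wneg q * Z = 0\<^sub>m m m"
  proof (rule eq_matI)
    fix i j assume "i < dim_row (0\<^sub>m m m)" "j < dim_col (0\<^sub>m m m)"
    then have ij: "i < m" "j < m" by auto
    have "(Wneg q * Z) $$ (i, j) = (\<Sum>k<m. Wneg q $$ (i, k) * x $ k) * cnj (x $ j)"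
      unfolding index_mult_sum[OF Nc Z ij] sum_distrib_right using ij by (intro sum.cong) (auto simp: Z_def)
    also have "(\<Sum>k<m. Wneg q $$ (i, k) * x $ k) = 0"
      using index_mult_vec_sum[OF Nc x(1) ij(1)] x(3) ij by simp
    finally show "(Wneg q * Z) $$ (i, j) = 0\<^sub>m m m $$ (i, j)" using ij by simp
  qed (use Nc Z in auto)
  have "Z * Wneg q * Z = 0\<^sub>m m m" using assoc_mult_mat[OF Z Nc Z] WZ Z by simp
  then have z: "mat_adjoint V * (Z * Wneg q * Z) * V = 0\<^sub>m n n" using V_adjoint(1) V by simp
  obtain u where u: "u \<in> prob_simplex n" "pos_def (Winf u)" using nondegenerate q(2) by blast
  define t where "t = Re (mat_trace (mat_adjoint V * Z * V))"
  have t: "0 < t" unfolding t_def Z_def using x(1,2) by (rule kernel_test_pos)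
  have "2 * c * t \<le> AECS_limit u" for c
    using AECS_cluster_test[OF p q u Z Zad, of c] by (simp add: z t_def mat_trace_def)
  \<comment> \<open>For this \<open>c\<close> the left side equals
    \<open>2 * (\<bar>AECS_limit u\<bar> + 1)\<close>.\<close>
  from this[of "(\<bar>AECS_limit u\<bar> + 1) / t"] show False using t by simp
qed

text \<open>With \<open>Z\<close> the inverse of \<open>Wneg q\<close> and \<open>c = 1\<close>,
  both traces in \<open>AECS_cluster_test\<close> equal \<open>AECS_limit q\<close>, and twice this
  value minus once remains.\<close>

lemma AECS_cluster_optimal:
  assumes p: "\<And>T. 0 < T \<Longrightarrow>
      p T \<in> minimizers (\<lambda>p. mat_trace (mat_inv (W T p))) {p \<in> prob_simplex n. pos_def (W T p)}"
    and q: "cluster_point n p q" "q \<in> prob_simplex n" and r: "r \<in> prob_simplex n" "pos_def (Winf r)"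
  shows "AECS_limit q \<le> AECS_limit r"
proof -
  note Nc = Wneg[OF q(2)]
  note pd = AECS_cluster_pos_def[OF p q]
  have "invertible_mat (Wneg q)" using pos_def_det_ne_0[OF Nc pd] invertible_mat_det[OF Nc] by simp
  note I = mat_inv[OF Nc this]
  have ad: "mat_adjoint (Wneg q) = Wneg q" using pd by (simp add: pos_def_def)
  have "Wneg q * mat_adjoint (mat_inv (Wneg q)) = 1\<^sub>m m"
    using mat_adjoint_mult[OF I(1) Nc] I(2) ad by simp
  from mat_inv_unique[OF Nc _ this] I(1) have Iad: "mat_adjoint (mat_inv (Wneg q)) = mat_inv (Wneg q)" by simp
  have "mat_inv (Wneg q) * Wneg q * mat_inv (Wneg q) = mat_inv (Wneg q)" unfolding I(2) using I(1) by simp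
  then show ?thesis
    using AECS_cluster_test[OF p q r I(1) Iad, of 1] unfolding AECS_limit_def by simp
qed

lemma AECS_cluster_point:
  assumes p: "\<And>T. 0 < T \<Longrightarrow>
      p T \<in> minimizers (\<lambda>p. mat_trace (mat_inv (W T p))) {p \<in> prob_simplex n. pos_def (W T p)}"
    and q: "cluster_point n p q"
  shows "q \<in> minimizers AECS_limit {p \<in> prob_simplex n. pos_def (Wneg p)}"
proof -
  have "p T \<in> prob_simplex n" if "0 < T" for T
    using p[OF that] by (auto simp: minimizers_def is_arg_min_def)
  then have qs: "q \<in> prob_simplex n" using cluster_point_cases[OF _ q] by blast
  obtain u where u: "u \<in> prob_simplex n" "pos_def (Winf u)" using nondegenerate qs by blast
  have "AECS_limit q \<le> AECS_limit r" if r: "r \<in> prob_simplex n" "pos_def (Wneg r)" for r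
  proof -
    \<comment> \<open>A positive weight on \<open>u\<close> makes the whole of
      \<open>Winf (s k)\<close> definite, whereas \<open>r\<close> is only known to have
      \<open>Wneg r\<close> definite. Weights tending to zero let the objective at
      \<open>s k\<close> converge to that at \<open>r\<close>.\<close>
    define e where "e k = 1 / real (Suc k)" for k
    define s where "s k = (1 - e k) \<cdot>\<^sub>v r + e k \<cdot>\<^sub>v u" for k
    have e: "0 < e k" "e k \<le> 1" for k by (auto simp: e_def)
    have e0: "e \<longlonglongrightarrow> 0" unfolding e_def by (rule LIMSEQ_Suc[OF lim_inverse_n', unfolded inverse_eq_divide])
    have s: "s k \<in> prob_simplex n" for k
      unfolding s_def using r(1) u(1) e[of k] by (intro prob_simplex_mix) auto
    have Ws: "Winf (s k) = of_real (1 - e k) \<cdot>\<^sub>m Winf r + of_real (e k) \<cdot>\<^sub>m Winf u" for k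
      unfolding s_def using r(1) u(1) e[of k] by (intro affine) auto
    have pd: "pos_def (Winf (s k))" for k
      unfolding Ws using pos_semidef_Winf[OF r(1)] Winf_carrier[OF u(1)] u(2) e by (rule pos_def_mix)
    have "mat_tendsto n n (\<lambda>k. Winf (s k)) (Winf r) sequentially"
    proof (rule mat_tendstoI)
      fix i j assume ij: "i < n" "j < n"
      have "(\<lambda>k. of_real (1 - e k) * Winf r $$ (i, j) + of_real (e k) * Winf u $$ (i, j)) \<longlonglongrightarrow>
          of_real (1 - 0) * Winf r $$ (i, j) + of_real 0 * Winf u $$ (i, j)"
        by (intro tendsto_intros e0)
      then show "(\<lambda>k. Winf (s k) $$ (i, j)) \<longlonglongrightarrow> Winf r $$ (i, j)"
        unfolding Ws using ij Winf_carrier[OF r(1)] Winf_carrier[OF u(1)] by simp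
    qed (rule Winf_carrier[OF s] Winf_carrier[OF r(1)])+
    from mat_tendsto_mult[OF mat_tendsto_mult[OF mat_tendsto_const[OF U_adjoint] this] mat_tendsto_const[OF U]]
    have N: "mat_tendsto m m (\<lambda>k. Wneg (s k)) (Wneg r) sequentially"
      unfolding Wneg_eq[OF s] Wneg_eq[OF r(1)] .
    have d: "det (Wneg r) \<noteq> 0" using pos_def_det_ne_0[OF Wneg[OF r(1)] r(2)] .
    obtain g where g: "mat_tendsto m m g (mat_inv (Wneg r)) sequentially"
      "\<forall>\<^sub>F k in sequentially. g k = mat_inv (Wneg (s k))"
      using mat_tendsto_mat_inv[OF N tendsto_imp_eventually_ne[OF mat_tendsto_det[OF N] d] d] by blast
    have lim: "(\<lambda>k. Re (mat_trace (mat_adjoint V * g k * V))) \<longlonglongrightarrow> AECS_limit r"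
      unfolding AECS_limit_def
      by (intro tendsto_Re mat_tendsto_trace[OF mat_tendsto_mult[OF mat_tendsto_mult[OF
            mat_tendsto_const[OF V_adjoint(1)] g(1)] mat_tendsto_const[OF V]]])
    have "\<forall>\<^sub>F k in sequentially. AECS_limit q \<le> Re (mat_trace (mat_adjoint V * g k * V))"
      using g(2)
    proof eventually_elim
      case (elim k)
      show ?case using AECS_cluster_optimal[OF p q qs s pd, of k] unfolding AECS_limit_def elim .
    qed
    from tendsto_lowerbound[OF lim this] show ?thesis by simp
  qed
  then show ?thesis
    using qs AECS_cluster_pos_def[OF p q qs] by (auto simp: minimizers_def is_arg_min_def not_less)
qed

end

section \<open>Block indices\<close>

lemma block_index_Cons:
  "block_index (k # ns) = map (Pair 0) [0..<k] @ map (map_prod Suc id) (block_index ns)"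
proof -
  have "[0..<length (k # ns)] = 0 # map Suc [0..<length ns]" by (simp add: upt_conv_Cons map_Suc_upt del: upt_Suc)
  then show ?thesis by (simp add: block_index_def map_concat o_def)
qed

lemma block_index_append:
  "block_index (ns @ ms) = block_index ns @ map (map_prod ((+) (length ns)) id) (block_index ms)"
  by (induction ns) (simp_all add: block_index_Cons block_index_def[of "[]"] o_def map_prod_def split_def)

lemma length_block_index: "length (block_index ns) = sum_list ns"
  by (induction ns) (simp_all add: block_index_Cons block_index_def[of "[]"])

lemma block_index_nth:
  "i < length ns \<Longrightarrow> a < ns ! i \<Longrightarrow> block_index ns ! (sum_list (take i ns) + a) = (i, a)"
proof (induction ns arbitrary: i)
  case (Cons k ns)
  show ?case
  proof (cases i)
    case 0
    then show ?thesis using Cons.prems by (simp add: block_index_Cons nth_append)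
  next
    case (Suc j)
    have "sum_list (take j ns) + a < sum_list ns"
    proof -
      have "sum_list ns = sum_list (take j ns) + sum_list (drop j ns)"
        by (metis append_take_drop_id sum_list_append)
      also have "drop j ns = ns ! j # drop (Suc j) ns" using Cons.prems Suc by (simp add: Cons_nth_drop_Suc)
      finally show ?thesis using Cons.prems Suc by simp
    qed
    then show ?thesis using Cons Suc by (simp add: block_index_Cons nth_append length_block_index)
  qed
qed simp

lemma block_index_less:
  fixes ns :: "nat list"
  assumes "i < length ns" "a < ns ! i"
  shows "sum_list (take i ns) + a < sum_list ns"
proof -
  have "sum_list ns = sum_list (take i ns) + sum_list (drop i ns)"
    by (metis append_take_drop_id sum_list_append)
  also have "drop i ns = ns ! i # drop (Suc i) ns" using assms by (simp add: Cons_nth_drop_Suc)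
  finally show ?thesis using assms by simp
qed

lemma block_index_cases:
  fixes ns :: "nat list"
  assumes "r < sum_list ns"
  obtains i a where "i < length ns" "a < ns ! i" "r = sum_list (take i ns) + a"
  using assms
proof (induction ns arbitrary: r thesis)
  case (Cons k ns)
  show ?case
  proof (cases "r < k")
    case True
    then show ?thesis using Cons.prems(1)[of 0 r] by simp
  next
    case False
    then have "r - k < sum_list ns" using Cons.prems(2) by simp
    then obtain i a where "i < length ns" "a < ns ! i" "r - k = sum_list (take i ns) + a"
      using Cons.IH by blast
    then show ?thesis using Cons.prems(1)[of "Suc i" a] False by simp
  qed
qed simp

lemma sum_list_take_mono: "i \<le> j \<Longrightarrow> sum_list (take i ns) \<le> sum_list (take j (ns :: nat list))"
  by (metis le_add1 le_add_diff_inverse sum_list_append take_add)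

lemma block_index_mono:
  fixes ns :: "nat list"
  assumes "i < length ns" "a < ns ! i" "sum_list (take j ns) + b \<le> sum_list (take i ns) + a"
  shows "j \<le> i"
proof (rule ccontr)
  assume "\<not> j \<le> i"
  then have "sum_list (take (Suc i) ns) \<le> sum_list (take j ns)" by (intro sum_list_take_mono) auto
  then show False using assms by (simp add: take_Suc_conv_app_nth)
qed

lemma diag_block_mat_nth:
  assumes "length As = length ns" "\<And>i. i < length ns \<Longrightarrow> As ! i \<in> carrier_mat (ns ! i) (ns ! i)"
  shows "diag_block_mat As \<in> carrier_mat (sum_list ns) (sum_list ns)"
    and "i < length ns \<Longrightarrow> a < ns ! i \<Longrightarrow> j < length ns \<Longrightarrow> b < ns ! j \<Longrightarrow>
      diag_block_mat As $$ (sum_list (take i ns) + a, sum_list (take j ns) + b) =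
      (if i = j then As ! i $$ (a, b) else 0)"
proof -
  \<comment> \<open>Size and entries are proved together, because the entries at the induction step
    depend on the size of the tail.\<close>
  have "diag_block_mat As \<in> carrier_mat (sum_list ns) (sum_list ns) \<and>
    (\<forall>i a j b. i < length ns \<longrightarrow> a < ns ! i \<longrightarrow> j < length ns \<longrightarrow> b < ns ! j \<longrightarrow>
      diag_block_mat As $$ (sum_list (take i ns) + a, sum_list (take j ns) + b) =
      (if i = j then As ! i $$ (a, b) else 0))"
    using assms
  proof (induction ns arbitrary: As)
    case (Cons k ns)
    then obtain A Bs where As: "As = A # Bs" "length Bs = length ns" by (cases As) auto
    have A: "A \<in> carrier_mat k k" using Cons.prems(2)[of 0] As by simp
    have Bi: "Bs ! i \<in> carrier_mat (ns ! i) (ns ! i)" if "i < length ns" for i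
      using Cons.prems(2)[of "Suc i"] As that by simp
    note IH = Cons.IH[OF As(2) Bi]
    let ?D = "diag_block_mat Bs"
    have D: "?D \<in> carrier_mat (sum_list ns) (sum_list ns)" using IH by simp
    have eq: "diag_block_mat As = four_block_mat A (0\<^sub>m k (sum_list ns)) (0\<^sub>m (sum_list ns) k) ?D"
      using A D by (auto simp: As Let_def)
    have "diag_block_mat As $$ (sum_list (take i (k # ns)) + a, sum_list (take j (k # ns)) + b) =
        (if i = j then As ! i $$ (a, b) else 0)"
      if ia: "i < length (k # ns)" "a < (k # ns) ! i" and jb: "j < length (k # ns)" "b < (k # ns) ! j" for i a j b
    proof -
      have less: "sum_list (take i ns) + a < sum_list ns" if "i < length ns" "a < ns ! i" for i a
        using that by (rule block_index_less)
      show ?thesis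
        using ia jb A D As less IH unfolding eq by (cases i; cases j) auto
    qed
    then show ?case using A D unfolding eq by auto
  qed simp
  then show "diag_block_mat As \<in> carrier_mat (sum_list ns) (sum_list ns)"
    and "i < length ns \<Longrightarrow> a < ns ! i \<Longrightarrow> j < length ns \<Longrightarrow> b < ns ! j \<Longrightarrow>
      diag_block_mat As $$ (sum_list (take i ns) + a, sum_list (take j ns) + b) =
      (if i = j then As ! i $$ (a, b) else 0)" by blast+
qed

lemma block_mat_nth:
  assumes "i < length ns" "a < ns ! i" "j < length ns" "b < ns ! j"
  shows "block_mat ns F $$ (sum_list (take i ns) + a, sum_list (take j ns) + b) = F i j $$ (a, b)"
  using assms block_index_less[of i ns a] block_index_less[of j ns b]
  by (simp add: block_mat_def block_index_nth)

section \<open>Rows of a Jordan matrix in block coordinates\<close>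

definition block_no :: "jordan_blocks \<Rightarrow> nat \<Rightarrow> nat" where
  "block_no bs r = fst (block_index (map fst bs) ! r)"

definition row_eigenvalue :: "jordan_blocks \<Rightarrow> nat \<Rightarrow> complex" where
  "row_eigenvalue bs r = snd (bs ! block_no bs r)"

text \<open>Zero on the last row of a block; it equals the exponent \<open>k - 1 - a\<close> that
  appears in \<open>C_mat\<close>.\<close>

definition rows_below :: "jordan_blocks \<Rightarrow> nat \<Rightarrow> nat" where
  "rows_below bs r = fst (bs ! block_no bs r) - 1 - snd (block_index (map fst bs) ! r)"

lemma total_size_append: "total_size (xs @ ys) = total_size xs + total_size ys"
  by (simp add: total_size_def)

lemma row_cases:
  assumes "r < total_size bs"
  obtains i a where "i < length bs" "a < fst (bs ! i)" "r = total_size (take i bs) + a"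
    "block_no bs r = i" "row_eigenvalue bs r = snd (bs ! i)" "rows_below bs r = fst (bs ! i) - 1 - a"
proof -
  obtain i a where i: "i < length (map fst bs)" "a < map fst bs ! i" "r = sum_list (take i (map fst bs)) + a"
    using assms block_index_cases unfolding total_size_def by blast
  from block_index_nth[OF i(1,2)] have "block_index (map fst bs) ! r = (i, a)" by (simp add: i(3))
  then show ?thesis using i
    by (intro that[of i a])
      (auto simp: total_size_def take_map block_no_def row_eigenvalue_def rows_below_def)
qed

lemma row_nth:
  assumes "i < length bs" "a < fst (bs ! i)"
  shows "total_size (take i bs) + a < total_size bs" "block_no bs (total_size (take i bs) + a) = i"
    "row_eigenvalue bs (total_size (take i bs) + a) = snd (bs ! i)"
    "rows_below bs (total_size (take i bs) + a) = fst (bs ! i) - 1 - a"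
  using block_index_nth[of i "map fst bs" a] block_index_less[of i "map fst bs" a] assms
  by (auto simp: total_size_def take_map block_no_def row_eigenvalue_def rows_below_def)

lemma jordan_scaling_blocks:
  "jordan_scaling (total_size bs) (row_eigenvalue bs) (block_no bs) (rows_below bs)"
proof
  fix r s
  show "block_no bs r \<le> block_no bs s" if rs: "r \<le> s" "s < total_size bs"
  proof -
    have "r < total_size bs" using rs by simp
    then obtain i a where i: "i < length bs" "a < fst (bs ! i)" "r = total_size (take i bs) + a" "block_no bs r = i"
      by (rule row_cases)
    obtain j b where j: "j < length bs" "b < fst (bs ! j)" "s = total_size (take j bs) + b" "block_no bs s = j"
      using rs(2) by (rule row_cases)
    show ?thesis
      using block_index_mono[of j "map fst bs" b i a] i j rs(1) by (simp add: total_size_def take_map)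
  qed
  show "row_eigenvalue bs r = row_eigenvalue bs s" if "block_no bs r = block_no bs s"
    using that by (simp add: row_eigenvalue_def)
  show "rows_below bs r = rows_below bs s + (s - r)"
    if rs: "r \<le> s" "s < total_size bs" "block_no bs r = block_no bs s"
  proof -
    have "r < total_size bs" using rs by simp
    then obtain i a where i: "i < length bs" "a < fst (bs ! i)" "r = total_size (take i bs) + a" "block_no bs r = i"
      "rows_below bs r = fst (bs ! i) - 1 - a" by (rule row_cases)
    obtain j b where j: "j < length bs" "b < fst (bs ! j)" "s = total_size (take j bs) + b" "block_no bs s = j"
      "rows_below bs s = fst (bs ! j) - 1 - b" using rs(2) by (rule row_cases)
    show ?thesis using i j rs by auto
  qed
next
  fix r assume "r < total_size bs"
  then obtain i a where i: "i < length bs" "a < fst (bs ! i)" "r = total_size (take i bs) + a" "block_no bs r = i"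
      "rows_below bs r = fst (bs ! i) - 1 - a" by (rule row_cases)
  then have eq: "r + rows_below bs r = total_size (take i bs) + (fst (bs ! i) - 1)" by simp
  show "r + rows_below bs r < total_size bs" "block_no bs (r + rows_below bs r) = block_no bs r"
    unfolding eq using row_nth[of i bs "fst (bs ! i) - 1"] i by auto
qed

lemma jordan_index_blocks: "jordan_index (total_size bs) (row_eigenvalue bs) (block_no bs)"
  using jordan_scaling_blocks by (simp add: jordan_scaling_def)

lemma jordan_matrix_eq_jmat:
  "jordan_matrix bs = jordan_index.jmat (total_size bs) (row_eigenvalue bs) (block_no bs)"
proof -
  interpret jordan_index "total_size bs" "row_eigenvalue bs" "block_no bs" by (rule jordan_index_blocks)
  show ?thesis
  proof (rule eq_matI)
    fix r s assume "r < dim_row jmat" "s < dim_col jmat"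
    then have rs: "r < total_size bs" "s < total_size bs" by (auto simp: jmat_def)
    obtain i a where i: "i < length bs" "a < fst (bs ! i)" "r = total_size (take i bs) + a" "block_no bs r = i"
      "row_eigenvalue bs r = snd (bs ! i)" using rs(1) by (rule row_cases)
    obtain j b where j: "j < length bs" "b < fst (bs ! j)" "s = total_size (take j bs) + b" "block_no bs s = j"
      using rs(2) by (rule row_cases)
    have "jordan_matrix bs $$ (r, s) = (if i = j then jordan_block (fst (bs ! i)) (snd (bs ! i)) $$ (a, b) else 0)"
      unfolding jordan_matrix_def i(3) j(3) total_size_def take_map[symmetric]
      using i j by (subst diag_block_mat_nth(2)) (auto simp: split_def)
    also have "\<dots> = jmat $$ (r, s)"
      using i j rs by (auto simp: jmat_def)
    finally show "jordan_matrix bs $$ (r, s) = jmat $$ (r, s)" .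
  qed (use jmat_carrier jordan_matrix_carrier[of bs] in \<open>auto simp del: jmat_carrier simp: total_size_def\<close>)
qed

lemma block_index_append_nth:
  "r < total_size xs \<Longrightarrow> block_index (map fst (xs @ ys)) ! r = block_index (map fst xs) ! r"
  "r < total_size ys \<Longrightarrow> block_index (map fst (xs @ ys)) ! (total_size xs + r) =
    map_prod ((+) (length xs)) id (block_index (map fst ys) ! r)"
  by (simp_all add: block_index_append nth_append length_block_index total_size_def)

lemma block_no_less: "r < total_size bs \<Longrightarrow> block_no bs r < length bs"
  by (metis row_cases)

lemma append_rows_left:
  assumes "r < total_size xs"
  shows "block_no (xs @ ys) r = block_no xs r" "row_eigenvalue (xs @ ys) r = row_eigenvalue xs r"
    "rows_below (xs @ ys) r = rows_below xs r"
proof -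
  show *: "block_no (xs @ ys) r = block_no xs r"
    using block_index_append_nth(1)[OF assms] by (simp add: block_no_def)
  show "row_eigenvalue (xs @ ys) r = row_eigenvalue xs r" "rows_below (xs @ ys) r = rows_below xs r"
    using block_index_append_nth(1)[OF assms] block_no_less[OF assms]
    by (simp_all add: row_eigenvalue_def rows_below_def * nth_append)
qed

lemma append_rows_right:
  assumes "r < total_size ys"
  shows "block_no (xs @ ys) (total_size xs + r) = length xs + block_no ys r"
    "row_eigenvalue (xs @ ys) (total_size xs + r) = row_eigenvalue ys r"
    "rows_below (xs @ ys) (total_size xs + r) = rows_below ys r"
proof -
  show *: "block_no (xs @ ys) (total_size xs + r) = length xs + block_no ys r"
    using block_index_append_nth(2)[OF assms] by (simp add: block_no_def)
  show "row_eigenvalue (xs @ ys) (total_size xs + r) = row_eigenvalue ys r"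
    "rows_below (xs @ ys) (total_size xs + r) = rows_below ys r"
    using block_index_append_nth(2)[OF assms]
    by (simp_all add: row_eigenvalue_def rows_below_def *)
qed

text \<open>Sortedness makes equal values contiguous, and the least value comes first in both lists.
  Applied to the imaginary parts, this cuts the imaginary blocks into consecutive groups with a
  common eigenvalue.\<close>

lemma concat_filter_sorted:
  "sorted (map f xs) \<Longrightarrow>
    concat (map (\<lambda>v. filter (\<lambda>x. f x = v) xs) (sorted_list_of_set (f ` set xs))) = xs"
proof (induction xs)
  case (Cons x xs)
  let ?S = "f ` set xs"
  let ?L = "sorted_list_of_set (?S - {f x})"
  have le: "f x \<le> f y" if "y \<in> set xs" for y using Cons.prems that by simp
  have "Min (insert (f x) ?S) = f x" using le by (intro Min_eqI) auto
  then have S: "sorted_list_of_set (f ` set (x # xs)) = f x # ?L"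
    by (simp add: sorted_list_of_set_nonempty)
  have L: "map (\<lambda>v. filter (\<lambda>y. f y = v) (x # xs)) ?L = map (\<lambda>v. filter (\<lambda>y. f y = v) xs) ?L"
    by (intro map_cong refl) auto
  have IH: "concat (map (\<lambda>v. filter (\<lambda>y. f y = v) xs) (sorted_list_of_set ?S)) = xs"
    using Cons by simp
  have "filter (\<lambda>y. f y = f x) xs @ concat (map (\<lambda>v. filter (\<lambda>y. f y = v) xs) ?L) = xs"
  proof (cases "f x \<in> ?S")
    case True
    have "Min ?S = f x" using le True by (intro Min_eqI) auto
    then have "sorted_list_of_set ?S = f x # ?L" using True by (subst sorted_list_of_set_nonempty) auto
    then show ?thesis using IH by simp
  next
    case False
    then have "filter (\<lambda>y. f y = f x) xs = []" unfolding filter_empty_conv by (metis imageI)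
    moreover have "?S - {f x} = ?S" using False by auto
    ultimately show ?thesis using IH by simp
  qed
  then show ?case unfolding S list.map L by simp
qed simp

section \<open>The limit of the scaled Gramian\<close>

text \<open>\<open>jmat\<close> uses block numbers only through equality, so blocks may be
  renumbered. The numbers inherited from \<open>bs\<close> differ by a shift from those of a
  sublist.\<close>

lemma jmat_cong:
  assumes 1: "jordan_index n l b" and 2: "jordan_index n l' b'"
    and l: "\<And>r. r < n \<Longrightarrow> l r = l' r"
    and b: "\<And>r s. r < n \<Longrightarrow> s < n \<Longrightarrow> b r = b s \<longleftrightarrow> b' r = b' s"
  shows "jordan_index.jmat n l b = jordan_index.jmat n l' b'"
  unfolding jordan_index.jmat_def[OF 1] jordan_index.jmat_def[OF 2]
  by (rule eq_matI) (auto simp: l b)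

lemma diag_of_vec_carrier: "p \<in> carrier_vec n \<Longrightarrow> map_mat complex_of_real (diag_of_vec p) \<in> carrier_mat n n"
  by (auto simp: diag_of_vec_def mat_diag_def)

lemma sub_block_carrier: "sub_block R i j k l \<in> carrier_mat k l"
  by (simp add: sub_block_def)

lemma total_size_concat: "total_size (concat xss) = sum_list (map total_size xss)"
  by (induction xss) (simp_all add: total_size_append, simp add: total_size_def)

locale jordan_gramian =
  fixes A :: "real mat" and Q :: "complex mat" and bs :: jordan_blocks and n :: nat
  assumes A: "A \<in> carrier_mat n n" and jordan: "ordered_jordan_decomposition A Q bs"
begin

abbreviation Qi :: "complex mat" where "Qi \<equiv> mat_inv Q"

abbreviation n_neg :: nat where "n_neg \<equiv> total_size (neg_blocks bs)"
abbreviation n_zero :: nat where "n_zero \<equiv> total_size (zero_blocks bs)"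
abbreviation n_pos :: nat where "n_pos \<equiv> total_size (pos_blocks bs)"

abbreviation lam :: "nat \<Rightarrow> complex" where "lam \<equiv> row_eigenvalue bs"
abbreviation h :: "nat \<Rightarrow> nat" where "h \<equiv> rows_below bs"

lemma Q: "Q \<in> carrier_mat n n" and inv_Q: "invertible_mat Q"
  and J: "Qi * map_mat complex_of_real A * Q = jordan_matrix bs"
  and bs_split: "bs = neg_blocks bs @ zero_blocks bs @ pos_blocks bs"
  and zero_sorted: "sorted (map (\<lambda>(k, \<mu>). Im \<mu>) (zero_blocks bs))"
  using jordan A unfolding ordered_jordan_decomposition_def by auto

lemma Qi: "Qi \<in> carrier_mat n n" "Qi * Q = 1\<^sub>m n" "Q * Qi = 1\<^sub>m n"
  using mat_inv[OF Q inv_Q] .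

lemma total_size_bs: "total_size bs = n"
proof -
  have "dim_row (jordan_matrix bs) = n" unfolding J[symmetric] using Qi(1) by simp
  then show ?thesis by (simp add: total_size_def)
qed

lemma n_split: "n = n_neg + n_zero + n_pos"
  using total_size_bs arg_cong[OF bs_split, of total_size] by (simp add: total_size_append)

sublocale jordan_scaling n "row_eigenvalue bs" "block_no bs" "rows_below bs"
  using jordan_scaling_blocks[of bs] unfolding total_size_bs .

lemma jordan_matrix_bs: "jordan_matrix bs = jmat"
  using jordan_matrix_eq_jmat[of bs] unfolding total_size_bs .

lemma rows_neg:
  assumes "r < n_neg"
  shows "block_no bs r = block_no (neg_blocks bs) r" "lam r = row_eigenvalue (neg_blocks bs) r"
    "Re (lam r) < 0"
proof -
  show 1: "block_no bs r = block_no (neg_blocks bs) r" "lam r = row_eigenvalue (neg_blocks bs) r"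
    using append_rows_left[OF assms, of "zero_blocks bs @ pos_blocks bs"] bs_split by simp_all
  obtain i where "i < length (neg_blocks bs)" "lam r = snd (neg_blocks bs ! i)"
    using row_cases[OF assms] 1(2) by metis
  then show "Re (lam r) < 0" using nth_mem[of i "neg_blocks bs"] by (auto simp: neg_blocks_def)
qed

lemma rows_zero:
  assumes "x < n_zero"
  shows "block_no bs (n_neg + x) = length (neg_blocks bs) + block_no (zero_blocks bs) x"
    "lam (n_neg + x) = row_eigenvalue (zero_blocks bs) x" "Re (lam (n_neg + x)) = 0"
proof -
  have x: "x < total_size (zero_blocks bs @ pos_blocks bs)" using assms by (simp add: total_size_append)
  show 1: "block_no bs (n_neg + x) = length (neg_blocks bs) + block_no (zero_blocks bs) x"
    "lam (n_neg + x) = row_eigenvalue (zero_blocks bs) x"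
    using append_rows_right[OF x, of "neg_blocks bs"] append_rows_left[OF assms, of "pos_blocks bs"] bs_split
    by simp_all
  obtain i where "i < length (zero_blocks bs)" "lam (n_neg + x) = snd (zero_blocks bs ! i)"
    using row_cases[OF assms] 1(2) by metis
  then show "Re (lam (n_neg + x)) = 0" using nth_mem[of i "zero_blocks bs"] by (auto simp: zero_blocks_def)
qed

lemma rows_pos:
  assumes "x < n_pos"
  shows "block_no bs (n_neg + n_zero + x) = length (neg_blocks bs @ zero_blocks bs) + block_no (pos_blocks bs) x"
    "lam (n_neg + n_zero + x) = row_eigenvalue (pos_blocks bs) x" "Re (lam (n_neg + n_zero + x)) > 0"
proof -
  show 1: "block_no bs (n_neg + n_zero + x) = length (neg_blocks bs @ zero_blocks bs) + block_no (pos_blocks bs) x"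
    "lam (n_neg + n_zero + x) = row_eigenvalue (pos_blocks bs) x"
    using append_rows_right[OF assms, of "neg_blocks bs @ zero_blocks bs"] bs_split
    by (simp_all add: total_size_append)
  obtain i where "i < length (pos_blocks bs)" "lam (n_neg + n_zero + x) = snd (pos_blocks bs ! i)"
    using row_cases[OF assms] 1(2) by metis
  then show "Re (lam (n_neg + n_zero + x)) > 0" using nth_mem[of i "pos_blocks bs"] by (auto simp: pos_blocks_def)
qed

lemma row_sign:
  assumes "r < n"
  shows "Re (lam r) < 0 \<longleftrightarrow> r < n_neg" "Re (lam r) > 0 \<longleftrightarrow> n_neg + n_zero \<le> r"
proof -
  consider "r < n_neg" | "n_neg \<le> r" "r - n_neg < n_zero" | "n_neg + n_zero \<le> r" "r - (n_neg + n_zero) < n_pos"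
    using assms n_split by linarith
  then have "(Re (lam r) < 0 \<longleftrightarrow> r < n_neg) \<and> (Re (lam r) > 0 \<longleftrightarrow> n_neg + n_zero \<le> r)"
  proof cases
    case 1
    then show ?thesis using rows_neg(3)[OF 1] by simp
  next
    case 2
    then show ?thesis using rows_zero(3)[OF 2(2)] by simp
  next
    case 3
    then show ?thesis using rows_pos(3)[OF 3(2)] by simp
  qed
  then show "Re (lam r) < 0 \<longleftrightarrow> r < n_neg" "Re (lam r) > 0 \<longleftrightarrow> n_neg + n_zero \<le> r" by auto
qed

lemma B_tilde_carrier: "p \<in> carrier_vec n \<Longrightarrow> B_tilde Q p \<in> carrier_mat n n"
  unfolding B_tilde_def using Qi(1) diag_of_vec_carrier by (intro mult_carrier_mat[of _ n n]) auto

lemma jordan_index_neg: "jordan_index n_neg lam (block_no bs)"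
  using n_split by unfold_locales (auto intro: bid_mono lam_eq)

lemma jmat_neg: "jordan_matrix (neg_blocks bs) = jordan_index.jmat n_neg lam (block_no bs)"
  unfolding jordan_matrix_eq_jmat
  by (rule jmat_cong[OF jordan_index_blocks jordan_index_neg]) (simp_all add: rows_neg)

lemma jordan_index_pos:
  "jordan_index n_pos (\<lambda>r. lam (n_neg + n_zero + r)) (\<lambda>r. block_no bs (n_neg + n_zero + r))"
  using n_split by unfold_locales (auto intro: bid_mono lam_eq)

lemma jmat_pos: "jordan_matrix (pos_blocks bs) =
    jordan_index.jmat n_pos (\<lambda>r. lam (n_neg + n_zero + r)) (\<lambda>r. block_no bs (n_neg + n_zero + r))"
  unfolding jordan_matrix_eq_jmat
  by (rule jmat_cong[OF jordan_index_blocks jordan_index_pos]) (simp_all add: rows_pos)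

lemma W_neg_carrier: "W_neg Q bs p \<in> carrier_mat n_neg n_neg"
proof -
  interpret sub: jordan_index n_neg lam "block_no bs" by (rule jordan_index_neg)
  show ?thesis
    unfolding W_neg_def Let_def jmat_neg
    using mat_tendstoD(2)[OF sub.lyapunov_sol_stable[OF _ sub_block_carrier]] rows_neg(3) by blast
qed

lemma W_pos_carrier: "W_pos Q bs p \<in> carrier_mat n_pos n_pos"
proof -
  interpret sub: jordan_index n_pos "\<lambda>r. lam (n_neg + n_zero + r)" "\<lambda>r. block_no bs (n_neg + n_zero + r)"
    by (rule jordan_index_pos)
  show ?thesis
    unfolding W_pos_def Let_def jmat_pos
    using mat_tendstoD(2)[OF sub.lyapunov_sol_antistable[OF _ sub_block_carrier]] rows_pos(3) by blast
qed

lemma W_neg_limit: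
  assumes "p \<in> carrier_vec n" "r < n_neg" "s < n_neg"
  shows "((\<lambda>T. scaled_gram (B_tilde Q p) T $$ (r, s)) \<longlongrightarrow> W_neg Q bs p $$ (r, s)) at_top"
  unfolding W_neg_def Let_def jmat_neg
  using n_split row_sign(1) assms by (intro scaled_gram_neg B_tilde_carrier) auto

lemma W_pos_limit:
  assumes "p \<in> carrier_vec n" "r < n_pos" "s < n_pos"
  shows "((\<lambda>T. scaled_gram (B_tilde Q p) T $$ (n_neg + n_zero + r, n_neg + n_zero + s)) \<longlongrightarrow>
    W_pos Q bs p $$ (r, s)) at_top"
  unfolding W_pos_def Let_def jmat_pos
  by (rule scaled_gram_pos[OF B_tilde_carrier[OF assms(1)] n_split row_sign(2) assms(2,3)])

section \<open>Groups of equal imaginary eigenvalues\<close>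

definition eig_group :: "nat \<Rightarrow> jordan_blocks" where
  "eig_group l = filter (\<lambda>(k, \<nu>). \<nu> = imag_eigenvalues bs ! l) bs"

abbreviation n_groups :: nat where "n_groups \<equiv> length (imag_eigenvalues bs)"

text \<open>The initial segment of \<open>bs\<close> that precedes group \<open>l\<close>; its
  length is \<open>group_start bs l\<close>.\<close>

definition before_group :: "nat \<Rightarrow> jordan_blocks" where
  "before_group l = neg_blocks bs @ concat (map eig_group [0..<l])"

lemma distinct_imag_eigenvalues: "distinct (imag_eigenvalues bs)"
  by (simp add: imag_eigenvalues_def distinct_map inj_on_def)

text \<open>For vanishing real part the imaginary part determines the eigenvalue, so the level sets
  of \<open>Im\<close> in the sorted list are the groups.\<close>

lemma zero_blocks_concat: "zero_blocks bs = concat (map eig_group [0..<n_groups])"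
proof -
  let ?vs = "sorted_list_of_set ((\<lambda>(k, \<mu>). Im \<mu>) ` set (zero_blocks bs))"
  have im: "(\<lambda>(k, \<mu>). Im \<mu>) ` set (zero_blocks bs) = Im ` snd ` set (zero_blocks bs)"
    by (simp add: image_image split_def)
  have "zero_blocks bs = concat (map (\<lambda>v. filter (\<lambda>x. (case x of (k, \<mu>) \<Rightarrow> Im \<mu>) = v) (zero_blocks bs)) ?vs)"
    using concat_filter_sorted[OF zero_sorted] by simp
  also have "map (\<lambda>v. filter (\<lambda>x. (case x of (k, \<mu>) \<Rightarrow> Im \<mu>) = v) (zero_blocks bs)) ?vs =
      map (\<lambda>\<mu>. filter (\<lambda>(k, \<nu>). \<nu> = \<mu>) bs) (imag_eigenvalues bs)"
    unfolding imag_eigenvalues_def im map_map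
    by (intro map_cong refl) (auto simp: zero_blocks_def complex_eq_iff intro!: filter_cong)
  also have "\<dots> = map eig_group [0..<n_groups]"
    by (rule nth_equalityI) (simp_all add: eig_group_def)
  finally show ?thesis .
qed

lemma bs_group_split:
  assumes l: "l < n_groups"
  obtains post where "bs = before_group l @ eig_group l @ post"
proof -
  have "[0..<n_groups] = [0..<l] @ l # [Suc l..<n_groups]"
    using l upt_add_eq_append[of 0 l "n_groups - l"] by (simp add: upt_conv_Cons)
  then have "zero_blocks bs = concat (map eig_group [0..<l]) @ eig_group l @ concat (map eig_group [Suc l..<n_groups])"
    using zero_blocks_concat by simp
  then show ?thesis using that bs_split unfolding before_group_def by simp
qed

lemma group_start_eq: "group_start bs l = length (before_group l)"
proof -
  have "(\<Sum>r<l. block_count bs (imag_eigenvalues bs ! r)) = length (concat (map eig_group [0..<l]))"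
    by (induction l) (simp_all add: block_count_def eig_group_def)
  then show ?thesis by (simp add: group_start_def before_group_def)
qed

abbreviation group_sizes :: "nat list" where
  "group_sizes \<equiv> map (\<lambda>l. total_size (eig_group l)) [0..<n_groups]"

lemma sum_group_sizes: "sum_list group_sizes = n_zero"
  unfolding zero_blocks_concat total_size_concat by (simp add: o_def)

lemma total_size_before_group:
  "l \<le> n_groups \<Longrightarrow> total_size (before_group l) = n_neg + sum_list (take l group_sizes)"
  by (simp add: before_group_def total_size_append total_size_concat take_map o_def)

lemma W_zero_group_eq:
  assumes l: "l < n_groups"
  shows "W_zero_group Q bs p l = block_mat (map fst (eig_group l))
    (\<lambda>i j. b_corner Q bs p (length (before_group l) + i) (length (before_group l) + j) \<cdot>\<^sub>m
      map_mat complex_of_real (C_mat (fst (bs ! (length (before_group l) + i)))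
        (fst (bs ! (length (before_group l) + j)))))"
proof -
  obtain post where "bs = before_group l @ eig_group l @ post" using l by (rule bs_group_split)
  then have "take (length (eig_group l)) (drop (length (before_group l)) bs) = eig_group l"
    by (metis append_eq_conv_conj)
  then show ?thesis
    by (simp add: W_zero_group_def Let_def group_start_eq block_count_def flip: eig_group_def)
qed

lemma W_zero_group_carrier:
  "l < n_groups \<Longrightarrow> W_zero_group Q bs p l \<in> carrier_mat (total_size (eig_group l)) (total_size (eig_group l))"
  by (simp add: W_zero_group_eq block_mat_def total_size_def)

lemma W_zero_carrier: "W_zero Q bs p \<in> carrier_mat n_zero n_zero"
  unfolding W_zero_def sum_group_sizes[symmetric]
  by (rule diag_block_mat_nth(1)) (simp_all add: W_zero_group_carrier)

text \<open>A row is located by its group \<open>l\<close>, its block \<open>i\<close> inside the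
  group and its offset \<open>a\<close> inside the block. The last equation finds the end of the
  block, where \<open>b_corner\<close> takes its entry.\<close>

lemma zero_row_cases:
  assumes "x < n_zero"
  obtains l i a where "l < n_groups" "i < length (eig_group l)" "a < fst (eig_group l ! i)"
    "x = sum_list (take l group_sizes) + (total_size (take i (eig_group l)) + a)"
    "total_size (take i (eig_group l)) + a < total_size (eig_group l)"
    "lam (n_neg + x) = imag_eigenvalues bs ! l"
    "h (n_neg + x) = fst (eig_group l ! i) - 1 - a"
    "bs ! (length (before_group l) + i) = eig_group l ! i"
    "n_neg + x + h (n_neg + x) =
      total_size (take (length (before_group l) + i) bs) + (fst (eig_group l ! i) - 1)"
proof -
  from assms have "x < sum_list group_sizes" unfolding sum_group_sizes .
  then obtain l y where l: "l < n_groups" "y < total_size (eig_group l)" "x = sum_list (take l group_sizes) + y"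
    by (rule block_index_cases) simp
  obtain i a where i: "i < length (eig_group l)" "a < fst (eig_group l ! i)"
    "y = total_size (take i (eig_group l)) + a" "block_no (eig_group l) y = i"
    "row_eigenvalue (eig_group l) y = snd (eig_group l ! i)"
    "rows_below (eig_group l) y = fst (eig_group l ! i) - 1 - a"
    using l(2) by (rule row_cases)
  obtain post where post: "bs = before_group l @ eig_group l @ post" using l(1) by (rule bs_group_split)
  have nx: "n_neg + x = total_size (before_group l) + y"
    using total_size_before_group[of l] l by simp
  have y: "y < total_size (eig_group l @ post)" using l(2) by (simp add: total_size_append)
  have lamx: "lam (n_neg + x) = snd (eig_group l ! i)" and hx: "h (n_neg + x) = fst (eig_group l ! i) - 1 - a"
    using append_rows_right[OF y, of "before_group l"] append_rows_left[OF l(2), of post] i post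
    unfolding nx by simp_all
  have "eig_group l ! i \<in> set (eig_group l)" using i(1) by simp
  then have mu: "snd (eig_group l ! i) = imag_eigenvalues bs ! l" by (auto simp: eig_group_def)
  have nth: "bs ! (length (before_group l) + i) = eig_group l ! i"
    by (subst post) (use i(1) in \<open>simp add: nth_append\<close>)
  have "take (length (before_group l) + i) bs = before_group l @ take i (eig_group l)"
    by (subst post) (use i(1) in simp)
  then have "n_neg + x + h (n_neg + x) =
      total_size (take (length (before_group l) + i) bs) + (fst (eig_group l ! i) - 1)"
    using nx hx i by (simp add: total_size_append)
  then show ?thesis using that[of l i a] l i lamx hx mu nth by simp
qed

lemma b_corner_index:
  assumes "fst (bs ! i) \<ge> 1" "fst (bs ! j) \<ge> 1"
  shows "b_corner Q bs p i j = B_tilde Q p $$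
    (total_size (take i bs) + (fst (bs ! i) - 1), total_size (take j bs) + (fst (bs ! j) - 1))"
  using assms by (simp add: b_corner_def B_block_def sub_block_def)

text \<open>The nested block definition rewritten in global row indices, in the shape of the limit
  in \<open>scaled_gram_zero\<close>.\<close>

lemma W_zero_index:
  assumes "x < n_zero" "y < n_zero"
  shows "W_zero Q bs p $$ (x, y) = (if lam (n_neg + x) = lam (n_neg + y) then
    B_tilde Q p $$ (n_neg + x + h (n_neg + x), n_neg + y + h (n_neg + y)) /
      (fact (h (n_neg + x)) * fact (h (n_neg + y)) * of_nat (h (n_neg + x) + h (n_neg + y) + 1)) else 0)"
proof -
  obtain l i a where x: "l < n_groups" "i < length (eig_group l)" "a < fst (eig_group l ! i)"
    "x = sum_list (take l group_sizes) + (total_size (take i (eig_group l)) + a)"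
    "total_size (take i (eig_group l)) + a < total_size (eig_group l)"
    "lam (n_neg + x) = imag_eigenvalues bs ! l"
    "h (n_neg + x) = fst (eig_group l ! i) - 1 - a"
    "bs ! (length (before_group l) + i) = eig_group l ! i"
    "n_neg + x + h (n_neg + x) =
      total_size (take (length (before_group l) + i) bs) + (fst (eig_group l ! i) - 1)"
    using assms(1) by (rule zero_row_cases)
  obtain l' j b where y: "l' < n_groups" "j < length (eig_group l')" "b < fst (eig_group l' ! j)"
    "y = sum_list (take l' group_sizes) + (total_size (take j (eig_group l')) + b)"
    "total_size (take j (eig_group l')) + b < total_size (eig_group l')"
    "lam (n_neg + y) = imag_eigenvalues bs ! l'"
    "h (n_neg + y) = fst (eig_group l' ! j) - 1 - b"
    "bs ! (length (before_group l') + j) = eig_group l' ! j"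
    "n_neg + y + h (n_neg + y) =
      total_size (take (length (before_group l') + j) bs) + (fst (eig_group l' ! j) - 1)"
    using assms(2) by (rule zero_row_cases)
  have ll: "lam (n_neg + x) = lam (n_neg + y) \<longleftrightarrow> l = l'"
    using x(1,6) y(1,6) distinct_imag_eigenvalues by (simp add: nth_eq_iff_index_eq)
  have "W_zero Q bs p $$ (x, y) =
      (if l = l' then map (W_zero_group Q bs p) [0..<n_groups] ! l $$
        (total_size (take i (eig_group l)) + a, total_size (take j (eig_group l')) + b) else 0)"
    unfolding W_zero_def x(4) y(4)
    by (rule diag_block_mat_nth(2)) (use x(1,5) y(1,5) in \<open>simp_all add: W_zero_group_carrier\<close>)
  also have "\<dots> = (if lam (n_neg + x) = lam (n_neg + y) then
    B_tilde Q p $$ (n_neg + x + h (n_neg + x), n_neg + y + h (n_neg + y)) /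
      (fact (h (n_neg + x)) * fact (h (n_neg + y)) * of_nat (h (n_neg + x) + h (n_neg + y) + 1)) else 0)"
  proof (cases "l = l'")
    case True
    note y' = y[folded True]
    let ?\<alpha> = "length (before_group l)"
    have "W_zero_group Q bs p l $$ (total_size (take i (eig_group l)) + a, total_size (take j (eig_group l)) + b) =
        (b_corner Q bs p (?\<alpha> + i) (?\<alpha> + j) \<cdot>\<^sub>m map_mat complex_of_real
          (C_mat (fst (bs ! (?\<alpha> + i))) (fst (bs ! (?\<alpha> + j))))) $$ (a, b)"
      unfolding W_zero_group_eq[OF x(1)] total_size_def take_map[symmetric]
      by (rule block_mat_nth) (use x(2,3) y'(2,3) in simp_all)
    also have "\<dots> = b_corner Q bs p (?\<alpha> + i) (?\<alpha> + j) *
        of_real (1 / (fact (h (n_neg + x)) * fact (h (n_neg + y)) * real (h (n_neg + x) + h (n_neg + y) + 1)))"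
      using x(3,7) y'(3,7) by (simp add: C_mat_def x(8) y'(8))
    also have "b_corner Q bs p (?\<alpha> + i) (?\<alpha> + j) =
        B_tilde Q p $$ (n_neg + x + h (n_neg + x), n_neg + y + h (n_neg + y))"
      using x(3) y'(3) by (subst b_corner_index) (simp_all add: x(8,9) y'(8,9))
    finally have "W_zero_group Q bs p l $$ (total_size (take i (eig_group l)) + a, total_size (take j (eig_group l)) + b) =
      B_tilde Q p $$ (n_neg + x + h (n_neg + x), n_neg + y + h (n_neg + y)) /
      (fact (h (n_neg + x)) * fact (h (n_neg + y)) * of_nat (h (n_neg + x) + h (n_neg + y) + 1))"
      by simp
    then show ?thesis using True x(1) ll by simp
  qed (use ll in simp)
  finally show ?thesis .
qed

lemma W_inf_carrier: "W_inf Q bs p \<in> carrier_mat n n"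
  and W_inf_index: "i < 3 \<Longrightarrow> a < [n_neg, n_zero, n_pos] ! i \<Longrightarrow> j < 3 \<Longrightarrow> b < [n_neg, n_zero, n_pos] ! j \<Longrightarrow>
    W_inf Q bs p $$ (sum_list (take i [n_neg, n_zero, n_pos]) + a, sum_list (take j [n_neg, n_zero, n_pos]) + b) =
    (if i = j then [W_neg Q bs p, W_zero Q bs p, W_pos Q bs p] ! i $$ (a, b) else 0)"
proof -
  have c: "[W_neg Q bs p, W_zero Q bs p, W_pos Q bs p] ! i \<in>
      carrier_mat ([n_neg, n_zero, n_pos] ! i) ([n_neg, n_zero, n_pos] ! i)"
    if "i < length [n_neg, n_zero, n_pos]" for i
    using that W_neg_carrier W_zero_carrier W_pos_carrier by (auto simp: less_Suc_eq)
  have l: "length [W_neg Q bs p, W_zero Q bs p, W_pos Q bs p] = length [n_neg, n_zero, n_pos]" by simp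
  show "W_inf Q bs p \<in> carrier_mat n n"
    using diag_block_mat_nth(1)[OF l c] n_split by (simp add: W_inf_def add.assoc del: diag_block_mat.simps)
  show "W_inf Q bs p $$ (sum_list (take i [n_neg, n_zero, n_pos]) + a, sum_list (take j [n_neg, n_zero, n_pos]) + b) =
    (if i = j then [W_neg Q bs p, W_zero Q bs p, W_pos Q bs p] ! i $$ (a, b) else 0)"
    if "i < 3" "a < [n_neg, n_zero, n_pos] ! i" "j < 3" "b < [n_neg, n_zero, n_pos] ! j"
    unfolding W_inf_def by (rule diag_block_mat_nth(2)[OF l c]) (use that in simp_all)
qed

text \<open>The sign of the real part separates the three kinds of rows. Pairs of different kinds
  vanish by \<open>scaled_gram_cross\<close>, and each diagonal block has its own limit.\<close>

lemma W_inf_limit: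
  assumes p: "p \<in> carrier_vec n"
  shows "mat_tendsto n n (scaled_gram (B_tilde Q p)) (W_inf Q bs p) at_top"
proof (rule mat_tendstoI)
  note B = B_tilde_carrier[OF p]
  let ?ns = "[n_neg, n_zero, n_pos]"
  fix r s assume rs: "r < n" "s < n"
  have ns: "sum_list ?ns = n" using n_split by simp
  obtain i a where i: "i < length ?ns" "a < ?ns ! i" "r = sum_list (take i ?ns) + a"
    using rs(1) unfolding ns[symmetric] by (rule block_index_cases)
  obtain j b where j: "j < length ?ns" "b < ?ns ! j" "s = sum_list (take j ?ns) + b"
    using rs(2) unfolding ns[symmetric] by (rule block_index_cases)
  have W: "W_inf Q bs p $$ (r, s) = (if i = j then [W_neg Q bs p, W_zero Q bs p, W_pos Q bs p] ! i $$ (a, b) else 0)"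
    unfolding i(3) j(3) by (rule W_inf_index) (use i j in simp_all)
  have sgn_row: "sgn (Re (lam (sum_list (take i ?ns) + a))) = [-1, 0, 1] ! i"
    if "i < length ?ns" "a < ?ns ! i" for i a
    using that rows_neg(3)[of a] rows_zero(3)[of a] rows_pos(3)[of a] by (auto simp: less_Suc_eq)
  have "sgn (Re (lam r)) = [-1, 0, 1] ! i" "sgn (Re (lam s)) = [-1, 0, 1] ! j"
    using sgn_row i j by simp_all
  show "((\<lambda>T. scaled_gram (B_tilde Q p) T $$ (r, s)) \<longlongrightarrow> W_inf Q bs p $$ (r, s)) at_top"
  proof (cases "i = j")
    case False
    then have "sgn (Re (lam r)) \<noteq> sgn (Re (lam s))"
      using i(1) j(1) \<open>sgn (Re (lam r)) = _\<close> \<open>sgn (Re (lam s)) = _\<close> by (auto simp: less_Suc_eq)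
    then show ?thesis using scaled_gram_cross[OF B rs] False W by simp
  next
    case True
    then consider "i = 0" "j = 0" | "i = 1" "j = 1" | "i = 2" "j = 2" using i(1) by (auto simp: less_Suc_eq)
    then show ?thesis
    proof cases
      case 1
      then show ?thesis using W_neg_limit[OF p, of a b] i j W by simp
    next
      case 2
      then have rs': "r = n_neg + a" "s = n_neg + b" "a < n_zero" "b < n_zero" using i j by simp_all
      show ?thesis
        using scaled_gram_zero[OF B rs] rows_zero(3)[OF rs'(3)] rows_zero(3)[OF rs'(4)] W W_zero_index[OF rs'(3,4), of p] 2
        unfolding rs'(1,2) by simp
    next
      case 3
      then have rs': "r = n_neg + n_zero + a" "s = n_neg + n_zero + b" "a < n_pos" "b < n_pos"
        using i j by (simp_all add: numeral_2_eq_2)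
      show ?thesis using W_pos_limit[OF p rs'(3,4)] W 3 unfolding rs'(1,2) by (simp add: numeral_2_eq_2)
    qed
  qed
qed (simp_all add: W_inf_carrier)

end

section \<open>The matrix exponential\<close>

text \<open>The terms with \<open>k < d\<close> vanish. After a shift by \<open>d\<close>, the
  identity \<open>(j + d choose d) / (j + d)! = 1 / (d! j!)\<close> leaves the exponential series
  times a constant.\<close>

lemma exp_pow_sums:
  "(\<lambda>k. of_real t ^ k * (of_nat (k choose d) * \<mu> ^ (k - d)) / fact k) sums exp_pow \<mu> d t"
proof -
  define f :: "nat \<Rightarrow> complex" where
    "f k = of_real t ^ k * (of_nat (k choose d) * \<mu> ^ (k - d)) / fact k" for k
  have "(\<lambda>j. (\<mu> * of_real t) ^ j /\<^sub>R fact j * (of_real t ^ d / fact d)) sums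
      (exp (\<mu> * of_real t) * (of_real t ^ d / fact d))"
    by (intro sums_mult2 exp_converges)
  moreover have "(\<mu> * of_real t) ^ j /\<^sub>R fact j * (of_real t ^ d / fact d) = f (j + d)" for j
  proof -
    have "of_nat ((j + d) choose d) = (fact (j + d) / (fact d * fact j) :: complex)"
      by (simp add: binomial_fact)
    then show ?thesis
      by (simp add: f_def scaleR_conv_of_real power_mult_distrib power_add field_simps)
  qed
  ultimately have "(\<lambda>j. f (j + d)) sums exp_pow \<mu> d t" by (simp add: exp_pow_def)
  moreover have "f k = 0" if "k < d" for k using that by (simp add: f_def binomial_eq_0)
  ultimately show ?thesis unfolding f_def[symmetric] by (subst (asm) sums_zero_iff_shift) auto
qed

context jordan_index
begin

text \<open>The binomial expansion of \<open>(lam I + N)^k\<close> in each block; multiplying by one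
  more factor is Pascal's rule.\<close>

lemma jmat_pow_index:
  assumes "r < n" "s < n"
  shows "(jmat ^\<^sub>m k) $$ (r, s) =
    (if bid r = bid s \<and> r \<le> s then of_nat (k choose (s - r)) * lam r ^ (k - (s - r)) else 0)"
  using assms
proof (induction k arbitrary: s)
  case 0
  then show ?case by (auto simp: jmat_def)
next
  case (Suc k)
  have c: "jmat ^\<^sub>m k \<in> carrier_mat n n" by (intro pow_carrier_mat jmat_carrier)
  have step: "(jmat ^\<^sub>m Suc k) $$ (r, s) = (jmat ^\<^sub>m k) $$ (r, s) * lam s +
      (if s \<noteq> 0 \<and> bid (s - 1) = bid s then (jmat ^\<^sub>m k) $$ (r, s - 1) else 0)"
    using mult_jmat_index[OF c Suc.prems] by simp
  note IH = Suc.IH[OF Suc.prems] Suc.IH[OF Suc.prems(1), of "s - 1"]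
  consider "bid r = bid s" "r = s" | "bid r = bid s" "r < s" | "\<not> (bid r = bid s \<and> r \<le> s)" by linarith
  then show ?case
  proof cases
    case 1
    then show ?thesis unfolding step IH(1) using IH(2) Suc.prems by auto
  next
    case 2
    define e where "e = s - r - 1"
    have e: "s - r = Suc e" "s - 1 - r = e" "r \<le> s - 1" "s - 1 < n" using 2 Suc.prems by (auto simp: e_def)
    have b: "bid (s - 1) = bid s" "lam s = lam r"
      using bid_between[of r "s - 1" s] lam_eq[of s r] 2 Suc.prems by auto
    \<comment> \<open>For \<open>k < Suc e\<close> the exponents are truncated, but then the
      binomial coefficient is zero.\<close>
    have "of_nat (k choose Suc e) * lam r ^ (k - Suc e) * lam r = of_nat (k choose Suc e) * lam r ^ (k - e)"
    proof (cases "k < Suc e")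
      case True
      then show ?thesis by (simp add: binomial_eq_0)
    next
      case False
      then have "k - e = Suc (k - Suc e)" by simp
      then show ?thesis by (simp add: mult_ac)
    qed
    then show ?thesis
      unfolding step IH(1) using IH(2) 2 e b by (simp add: algebra_simps)
  next
    case 3
    have "\<not> (bid (s - 1) = bid s \<and> bid r = bid (s - 1) \<and> r \<le> s - 1)" using 3 by auto
    then show ?thesis unfolding step IH(1) using IH(2) 3 Suc.prems by auto
  qed
qed

lemma jexp_sums:
  assumes "r < n" "s < n"
  shows "(\<lambda>k. of_real t ^ k * (jmat ^\<^sub>m k) $$ (r, s) / fact k) sums jexp t $$ (r, s)"
proof (cases "bid r = bid s \<and> r \<le> s")
  case True
  then show ?thesis
    using exp_pow_sums[of t "s - r" "lam r"] by (simp add: jmat_pow_index[OF assms] jexp_index[OF assms])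
next
  case False
  then have z: "(jmat ^\<^sub>m k) $$ (r, s) = 0" "jexp t $$ (r, s) = 0" for k
    unfolding jmat_pow_index[OF assms] jexp_index[OF assms] by (simp_all only: if_False)
  show ?thesis unfolding z by simp
qed

end

lemma index_map_mat_carrier:
  "X \<in> carrier_mat m n \<Longrightarrow> i < m \<Longrightarrow> j < n \<Longrightarrow> map_mat f X $$ (i, j) = f (X $$ (i, j))"
  by auto

lemma map_mat_pow_of_real:
  assumes "X \<in> carrier_mat n n"
  shows "map_mat complex_of_real (X ^\<^sub>m k) = map_mat complex_of_real X ^\<^sub>m k"
  by (rule of_real_hom.mat_hom_pow[OF assms])

lemma smult_pow_mat:
  fixes X :: "'a::comm_ring_1 mat"
  assumes X: "X \<in> carrier_mat n n"
  shows "(c \<cdot>\<^sub>m X) ^\<^sub>m k = c ^ k \<cdot>\<^sub>m (X ^\<^sub>m k)"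
proof (induction k)
  case 0
  show ?case by (rule eq_matI) auto
next
  case (Suc k)
  have P: "X ^\<^sub>m k \<in> carrier_mat n n" using X by (rule pow_carrier_mat)
  have "(c \<cdot>\<^sub>m X) ^\<^sub>m Suc k = (c ^ k \<cdot>\<^sub>m (X ^\<^sub>m k)) * (c \<cdot>\<^sub>m X)" by (simp add: Suc)
  also have "\<dots> = c ^ k \<cdot>\<^sub>m (c \<cdot>\<^sub>m (X ^\<^sub>m k * X))"
    unfolding mult_smult_assoc_mat[OF P smult_carrier_mat[OF X]] mult_smult_distrib[OF P X] ..
  also have "\<dots> = c ^ Suc k \<cdot>\<^sub>m (X ^\<^sub>m Suc k)" by (rule eq_matI) (auto simp: mult_ac)
  finally show ?case .
qed

lemma mult_pow_mat_commute:
  assumes X: "X \<in> carrier_mat n n"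
  shows "X * X ^\<^sub>m k = X ^\<^sub>m k * (X :: 'a::semiring_1 mat)"
proof (induction k)
  case 0
  show ?case using X by simp
next
  case (Suc k)
  have P: "X ^\<^sub>m k \<in> carrier_mat n n" using X by (rule pow_carrier_mat)
  have "X * X ^\<^sub>m Suc k = X * X ^\<^sub>m k * X" using assoc_mult_mat[OF X P X] by simp
  then show ?case using Suc by simp
qed

lemma transpose_pow_mat:
  fixes X :: "'a::comm_semiring_1 mat"
  assumes X: "X \<in> carrier_mat n n"
  shows "transpose_mat X ^\<^sub>m k = transpose_mat (X ^\<^sub>m k)"
proof (induction k)
  case 0
  show ?case using X by simp
next
  case (Suc k)
  have P: "X ^\<^sub>m k \<in> carrier_mat n n" using X by (rule pow_carrier_mat)
  have "transpose_mat X ^\<^sub>m Suc k = transpose_mat (X * X ^\<^sub>m k)"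
    using transpose_mult[OF X P] Suc by simp
  then show ?case using mult_pow_mat_commute[OF X] by simp
qed

lemma mat_exp_carrier: "X \<in> carrier_mat n n \<Longrightarrow> mat_exp X \<in> carrier_mat n n"
  by (simp add: mat_exp_def)

lemma mat_exp_transpose:
  assumes X: "X \<in> carrier_mat n n"
  shows "mat_exp (transpose_mat X) = transpose_mat (mat_exp X)"
  using X pow_carrier_mat[OF X]
  by (intro eq_matI) (auto simp: mat_exp_def transpose_pow_mat[OF X])

lemma quad_form_diag:
  assumes p: "p \<in> carrier_vec n" and v: "v \<in> carrier_vec n"
  shows "quad_form (map_mat complex_of_real (diag_of_vec p)) v = of_real (\<Sum>i<n. p $ i * (cmod (v $ i))\<^sup>2)"
proof -
  have c: "map_mat complex_of_real (diag_of_vec p) \<in> carrier_mat n n"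
    using p by (auto simp: diag_of_vec_def mat_diag_def)
  have "quad_form (map_mat complex_of_real (diag_of_vec p)) v =
      (\<Sum>i<n. \<Sum>j<n. if j = i then of_real (p $ i) * (v $ i * cnj (v $ i)) else 0)"
    unfolding quad_form_sum[OF c v] using p
    by (intro sum.cong refl) (auto simp: diag_of_vec_def mat_diag_def)
  then show ?thesis by (simp add: complex_norm_square[symmetric] flip: of_real_power of_real_mult)
qed

lemma pos_semidef_diag:
  assumes p: "p \<in> prob_simplex n"
  shows "pos_semidef n (map_mat complex_of_real (diag_of_vec p))"
  unfolding pos_semidef_def
proof (intro conjI ballI)
  note P = prob_simplexD[OF p]
  show "map_mat complex_of_real (diag_of_vec p) \<in> carrier_mat n n"
    using P(1) by (auto simp: diag_of_vec_def mat_diag_def)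
  show "mat_adjoint (map_mat complex_of_real (diag_of_vec p)) = map_mat complex_of_real (diag_of_vec p)"
    by (rule eq_matI) (auto simp: diag_of_vec_def mat_diag_def)
  fix v :: "complex Matrix.vec" assume v: "v \<in> carrier_vec n"
  show "0 \<le> quad_form (map_mat complex_of_real (diag_of_vec p)) v"
    unfolding quad_form_diag[OF P(1) v] using P(3) by (auto simp: less_eq_complex_def intro!: sum_nonneg)
qed

context jordan_gramian
begin

text \<open>Entry by entry, \<open>A^k = Q J^k Q^-1\<close> turns the exponential series of
  \<open>A\<close> into finite combinations of the series in \<open>jexp_sums\<close>.\<close>

lemma mat_exp_eq: "map_mat complex_of_real (mat_exp (t \<cdot>\<^sub>m A)) = Q * jexp t * Qi"
proof (rule eq_matI)
  have tA: "t \<cdot>\<^sub>m A \<in> carrier_mat n n" using A by simp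
  let ?cA = "map_mat complex_of_real A"
  have cA: "?cA \<in> carrier_mat n n" using A by simp
  have Jn: "Qi * ?cA * Q = jmat" using J jordan_matrix_bs by simp
  have "Q * jmat * Qi = Q * Qi * ?cA * (Q * Qi)"
    unfolding Jn[symmetric] using Q Qi(1) cA by (simp add: assoc_mult_mat[of _ n n _ n _ n])
  then have cA_eq: "?cA = Q * jmat * Qi" using Qi cA by simp
  have wit: "similar_mat_wit ?cA jmat Q Qi"
    using Q Qi cA cA_eq by (auto simp: similar_mat_wit_def Let_def simp del: assoc_mult_mat)
  have QJ: "Q * jmat ^\<^sub>m k \<in> carrier_mat n n" "jmat ^\<^sub>m k \<in> carrier_mat n n" for k
    using Q pow_carrier_mat[OF jmat_carrier] by (auto intro: mult_carrier_mat)
  have QE: "Q * jexp t \<in> carrier_mat n n" using Q jexp_carrier by (rule mult_carrier_mat)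
  fix i j assume "i < dim_row (Q * jexp t * Qi)" "j < dim_col (Q * jexp t * Qi)"
  then have ij: "i < n" "j < n" using Q Qi by auto
  have entry: "complex_of_real (((t \<cdot>\<^sub>m A) ^\<^sub>m k) $$ (i, j) / fact k) =
      (\<Sum>s<n. (\<Sum>r<n. Q $$ (i, r) * (of_real t ^ k * (jmat ^\<^sub>m k) $$ (r, s) / fact k)) * Qi $$ (s, j))" for k
  proof -
    have "complex_of_real ((A ^\<^sub>m k) $$ (i, j)) = (map_mat complex_of_real (A ^\<^sub>m k)) $$ (i, j)"
      by (rule index_map_mat_carrier[OF pow_carrier_mat[OF A] ij, symmetric])
    also have "\<dots> = (Q * jmat ^\<^sub>m k * Qi) $$ (i, j)"
      unfolding map_mat_pow_of_real[OF A] similar_mat_wit_pow_id[OF wit] ..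
    also have "\<dots> = (\<Sum>s<n. (\<Sum>r<n. Q $$ (i, r) * (jmat ^\<^sub>m k) $$ (r, s)) * Qi $$ (s, j))"
      unfolding index_mult_sum[OF QJ(1) Qi(1) ij]
      by (intro sum.cong refl) (use index_mult_sum[OF Q QJ(2) ij(1)] in simp)
    finally show ?thesis
      unfolding smult_pow_mat[OF A] using ij carrier_matD[OF pow_carrier_mat[OF A, of k]]
      by (simp add: sum_distrib_left sum_divide_distrib sum_distrib_right mult_ac del: pow_mat_dim)
  qed
  have "(\<lambda>k. complex_of_real (((t \<cdot>\<^sub>m A) ^\<^sub>m k) $$ (i, j) / fact k)) sums
      (\<Sum>s<n. (\<Sum>r<n. Q $$ (i, r) * jexp t $$ (r, s)) * Qi $$ (s, j))"
    unfolding entry by (intro sums_sum sums_mult2 sums_mult jexp_sums) auto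
  also have "(\<Sum>s<n. (\<Sum>r<n. Q $$ (i, r) * jexp t $$ (r, s)) * Qi $$ (s, j)) = (Q * jexp t * Qi) $$ (i, j)"
    unfolding index_mult_sum[OF QE Qi(1) ij]
    by (intro sum.cong refl) (use index_mult_sum[OF Q jexp_carrier ij(1)] in simp)
  finally have s: "(\<lambda>k. complex_of_real (((t \<cdot>\<^sub>m A) ^\<^sub>m k) $$ (i, j) / fact k)) sums (Q * jexp t * Qi) $$ (i, j)" .
  \<comment> \<open>A divergent series would have an arbitrary value in \<open>mat_exp\<close>;
    convergence of the real series is inferred from its complex image.\<close>
  then have "summable (\<lambda>k. ((t \<cdot>\<^sub>m A) ^\<^sub>m k) $$ (i, j) / fact k)"
    using sums_summable summable_complex_of_real by blast
  then have "(\<lambda>k. complex_of_real (((t \<cdot>\<^sub>m A) ^\<^sub>m k) $$ (i, j) / fact k)) sums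
      of_real (\<Sum>k. ((t \<cdot>\<^sub>m A) ^\<^sub>m k) $$ (i, j) / fact k)"
    by (intro sums_of_real summable_sums)
  then show "map_mat complex_of_real (mat_exp (t \<cdot>\<^sub>m A)) $$ (i, j) = (Q * jexp t * Qi) $$ (i, j)"
    using s A ij by (simp add: mat_exp_def sums_unique2 del: assoc_mult_mat)
qed (use A Q Qi in \<open>auto simp: mat_exp_def\<close>)

section \<open>The scaled Gramian as a congruence of the finite-horizon Gramian\<close>

definition state_exp :: "real \<Rightarrow> complex mat" where
  "state_exp t = Q * jexp t * Qi"

lemma state_exp_continuous: "mat_continuous n n state_exp"
  unfolding state_exp_def[abs_def]
  by (intro mat_continuous_mult[of n n _ n] mat_continuous_const jexp_continuous Q Qi(1))

lemma W_fin_carrier: "W_fin A T p \<in> carrier_mat n n"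
  using A by (simp add: W_fin_def)

lemma W_fin_eq:
  assumes p: "p \<in> carrier_vec n"
  shows "map_mat complex_of_real (W_fin A T p) = mat_integral n n T
    (\<lambda>t. state_exp t * map_mat complex_of_real (diag_of_vec p) * mat_adjoint (state_exp t))"
proof (rule eq_matI)
  let ?D = "map_mat complex_of_real (diag_of_vec p)"
  let ?g = "\<lambda>t. state_exp t * ?D * mat_adjoint (state_exp t)"
  let ?f = "\<lambda>t. mat_exp (t \<cdot>\<^sub>m A) * diag_of_vec p * mat_exp (t \<cdot>\<^sub>m transpose_mat A)"
  have gc: "mat_continuous n n ?g"
    by (rule mat_continuous_mult[OF mat_continuous_mult[OF state_exp_continuous
            mat_continuous_const[OF diag_of_vec_carrier[OF p]]] mat_continuous_adjoint[OF state_exp_continuous]])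
  fix i j assume "i < dim_row (mat_integral n n T ?g)" "j < dim_col (mat_integral n n T ?g)"
  then have ij: "i < n" "j < n" by (auto simp: mat_integral_def)
  have Dc: "diag_of_vec p \<in> carrier_mat n n" using p by (auto simp: diag_of_vec_def mat_diag_def)
  have tA: "t \<cdot>\<^sub>m A \<in> carrier_mat n n" for t using A by simp
  have fg: "complex_of_real (?f t $$ (i, j)) = ?g t $$ (i, j)" for t
  proof -
    note E = mat_exp_carrier[OF tA, of t]
    have Et: "transpose_mat (mat_exp (t \<cdot>\<^sub>m A)) \<in> carrier_mat n n" using E by simp
    have "t \<cdot>\<^sub>m transpose_mat A = transpose_mat (t \<cdot>\<^sub>m A)" by (rule eq_matI) auto
    then have tr: "mat_exp (t \<cdot>\<^sub>m transpose_mat A) = transpose_mat (mat_exp (t \<cdot>\<^sub>m A))"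
      using mat_exp_transpose[OF tA] by simp
    \<comment> \<open>The exponential of \<open>t A\<close> is real, so its transpose is its
      conjugate transpose.\<close>
    have ad: "map_mat complex_of_real (transpose_mat (mat_exp (t \<cdot>\<^sub>m A))) = mat_adjoint (state_exp t)"
      unfolding state_exp_def mat_exp_eq[symmetric] by (rule eq_matI) auto
    have "complex_of_real (?f t $$ (i, j)) = map_mat complex_of_real (?f t) $$ (i, j)"
      unfolding tr
      by (rule index_map_mat_carrier[OF mult_carrier_mat[OF mult_carrier_mat[OF E Dc] Et] ij, symmetric])
    also have "map_mat complex_of_real (?f t) = ?g t"
      unfolding tr of_real_hom.mat_hom_mult[OF mult_carrier_mat[OF E Dc] Et] of_real_hom.mat_hom_mult[OF E Dc]
        ad mat_exp_eq state_exp_def ..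
    finally show ?thesis .
  qed
  have "(\<lambda>t. Re (?g t $$ (i, j))) integrable_on {0..T}"
    using mat_continuousD(2)[OF gc ij] by (intro integrable_continuous_interval continuous_on_Re)
  then have "(\<lambda>t. ?f t $$ (i, j)) integrable_on {0..T}"
    unfolding fg[symmetric] by (simp del: assoc_mult_mat index_mult_mat(1))
  then have "((\<lambda>t. ?f t $$ (i, j)) has_integral integral {0..T} (\<lambda>t. ?f t $$ (i, j))) {0..T}"
    by (rule integrable_integral)
  then have "(complex_of_real \<circ> (\<lambda>t. ?f t $$ (i, j)) has_integral
      complex_of_real (integral {0..T} (\<lambda>t. ?f t $$ (i, j)))) {0..T}"
    by (rule has_integral_linear[OF _ bounded_linear_of_real])
  then have "integral {0..T} (\<lambda>t. ?g t $$ (i, j)) = of_real (integral {0..T} (\<lambda>t. ?f t $$ (i, j)))"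
    unfolding o_def fg by (rule integral_unique)
  then show "map_mat complex_of_real (W_fin A T p) $$ (i, j) = mat_integral n n T ?g $$ (i, j)"
    using ij A by (simp add: W_fin_def del: assoc_mult_mat index_mult_mat(1))
qed (use A in \<open>auto simp: W_fin_def mat_integral_def\<close>)

definition G :: "real \<Rightarrow> complex mat" where
  "G T = scaling T * Qi"

lemma G_carrier: "G T \<in> carrier_mat n n"
  unfolding G_def using scaling_carrier Qi(1) by (rule mult_carrier_mat)

lemma det_Qi: "det Qi \<noteq> 0"
proof -
  have "det Qi * det Q = 1" using det_mult[OF Qi(1) Q] Qi(2) by simp
  then show ?thesis by auto
qed

lemma det_G: "0 < T \<Longrightarrow> det (G T) \<noteq> 0"
  unfolding G_def det_mult[OF scaling_carrier Qi(1)] using scaling_det det_Qi by simp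

lemma G_state_exp: "G T * state_exp t = scaled_exp T t * Qi"
proof -
  have EQ: "jexp t * Qi \<in> carrier_mat n n" using jexp_carrier Qi(1) by (rule mult_carrier_mat)
  have "G T * state_exp t = scaling T * (Qi * (Q * (jexp t * Qi)))"
    unfolding G_def state_exp_def assoc_mult_mat[OF Q jexp_carrier Qi(1)]
    by (rule assoc_mult_mat[OF scaling_carrier Qi(1) mult_carrier_mat[OF Q EQ]])
  also have "Qi * (Q * (jexp t * Qi)) = jexp t * Qi"
    unfolding assoc_mult_mat[OF Qi(1) Q EQ, symmetric] Qi(2) by (rule left_mult_one_mat[OF EQ])
  also have "scaling T * (jexp t * Qi) = scaling T * jexp t * Qi"
    by (rule assoc_mult_mat[OF scaling_carrier jexp_carrier Qi(1), symmetric])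
  finally show ?thesis unfolding scaling_mult_jexp .
qed

text \<open>The identity holds under the integral sign, as
  \<open>G T * state_exp t = scaled_exp T t * Qi\<close>; the matrix \<open>G T\<close> is constant
  in \<open>t\<close> and leaves the integral on both sides.\<close>

lemma scaled_gram_eq:
  assumes p: "p \<in> carrier_vec n"
  shows "scaled_gram (B_tilde Q p) T = G T * map_mat complex_of_real (W_fin A T p) * mat_adjoint (G T)"
proof -
  let ?D = "map_mat complex_of_real (diag_of_vec p)"
  note D = diag_of_vec_carrier[OF p]
  let ?g = "\<lambda>t. state_exp t * ?D * mat_adjoint (state_exp t)"
  have gc: "mat_continuous n n ?g"
    by (rule mat_continuous_mult[OF mat_continuous_mult[OF state_exp_continuous
            mat_continuous_const[OF D]] mat_continuous_adjoint[OF state_exp_continuous]])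
  note Ggc = mat_continuous_mult[OF mat_continuous_const[OF G_carrier] gc]
  have Ga: "mat_adjoint (G T) \<in> carrier_mat n n" using G_carrier by simp
  have "G T * ?g t * mat_adjoint (G T) =
      scaled_exp T t * B_tilde Q p * mat_adjoint (scaled_exp T t)" for t
  proof -
    have E: "state_exp t \<in> carrier_mat n n" using mat_continuousD(1)[OF state_exp_continuous] .
    have Ea: "mat_adjoint (state_exp t) \<in> carrier_mat n n" and Qa: "mat_adjoint Qi \<in> carrier_mat n n"
      and Fa: "mat_adjoint (scaled_exp T t) \<in> carrier_mat n n" using E Qi(1) by simp_all
    have "G T * ?g t * mat_adjoint (G T) = (G T * state_exp t) * ?D * (mat_adjoint (state_exp t) * mat_adjoint (G T))"
      using G_carrier[of T] E D Ea Ga by (simp add: assoc_mult_mat[of _ n n _ n _ n])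
    also have "mat_adjoint (state_exp t) * mat_adjoint (G T) = mat_adjoint (G T * state_exp t)"
      using mat_adjoint_mult[OF G_carrier E] by simp
    also have "(G T * state_exp t) * ?D * mat_adjoint (G T * state_exp t) =
        (scaled_exp T t * Qi) * ?D * (mat_adjoint Qi * mat_adjoint (scaled_exp T t))"
      unfolding G_state_exp mat_adjoint_mult[OF scaled_exp_carrier Qi(1)] ..
    also have "\<dots> = scaled_exp T t * B_tilde Q p * mat_adjoint (scaled_exp T t)"
      unfolding B_tilde_def using scaled_exp_carrier[of T t] Qi(1) D Qa Fa
      by (simp add: assoc_mult_mat[of _ n n _ n _ n])
    finally show ?thesis .
  qed
  then show ?thesis
    unfolding scaled_gram_def W_fin_eq[OF p] mat_integral_mult_left[OF gc G_carrier]
      mat_integral_mult_right[OF Ggc Ga] by simp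
qed

lemma pos_semidef_B_tilde: "p \<in> prob_simplex n \<Longrightarrow> pos_semidef n (B_tilde Q p)"
  unfolding B_tilde_def by (rule pos_semidef_congruence[OF pos_semidef_diag Qi(1)])

lemma B_tilde_index:
  assumes p: "p \<in> carrier_vec n" and cd: "c < n" "d < n"
  shows "B_tilde Q p $$ (c, d) = (\<Sum>l<n. of_real (p $ l) * (Qi $$ (c, l) * cnj (Qi $$ (d, l))))"
proof -
  note D = diag_of_vec_carrier[OF p]
  have "B_tilde Q p $$ (c, d) = (\<Sum>a<n. \<Sum>b<n. map_mat complex_of_real (diag_of_vec p) $$ (a, b) *
      (Qi $$ (c, a) * cnj (Qi $$ (d, b))))"
    unfolding B_tilde_def by (rule index_mult_mult_adjoint[OF Qi(1) D Qi(1) cd])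
  also have "\<dots> = (\<Sum>a<n. \<Sum>b<n. if b = a then of_real (p $ a) * (Qi $$ (c, a) * cnj (Qi $$ (d, a))) else 0)"
    using p by (intro sum.cong refl) (auto simp: diag_of_vec_def mat_diag_def)
  finally show ?thesis by simp
qed

text \<open>Expresses the dependence on \<open>p\<close> through the \<open>n\<close> fixed
  functions of \<open>T\<close> that belong to the unit vectors. This is what allows
  \<open>p\<close> to vary along with \<open>T\<close> in
  \<open>scaled_gram_tendsto\<close>.\<close>

lemma scaled_gram_linear:
  assumes p: "p \<in> carrier_vec n" and rs: "r < n" "s < n"
  shows "scaled_gram (B_tilde Q p) T $$ (r, s) =
    (\<Sum>l<n. of_real (p $ l) * scaled_gram (B_tilde Q (unit_vec n l)) T $$ (r, s))"
proof -
  let ?I = "\<lambda>c d. integral {0..T} (\<lambda>t. scaled_exp T t $$ (r, c) * cnj (scaled_exp T t $$ (s, d)))"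
  have unit: "B_tilde Q (unit_vec n l) $$ (c, d) = Qi $$ (c, l) * cnj (Qi $$ (d, l))"
    if "l < n" "c < n" "d < n" for l c d
  proof -
    have "B_tilde Q (unit_vec n l) $$ (c, d) = (\<Sum>k<n. if k = l then Qi $$ (c, l) * cnj (Qi $$ (d, l)) else 0)"
      unfolding B_tilde_index[OF unit_vec_carrier that(2,3)] using that(1)
      by (intro sum.cong refl) (auto simp: unit_vec_def)
    then show ?thesis using that(1) by simp
  qed
  have B: "B_tilde Q p $$ (c, d) = (\<Sum>l<n. of_real (p $ l) * B_tilde Q (unit_vec n l) $$ (c, d))"
    if "c < n" "d < n" for c d
    unfolding B_tilde_index[OF p that] using unit[OF _ that] by (intro sum.cong refl) simp
  have "scaled_gram (B_tilde Q p) T $$ (r, s) =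
      (\<Sum>c<n. \<Sum>d<n. \<Sum>l<n. of_real (p $ l) * (B_tilde Q (unit_vec n l) $$ (c, d) * ?I c d))"
    unfolding scaled_gram_index[OF B_tilde_carrier[OF p] rs]
    by (intro sum.cong refl) (simp add: B sum_distrib_right mult.assoc)
  also have "\<dots> = (\<Sum>c<n. \<Sum>l<n. \<Sum>d<n. of_real (p $ l) * (B_tilde Q (unit_vec n l) $$ (c, d) * ?I c d))"
    by (intro sum.cong refl sum.swap)
  also have "\<dots> = (\<Sum>l<n. \<Sum>c<n. \<Sum>d<n. of_real (p $ l) * (B_tilde Q (unit_vec n l) $$ (c, d) * ?I c d))"
    by (rule sum.swap)
  also have "\<dots> = (\<Sum>l<n. of_real (p $ l) * scaled_gram (B_tilde Q (unit_vec n l)) T $$ (r, s))"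
    by (intro sum.cong refl)
      (simp add: scaled_gram_index[OF B_tilde_carrier[OF unit_vec_carrier] rs] sum_distrib_left)
  finally show ?thesis .
qed

text \<open>\<open>W_inf\<close> involves definite descriptions, so linearity is inherited from the
  scaled Gramian by uniqueness of limits instead of being read off from the definition.\<close>

lemma W_inf_linear:
  assumes p: "p \<in> carrier_vec n" and rs: "r < n" "s < n"
  shows "W_inf Q bs p $$ (r, s) = (\<Sum>l<n. of_real (p $ l) * W_inf Q bs (unit_vec n l) $$ (r, s))"
proof (rule tendsto_unique)
  show "((\<lambda>T. scaled_gram (B_tilde Q p) T $$ (r, s)) \<longlongrightarrow> W_inf Q bs p $$ (r, s)) at_top"
    by (rule mat_tendstoD(3)[OF W_inf_limit[OF p] rs])
  show "((\<lambda>T. scaled_gram (B_tilde Q p) T $$ (r, s)) \<longlongrightarrow>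
      (\<Sum>l<n. of_real (p $ l) * W_inf Q bs (unit_vec n l) $$ (r, s))) at_top"
    unfolding scaled_gram_linear[OF p rs]
    by (intro tendsto_sum tendsto_mult tendsto_const mat_tendstoD(3)[OF W_inf_limit[OF unit_vec_carrier] rs])
qed simp

lemma scaled_gram_tendsto:
  assumes p: "\<And>k. ps k \<in> carrier_vec n" and q: "q \<in> carrier_vec n"
    and lim: "\<And>i. i < n \<Longrightarrow> (\<lambda>k. ps k $ i) \<longlonglongrightarrow> q $ i" and \<tau>: "filterlim \<tau> at_top sequentially"
  shows "mat_tendsto n n (\<lambda>k. scaled_gram (B_tilde Q (ps k)) (\<tau> k)) (W_inf Q bs q) sequentially"
proof (rule mat_tendstoI)
  fix r s assume rs: "r < n" "s < n"
  show "(\<lambda>k. scaled_gram (B_tilde Q (ps k)) (\<tau> k) $$ (r, s)) \<longlonglongrightarrow> W_inf Q bs q $$ (r, s)"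
    unfolding scaled_gram_linear[OF p rs] W_inf_linear[OF q rs]
    by (intro tendsto_sum tendsto_mult tendsto_of_real
        filterlim_compose[OF mat_tendstoD(3)[OF W_inf_limit[OF unit_vec_carrier] rs] \<tau>]) (simp add: lim)
qed (simp_all add: W_inf_carrier)

text \<open>At the uniform distribution \<open>B_tilde Q u\<close> is \<open>1 / n\<close> times
  \<open>Q^-1 Q^-*\<close>, which is coercive. By \<open>scaled_gram_coercive\<close> the form of
  the scaled Gramian at each nonzero \<open>x\<close> stays above a positive constant, and so does
  its limit.\<close>

lemma pos_def_W_inf_uniform:
  assumes "0 < n"
  defines "u \<equiv> Matrix.vec n (\<lambda>_. 1 / real n)"
  shows "u \<in> prob_simplex n" "pos_def (W_inf Q bs u)"
proof -
  show us: "u \<in> prob_simplex n" using assms(1) by (auto simp: prob_simplex_def u_def)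
  have uc: "u \<in> carrier_vec n" by (simp add: u_def)
  note B = B_tilde_carrier[OF uc] and D = diag_of_vec_carrier[OF uc]
  have Qa: "mat_adjoint Q \<in> carrier_mat n n" and Qia: "mat_adjoint Qi \<in> carrier_mat n n" using Q Qi(1) by simp_all
  \<comment> \<open>The squared Frobenius norm of \<open>Q\<close>, by Cauchy-Schwarz a bound for
    the squared norm of \<open>Q^* z\<close> in terms of that of \<open>z\<close>; adding 1 makes
    positivity immediate.\<close>
  define K where "K = (\<Sum>i<n. \<Sum>k<n. (cmod (Q $$ (k, i)))\<^sup>2) + 1"
  have K: "0 < K" unfolding K_def by (intro add_nonneg_pos sum_nonneg) auto
  have ge: "1 / (real n * K) * (\<Sum>i<n. (cmod (y $ i))\<^sup>2) \<le> Re (quad_form (B_tilde Q u) y)"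
    if y: "y \<in> carrier_vec n" for y
  proof -
    define z where "z = mat_adjoint Qi *\<^sub>v y"
    have z: "z \<in> carrier_vec n" unfolding z_def using Qia y by (rule mult_mat_vec_carrier)
    have "mat_adjoint Q *\<^sub>v z = mat_adjoint Q * mat_adjoint Qi *\<^sub>v y"
      unfolding z_def using assoc_mult_mat_vec[OF Qa Qia y] by simp
    also have "mat_adjoint Q * mat_adjoint Qi = 1\<^sub>m n"
      using mat_adjoint_mult[OF Qi(1) Q] Qi(2) by simp
    finally have yz: "y = mat_adjoint Q *\<^sub>v z" using y by simp
    define N where "N = (\<Sum>k<n. (cmod (z $ k))\<^sup>2)"
    have N: "0 \<le> N" unfolding N_def by (intro sum_nonneg) auto
    have "(cmod (y $ i))\<^sup>2 \<le> (\<Sum>k<n. (cmod (Q $$ (k, i)))\<^sup>2) * N" if i: "i < n" for i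
    proof -
      have "y $ i = (\<Sum>k<n. cnj (Q $$ (k, i)) * z $ k)"
        using index_mult_vec_sum[OF Qa z i] i Q unfolding yz[symmetric] by simp
      then have "cmod (y $ i) \<le> (\<Sum>k<n. cmod (Q $$ (k, i)) * cmod (z $ k))"
        using norm_sum[of "\<lambda>k. cnj (Q $$ (k, i)) * z $ k" "{..<n}"] by (simp add: norm_mult)
      then have "(cmod (y $ i))\<^sup>2 \<le> (\<Sum>k<n. cmod (Q $$ (k, i)) * cmod (z $ k))\<^sup>2"
        by (intro power_mono) auto
      also have "\<dots> \<le> (\<Sum>k<n. (cmod (Q $$ (k, i)))\<^sup>2) * (\<Sum>k<n. (cmod (z $ k))\<^sup>2)"
        by (rule Cauchy_Schwarz_ineq_sum)
      finally show ?thesis unfolding N_def .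
    qed
    then have "(\<Sum>i<n. (cmod (y $ i))\<^sup>2) \<le> (\<Sum>i<n. (\<Sum>k<n. (cmod (Q $$ (k, i)))\<^sup>2) * N)"
      by (intro sum_mono) auto
    also have "\<dots> \<le> K * N" using N by (simp add: K_def sum_distrib_right[symmetric] distrib_right)
    finally have "(\<Sum>i<n. (cmod (y $ i))\<^sup>2) \<le> K * N" .
    then have "1 / (real n * K) * (\<Sum>i<n. (cmod (y $ i))\<^sup>2) \<le> 1 / (real n * K) * (K * N)"
      using K by (intro mult_left_mono) auto
    also have "\<dots> = 1 / real n * N" using K by simp
    also have "\<dots> = Re (quad_form (map_mat complex_of_real (diag_of_vec u)) z)"
      unfolding quad_form_diag[OF uc z] N_def by (simp add: u_def sum_distrib_left)
    also have "quad_form (map_mat complex_of_real (diag_of_vec u)) z = quad_form (B_tilde Q u) y"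
      unfolding B_tilde_def z_def by (rule quad_form_congruence[OF Qi(1) D y, symmetric])
    finally show ?thesis .
  qed
  have eps: "0 < 1 / (real n * K)" using K assms(1) by simp
  note lim = W_inf_limit[OF uc]
  have psd: "pos_semidef n (W_inf Q bs u)"
    by (rule pos_semidef_limit[OF lim pos_semidef_scaled_gram[OF pos_semidef_B_tilde[OF us]]]) simp
  have "0 < quad_form (W_inf Q bs u) x" if x: "x \<in> carrier_vec n" "x \<noteq> 0\<^sub>v n" for x
  proof -
    obtain \<delta> where \<delta>: "0 < \<delta>" "\<And>T. 1 \<le> T \<Longrightarrow> \<delta> \<le> Re (quad_form (scaled_gram (B_tilde Q u) T) x)"
      using scaled_gram_coercive[OF B eps ge x] by blast
    have "((\<lambda>T. Re (quad_form (scaled_gram (B_tilde Q u) T) x)) \<longlongrightarrow> Re (quad_form (W_inf Q bs u) x)) at_top"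
      unfolding quad_form_sum[OF scaled_gram_carrier x(1)] quad_form_sum[OF W_inf_carrier x(1)]
      by (intro tendsto_Re tendsto_sum tendsto_mult tendsto_const mat_tendstoD(3)[OF lim]) auto
    then have "\<delta> \<le> Re (quad_form (W_inf Q bs u) x)"
      by (rule tendsto_lowerbound) (use \<delta>(2) in \<open>auto intro: eventually_mono[OF eventually_ge_at_top[of 1]]\<close>)
    moreover have "0 \<le> quad_form (W_inf Q bs u) x" using psd x by (simp add: pos_semidef_def)
    ultimately show ?thesis using \<delta>(1) by (auto simp: less_complex_def less_eq_complex_def)
  qed
  then show "pos_def (W_inf Q bs u)"
    using psd by (simp add: pos_def_quad_form[OF W_inf_carrier] pos_semidef_def)
qed

section \<open>Embedding of the stable coordinates\<close>

definition U :: "complex mat" where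
  "U = mat n n_neg (\<lambda>(i, j). if i = j then 1 else 0)"

lemma n_neg_le: "n_neg \<le> n"
  using n_split by simp

lemma U_carrier: "U \<in> carrier_mat n n_neg"
  by (simp add: U_def)

lemma U_mult_index:
  assumes "R \<in> carrier_mat n_neg k" "r < n" "c < k"
  shows "(U * R) $$ (r, c) = (if r < n_neg then R $$ (r, c) else 0)"
proof -
  have "(U * R) $$ (r, c) = (\<Sum>l<n_neg. if l = r then R $$ (r, c) else 0)"
    unfolding index_mult_sum[OF U_carrier assms] using assms by (intro sum.cong refl) (auto simp: U_def)
  then show ?thesis by simp
qed

lemma mult_U_index:
  assumes "R \<in> carrier_mat k n" "r < k" "c < n_neg"
  shows "(R * U) $$ (r, c) = R $$ (r, c)"
proof -
  have "(R * U) $$ (r, c) = (\<Sum>l<n. if l = c then R $$ (r, c) else 0)"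
    unfolding index_mult_sum[OF assms(1) U_carrier assms(2,3)] using assms
    by (intro sum.cong refl) (auto simp: U_def)
  then show ?thesis using assms n_neg_le by simp
qed

lemma U_adjoint_U: "mat_adjoint U * U = 1\<^sub>m n_neg"
proof (rule eq_matI)
  fix i j assume "i < dim_row (1\<^sub>m n_neg)" "j < dim_col (1\<^sub>m n_neg)"
  then have ij: "i < n_neg" "j < n_neg" by auto
  have "mat_adjoint U \<in> carrier_mat n_neg n" using U_carrier by simp
  from mult_U_index[OF this ij] show "(mat_adjoint U * U) $$ (i, j) = 1\<^sub>m n_neg $$ (i, j)"
    using ij n_neg_le by (auto simp: U_def)
qed (auto simp: U_def)

lemma U_U_adjoint: "U * mat_adjoint U = stable_proj"
proof (rule eq_matI)
  fix i j assume "i < dim_row stable_proj" "j < dim_col stable_proj"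
  then have ij: "i < n" "j < n" by (auto simp: stable_proj_def)
  have "mat_adjoint U \<in> carrier_mat n_neg n" using U_carrier by simp
  from U_mult_index[OF this ij] show "(U * mat_adjoint U) $$ (i, j) = stable_proj $$ (i, j)"
    using ij n_neg_le row_sign(1) by (auto simp: U_def stable_proj_def)
qed (auto simp: U_def stable_proj_def)

lemma G_limit: "mat_tendsto n n G (U * (mat_adjoint U * Qi)) at_top"
proof -
  have Ua: "mat_adjoint U \<in> carrier_mat n_neg n" using U_carrier by simp
  have "U * (mat_adjoint U * Qi) = stable_proj * Qi"
    using assoc_mult_mat[OF U_carrier Ua Qi(1)] U_U_adjoint by simp
  then show ?thesis
    unfolding G_def[abs_def] using mat_tendsto_mult[OF scaling_limit mat_tendsto_const[OF Qi(1)]] by simp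
qed

text \<open>Block diagonality: the first \<open>n_neg\<close> columns of \<open>W_inf\<close>
  consist of \<open>W_neg\<close> and zeros.\<close>

lemma W_inf_U: "W_inf Q bs p * U = U * W_neg Q bs p"
proof (rule eq_matI)
  fix r c assume "r < dim_row (U * W_neg Q bs p)" "c < dim_col (U * W_neg Q bs p)"
  then have rc: "r < n" "c < n_neg" using W_neg_carrier[of p] by (auto simp: U_def)
  have ns: "sum_list [n_neg, n_zero, n_pos] = n" using n_split by simp
  obtain i a where i: "i < length [n_neg, n_zero, n_pos]" "a < [n_neg, n_zero, n_pos] ! i"
    "r = sum_list (take i [n_neg, n_zero, n_pos]) + a"
    using rc(1) unfolding ns[symmetric] by (rule block_index_cases)
  have "W_inf Q bs p $$ (r, c) = (if i = 0 then W_neg Q bs p $$ (a, c) else 0)"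
    using W_inf_index[of i a 0 c p] i rc(2) by auto
  moreover have "r < n_neg \<longleftrightarrow> i = 0" using i by (cases i) auto
  ultimately show "(W_inf Q bs p * U) $$ (r, c) = (U * W_neg Q bs p) $$ (r, c)"
    unfolding mult_U_index[OF W_inf_carrier rc] U_mult_index[OF W_neg_carrier rc] using i by auto
qed (use W_inf_carrier[of p] W_neg_carrier[of p] in \<open>auto simp: U_def\<close>)

lemma W_inf_affine:
  assumes p: "p \<in> carrier_vec n" and u: "u \<in> carrier_vec n"
  shows "W_inf Q bs ((1 - e) \<cdot>\<^sub>v p + e \<cdot>\<^sub>v u) =
    of_real (1 - e) \<cdot>\<^sub>m W_inf Q bs p + of_real e \<cdot>\<^sub>m W_inf Q bs u"
proof (rule eq_matI)
  fix r s assume "r < dim_row (of_real (1 - e) \<cdot>\<^sub>m W_inf Q bs p + of_real e \<cdot>\<^sub>m W_inf Q bs u)"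
    "s < dim_col (of_real (1 - e) \<cdot>\<^sub>m W_inf Q bs p + of_real e \<cdot>\<^sub>m W_inf Q bs u)"
  then have rs: "r < n" "s < n" using W_inf_carrier[of u] by auto
  have c: "(1 - e) \<cdot>\<^sub>v p + e \<cdot>\<^sub>v u \<in> carrier_vec n" using p u by simp
  have "W_inf Q bs ((1 - e) \<cdot>\<^sub>v p + e \<cdot>\<^sub>v u) $$ (r, s) =
      of_real (1 - e) * W_inf Q bs p $$ (r, s) + of_real e * W_inf Q bs u $$ (r, s)"
    unfolding W_inf_linear[OF c rs] W_inf_linear[OF p rs] W_inf_linear[OF u rs]
      sum_distrib_left sum.distrib[symmetric]
    using p u by (intro sum.cong refl) (simp add: algebra_simps)
  then show "W_inf Q bs ((1 - e) \<cdot>\<^sub>v p + e \<cdot>\<^sub>v u) $$ (r, s) =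
      (of_real (1 - e) \<cdot>\<^sub>m W_inf Q bs p + of_real e \<cdot>\<^sub>m W_inf Q bs u) $$ (r, s)"
    using rs W_inf_carrier[of p] W_inf_carrier[of u] by simp
qed (use W_inf_carrier[of p] W_inf_carrier[of u] W_inf_carrier[of "(1 - e) \<cdot>\<^sub>v p + e \<cdot>\<^sub>v u"] in auto)

lemma gramian_limit_stable:
  "gramian_limit_stable n (W_fin A) G (W_inf Q bs) (\<lambda>T p. scaled_gram (B_tilde Q p) T)
     n_neg U Qi (W_neg Q bs)"
proof
  show "\<exists>u\<in>prob_simplex n. pos_def (W_inf Q bs u)" if ne: "prob_simplex n \<noteq> {}"
  proof -
    obtain p where p: "p \<in> prob_simplex n" using ne by blast
    have "0 < n" using prob_simplexD(5)[OF p] by (cases n) simp_all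
    then show ?thesis using pos_def_W_inf_uniform by blast
  qed
  show "scaled_gram (B_tilde Q p) T = G T * map_mat complex_of_real (W_fin A T p) * mat_adjoint (G T)"
    if "p \<in> prob_simplex n" for p T
    by (rule scaled_gram_eq[OF prob_simplexD(1)[OF that]])
  show "mat_tendsto n n (\<lambda>k. scaled_gram (B_tilde Q (ps k)) (\<tau> k)) (W_inf Q bs q) sequentially"
    if "\<And>k. ps k \<in> prob_simplex n" "q \<in> prob_simplex n"
      "\<And>i. i < n \<Longrightarrow> (\<lambda>k. ps k $ i) \<longlonglongrightarrow> q $ i" "filterlim \<tau> at_top sequentially" for ps q \<tau>
    by (rule scaled_gram_tendsto[OF prob_simplexD(1)[OF that(1)] prob_simplexD(1)[OF that(2)] that(3,4)])
qed (simp_all add: W_fin_carrier G_carrier det_G prob_simplexD(1) pos_semidef_scaled_gram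
    pos_semidef_B_tilde U_carrier U_adjoint_U Qi(1) det_Qi G_limit W_neg_carrier
    W_inf_U W_inf_affine del: assoc_mult_mat)

text \<open>The padded block matrix is \<open>U\<close> times the inverse of \<open>W_neg\<close>
  times \<open>U^*\<close>. Definiteness is assumed so that \<open>mat_inv\<close> has its meaning
  and its size.\<close>

lemma AECS_objective:
  assumes p: "pos_def (W_neg Q bs p)"
  shows "mat_adjoint Qi * diag_block_mat [mat_inv (W_neg Q bs p), 0\<^sub>m n_zero n_zero, 0\<^sub>m n_pos n_pos] * Qi =
    mat_adjoint (mat_adjoint U * Qi) * mat_inv (W_neg Q bs p) * (mat_adjoint U * Qi)"
proof -
  have "invertible_mat (W_neg Q bs p)"
    using pos_def_det_ne_0[OF W_neg_carrier p] invertible_mat_det[OF W_neg_carrier] by simp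
  note I = mat_inv(1)[OF W_neg_carrier this]
  let ?I = "mat_inv (W_neg Q bs p)"
  let ?ns = "[n_neg, n_zero, n_pos]" and ?As = "[?I, 0\<^sub>m n_zero n_zero, 0\<^sub>m n_pos n_pos]"
  have Ua: "mat_adjoint U \<in> carrier_mat n_neg n" using U_carrier by simp
  have Qia: "mat_adjoint Qi \<in> carrier_mat n n" using Qi(1) by simp
  have IUa: "?I * mat_adjoint U \<in> carrier_mat n_neg n" using I Ua by (rule mult_carrier_mat)
  have l: "length ?As = length ?ns" by simp
  have c: "?As ! i \<in> carrier_mat (?ns ! i) (?ns ! i)" if "i < length ?ns" for i
    using that I by (auto simp: less_Suc_eq)
  have ns: "sum_list ?ns = n" using n_split by simp
  have "diag_block_mat ?As = U * (?I * mat_adjoint U)"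
  proof (rule eq_matI)
    fix r s assume "r < dim_row (U * (?I * mat_adjoint U))" "s < dim_col (U * (?I * mat_adjoint U))"
    then have rs: "r < n" "s < n" by (auto simp: U_def)
    obtain i a where i: "i < length ?ns" "a < ?ns ! i" "r = sum_list (take i ?ns) + a"
      using rs(1) unfolding ns[symmetric] by (rule block_index_cases)
    obtain j b where j: "j < length ?ns" "b < ?ns ! j" "s = sum_list (take j ?ns) + b"
      using rs(2) unfolding ns[symmetric] by (rule block_index_cases)
    have r0: "r < n_neg \<longleftrightarrow> i = 0" using i by (cases i) auto
    have s0: "s < n_neg \<longleftrightarrow> j = 0" using j by (cases j) auto
    have "diag_block_mat ?As $$ (r, s) = (if i = j then ?As ! i $$ (a, b) else 0)"
      unfolding i(3) j(3) by (rule diag_block_mat_nth(2)[OF l c i(1,2) j(1,2)])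
    also have "\<dots> = (if i = 0 \<and> j = 0 then ?I $$ (a, b) else 0)"
      using i j by (auto simp: less_Suc_eq)
    also have "\<dots> = (U * (?I * mat_adjoint U)) $$ (r, s)"
    proof (cases "r < n_neg")
      case True
      have "(?I * mat_adjoint U) $$ (r, s) = (\<Sum>k<n_neg. if k = s then ?I $$ (r, s) else 0)"
        unfolding index_mult_sum[OF I Ua True rs(2)] using rs n_neg_le
        by (intro sum.cong refl) (auto simp: U_def)
      then show ?thesis
        unfolding U_mult_index[OF IUa rs] using True r0 s0 i j by auto
    next
      case False
      then show ?thesis unfolding U_mult_index[OF IUa rs] using r0 by simp
    qed
    finally show "diag_block_mat ?As $$ (r, s) = (U * (?I * mat_adjoint U)) $$ (r, s)" .
  qed (use diag_block_mat_nth(1)[OF l c] ns in \<open>auto simp: U_def simp del: diag_block_mat.simps\<close>)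
  then show ?thesis
    unfolding mat_adjoint_mult[OF Ua Qi(1)] mat_adjoint_adjoint
    using Qia U_carrier I Ua Qi(1)
    by (simp add: assoc_mult_mat[of _ n n _ n_neg _ n_neg] assoc_mult_mat[of _ n n_neg _ n_neg _ n]
        assoc_mult_mat[of _ n_neg n_neg _ n _ n] assoc_mult_mat[of _ n n_neg _ n _ n]
        assoc_mult_mat[of _ n n _ n_neg _ n] assoc_mult_mat[of _ n n _ n _ n] del: diag_block_mat.simps)
qed

end

text \<open>Applied to the two forms of the AECS objective, whose agreement is established on the
  feasible set.\<close>

lemma minimizers_cong:
  assumes "\<And>x. x \<in> S \<Longrightarrow> f x = g x"
  shows "minimizers f S = minimizers g S"
  using assms by (auto simp: minimizers_def is_arg_min_def)

theorem proposition1: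
  fixes A :: "real mat" and Q :: "complex mat" and bs :: "(nat \<times> complex) list" and n :: nat
  assumes A: "A \<in> carrier_mat n n"
    and jordan: "ordered_jordan_decomposition A Q bs"
  shows
    "(\<forall>p. (\<forall>T>0. p T \<in> VCS_fin A T) \<longrightarrow>
        (\<forall>q. cluster_point n p q \<longrightarrow> q \<in> VCS_inf Q bs) \<and>
        ((\<lambda>T. dist_to_set (p T) (VCS_inf Q bs)) \<longlongrightarrow> 0) at_top)
   \<and> ((\<exists>\<mu>. eigenvalue (map_mat complex_of_real A) \<mu> \<and> Re \<mu> < 0) \<longrightarrow>
      (\<forall>p. (\<forall>T>0. p T \<in> AECS_fin A T) \<longrightarrow>
        (\<forall>q. cluster_point n p q \<longrightarrow> q \<in> AECS_inf Q bs) \<and>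
        ((\<lambda>T. dist_to_set (p T) (AECS_inf Q bs)) \<longlongrightarrow> 0) at_top))"
proof -
  interpret jordan_gramian A Q bs n using A jordan by unfold_locales
  interpret lim: gramian_limit_stable n "W_fin A" G "W_inf Q bs" "\<lambda>T p. scaled_gram (B_tilde Q p) T"
    n_neg U Qi "W_neg Q bs" by (rule gramian_limit_stable)
  have dims: "dim_row A = n" "dim_row Q = n" using A Q by auto
  have VCS: "q \<in> VCS_inf Q bs" if "\<forall>T>0. p T \<in> VCS_fin A T" "cluster_point n p q" for p q
    using lim.VCS_cluster_point[OF _ that(2)] that(1) by (simp add: VCS_fin_def VCS_inf_def dims)
  have AECS: "q \<in> AECS_inf Q bs" if "\<forall>T>0. p T \<in> AECS_fin A T" "cluster_point n p q" for p q
  proof -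
    have "q \<in> minimizers lim.AECS_limit {p \<in> prob_simplex n. pos_def (W_neg Q bs p)}"
      using lim.AECS_cluster_point[OF _ that(2)] that(1) by (simp add: AECS_fin_def dims)
    also have "\<dots> = AECS_inf Q bs"
      unfolding AECS_inf_def Let_def dims
      by (rule minimizers_cong) (simp add: lim.AECS_limit_def lim.V_def AECS_objective
          del: diag_block_mat.simps assoc_mult_mat)
    finally show ?thesis .
  qed
  have "((\<lambda>T. dist_to_set (p T) (VCS_inf Q bs)) \<longlongrightarrow> 0) at_top" if p: "\<forall>T>0. p T \<in> VCS_fin A T" for p
    using p VCS[OF p] by (intro dist_to_set_tendsto_0[of _ n])
      (auto simp: VCS_fin_def minimizers_def is_arg_min_def dims)
  moreover have "((\<lambda>T. dist_to_set (p T) (AECS_inf Q bs)) \<longlongrightarrow> 0) at_top" if p: "\<forall>T>0. p T \<in> AECS_fin A T" for p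
    using p AECS[OF p] by (intro dist_to_set_tendsto_0[of _ n])
      (auto simp: AECS_fin_def minimizers_def is_arg_min_def dims)
  ultimately show ?thesis using VCS AECS by blast
qed

end
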